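(* Let $G$ be a $2$-connected cubic graph with $\mathrm{df}(G)=3$ and let $C$ be a hexagonal core of $G$. Then $G$ admits a decomposition $\mathcal{D}=\{G_1,\dots,G_m\}$ (along small independent edge cuts) such that all decomposition factors are cyclically $4$-edge-connected, except possibly $G_1$, and the following hold: (i) $\mathrm{df}(G_1)=3$ and $C$ is a hexagonal core of $G_1$; (ii) each $G_i$ with $i\ge 2$ is $3$-edge-colourable; (iii) if $G_1$ is not cyclically $4$-edge-connected, then it contains a triangle $T$ such that $C$ intersects $T$ and $G_1/T$ (obtained by contracting $T$ to a single vertex) is cyclically $4$-edge-connected. Moreover, $G$ can be reconstructed from $\mathcal{D}$ by repeated application of $2$-sums and $3$-sums.
   Context: Graphs are finite; loops and multiple edges are allowed. A $3$-array of a bridgeless cubic graph $H$ is a set $\mathcal{M}$ of three perfect matchings of $H$; an edge is uncovered if it lies in none of them and simply covered if it lies in exactly one. The colouring defect $\mathrm{df}(H)$ is the minimum number of uncovered edges over all $3$-arrays; a $3$-array attaining it is optimal. The core of $\mathcal{M}$ is the subgraph formed by all edges not simply covered. When $\mathrm{df}(H)=3$ the core of every optimal $3$-array is an induced $6$-cycle, called a hexagonal core. A connected graph is cyclically $k$-edge-connected if removing fewer than $k$ edges cannot produce two components containing circuits. An edge cut is independent if its edges are pairwise non-adjacent, and small if it has $2$ or $3$ edges. For a small independent edge cut $R$ with components $L_1,L_2$ of $G-R$, the completion $\bar L_i$ is $L_i$ plus an edge joining its two $2$-valent vertices (if $|R|=2$) or $L_i$ plus a new vertex adjacent to its three $2$-valent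 vertices (if $|R|=3$); the decomposition along $R$ is $\{\bar L_1,\bar L_2\}$. A decomposition of $G$ is defined recursively: $\{G\}$ is one, and replacing a member by its decomposition along one of its small independent edge cuts gives another. A $2$-sum of $2$-connected cubic graphs $H,K$ with distinguished edges $e,f$ deletes $e,f$ and joins the $2$-valent vertices of $H-e$ to those of $K-f$ by two new independent edges; a $3$-sum with distinguished vertices $u,v$ deletes $u,v$ and joins the three dangling edge-ends formerly at $u$ bijectively to those formerly at $v$. *)

theory Defs
  imports Main "HOL-Library.Multiset"
begin

text \<open>A graph has a vertex set, an edge set (edge labels) and an endpoint map.
  The orientation of the endpoint pair is irrelevant; a loop has equal endpoints.
  Vertex and edge labels are natural numbers, so fresh labels are always available.\<close>

record graph =
  verts :: "nat set"
  edges :: "nat set"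
  ends  :: "nat \<Rightarrow> nat \<times> nat"

definition wf_graph :: "graph \<Rightarrow> bool" where
  "wf_graph G \<longleftrightarrow> finite (verts G) \<and> finite (edges G) \<and>
     (\<forall>e\<in>edges G. fst (ends G e) \<in> verts G \<and> snd (ends G e) \<in> verts G)"

definition incident :: "graph \<Rightarrow> nat \<Rightarrow> nat \<Rightarrow> bool" where
  "incident G e v \<longleftrightarrow> fst (ends G e) = v \<or> snd (ends G e) = v"

text \<open>Degree: a loop contributes 2.\<close>
definition degree :: "graph \<Rightarrow> nat \<Rightarrow> nat" where
  "degree G v = card {e\<in>edges G. fst (ends G e) = v} + card {e\<in>edges G. snd (ends G e) = v}"

definition cubic :: "graph \<Rightarrow> bool" where
  "cubic G \<longleftrightarrow> wf_graph G \<and> (\<forall>v\<in>verts G. degree G v = 3)"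

definition adj :: "graph \<Rightarrow> nat \<Rightarrow> nat \<Rightarrow> bool" where
  "adj G u v \<longleftrightarrow> (\<exists>e\<in>edges G. ends G e = (u, v) \<or> ends G e = (v, u))"

definition reach :: "graph \<Rightarrow> nat \<Rightarrow> nat \<Rightarrow> bool" where
  "reach G = (adj G)\<^sup>*\<^sup>*"

definition connected :: "graph \<Rightarrow> bool" where
  "connected G \<longleftrightarrow> verts G \<noteq> {} \<and> (\<forall>u\<in>verts G. \<forall>v\<in>verts G. reach G u v)"

definition del_edges :: "graph \<Rightarrow> nat set \<Rightarrow> graph" where
  "del_edges G S = G\<lparr>edges := edges G - S\<rparr>"

text \<open>2-connectedness of a cubic graph, taken as 2-edge-connectedness (bridgelessness);
  for cubic graphs vertex- and edge-connectivity coincide.\<close>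
definition two_connected :: "graph \<Rightarrow> bool" where
  "two_connected G \<longleftrightarrow> connected G \<and> (\<forall>e\<in>edges G. connected (del_edges G {e}))"

definition perfect_matching :: "graph \<Rightarrow> nat set \<Rightarrow> bool" where
  "perfect_matching G M \<longleftrightarrow> M \<subseteq> edges G \<and> (\<forall>e\<in>M. fst (ends G e) \<noteq> snd (ends G e)) \<and>
     (\<forall>v\<in>verts G. card {e\<in>M. incident G e v} = 1)"

definition three_array :: "graph \<Rightarrow> nat set set \<Rightarrow> bool" where
  "three_array G A \<longleftrightarrow> card A = 3 \<and> (\<forall>M\<in>A. perfect_matching G M)"

definition cover_count :: "nat set set \<Rightarrow> nat \<Rightarrow> nat" where
  "cover_count A e = card {M\<in>A. e \<in> M}"

definition uncovered :: "graph \<Rightarrow> nat set set \<Rightarrow> nat set" where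
  "uncovered G A = {e\<in>edges G. cover_count A e = 0}"

definition df :: "graph \<Rightarrow> nat" where
  "df G = (LEAST k. \<exists>A. three_array G A \<and> card (uncovered G A) = k)"

definition optimal :: "graph \<Rightarrow> nat set set \<Rightarrow> bool" where
  "optimal G A \<longleftrightarrow> three_array G A \<and> card (uncovered G A) = df G"

definition core :: "graph \<Rightarrow> nat set set \<Rightarrow> nat set" where
  "core G A = {e\<in>edges G. cover_count A e \<noteq> 1}"

definition hexagonal_core :: "graph \<Rightarrow> nat set \<Rightarrow> bool" where
  "hexagonal_core G C \<longleftrightarrow> df G = 3 \<and> (\<exists>A. optimal G A \<and> core G A = C)"

definition three_edge_colourable :: "graph \<Rightarrow> bool" where
  "three_edge_colourable G \<longleftrightarrow> (\<exists>col :: nat \<Rightarrow> nat.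
     (\<forall>e\<in>edges G. col e < 3 \<and> fst (ends G e) \<noteq> snd (ends G e)) \<and>
     (\<forall>e1\<in>edges G. \<forall>e2\<in>edges G. e1 \<noteq> e2 \<and> (\<exists>v. incident G e1 v \<and> incident G e2 v)
        \<longrightarrow> col e1 \<noteq> col e2))"

definition edge_verts :: "graph \<Rightarrow> nat set \<Rightarrow> nat set" where
  "edge_verts G D = {v. \<exists>e\<in>D. incident G e v}"

definition edge_subgraph :: "graph \<Rightarrow> nat set \<Rightarrow> graph" where
  "edge_subgraph G D = \<lparr>verts = edge_verts G D, edges = D, ends = ends G\<rparr>"

definition circuit :: "graph \<Rightarrow> nat set \<Rightarrow> bool" where
  "circuit G D \<longleftrightarrow> D \<subseteq> edges G \<and> D \<noteq> {} \<and> finite D \<and> connected (edge_subgraph G D) \<and>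
     (\<forall>v\<in>edge_verts G D. degree (edge_subgraph G D) v = 2)"

definition cyc_edge_conn :: "nat \<Rightarrow> graph \<Rightarrow> bool" where
  "cyc_edge_conn k G \<longleftrightarrow> connected G \<and>
     (\<forall>S\<subseteq>edges G. card S < k \<longrightarrow>
        \<not> (\<exists>D1 D2 u v. circuit (del_edges G S) D1 \<and> circuit (del_edges G S) D2 \<and>
              u \<in> edge_verts G D1 \<and> v \<in> edge_verts G D2 \<and> \<not> reach (del_edges G S) u v))"

definition induced :: "graph \<Rightarrow> nat set \<Rightarrow> graph" where
  "induced G X = \<lparr>verts = X,
     edges = {e\<in>edges G. fst (ends G e) \<in> X \<and> snd (ends G e) \<in> X}, ends = ends G\<rparr>"

definition crossing :: "graph \<Rightarrow> nat set \<Rightarrow> nat set" where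
  "crossing G X = {e\<in>edges G. (fst (ends G e) \<in> X) \<noteq> (snd (ends G e) \<in> X)}"

definition independent :: "graph \<Rightarrow> nat set \<Rightarrow> bool" where
  "independent G R \<longleftrightarrow> (\<forall>e1\<in>R. \<forall>e2\<in>R. e1 \<noteq> e2 \<longrightarrow> \<not> (\<exists>v. incident G e1 v \<and> incident G e2 v))"

definition small_indep_cut :: "graph \<Rightarrow> nat set \<Rightarrow> nat set \<Rightarrow> bool" where
  "small_indep_cut G R X \<longleftrightarrow> X \<subseteq> verts G \<and> R = crossing G X \<and> card R \<in> {2, 3} \<and>
     independent G R \<and> connected (induced G X) \<and> connected (induced G (verts G - X))"

definition two_valent :: "graph \<Rightarrow> nat set" where
  "two_valent L = {v\<in>verts L. degree L v = 2}"

definition completion :: "graph \<Rightarrow> nat set \<Rightarrow> graph \<Rightarrow> graph \<Rightarrow> bool" where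
  "completion G R L Lb \<longleftrightarrow>
     (card R = 2 \<and> (\<exists>a b e. two_valent L = {a, b} \<and> a \<noteq> b \<and> e \<notin> edges G \<and>
        Lb = \<lparr>verts = verts L, edges = insert e (edges L), ends = (ends L)(e := (a, b))\<rparr>)) \<or>
     (card R = 3 \<and> (\<exists>a1 a2 a3 w e1 e2 e3. two_valent L = {a1, a2, a3} \<and> distinct [a1, a2, a3] \<and>
        w \<notin> verts G \<and> distinct [e1, e2, e3] \<and> {e1, e2, e3} \<inter> edges G = {} \<and>
        Lb = \<lparr>verts = insert w (verts L), edges = edges L \<union> {e1, e2, e3},
               ends = (ends L)(e1 := (w, a1), e2 := (w, a2), e3 := (w, a3))\<rparr>))"

definition split_along_cut :: "graph \<Rightarrow> graph \<Rightarrow> graph \<Rightarrow> bool" where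
  "split_along_cut G H1 H2 \<longleftrightarrow> (\<exists>R X. small_indep_cut G R X \<and>
     completion G R (induced G X) H1 \<and> completion G R (induced G (verts G - X)) H2)"

inductive decomposition :: "graph \<Rightarrow> graph multiset \<Rightarrow> bool" for G where
  base: "decomposition G {#G#}"
| step: "decomposition G D \<Longrightarrow> H \<in># D \<Longrightarrow> split_along_cut H H1 H2 \<Longrightarrow>
           decomposition G (D - {#H#} + {#H1, H2#})"

definition iso :: "graph \<Rightarrow> graph \<Rightarrow> bool" where
  "iso G H \<longleftrightarrow> (\<exists>fv fe. bij_betw fv (verts G) (verts H) \<and> bij_betw fe (edges G) (edges H) \<and>
     (\<forall>e\<in>edges G. ends H (fe e) = (fv (fst (ends G e)), fv (snd (ends G e))) \<or>
                  ends H (fe e) = (fv (snd (ends G e)), fv (fst (ends G e)))))"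

definition two_sum :: "graph \<Rightarrow> graph \<Rightarrow> graph \<Rightarrow> bool" where
  "two_sum H K S \<longleftrightarrow> two_connected H \<and> cubic H \<and> two_connected K \<and> cubic K \<and>
     verts H \<inter> verts K = {} \<and> edges H \<inter> edges K = {} \<and>
     (\<exists>e f g1 g2 h1 h2 k1 k2. e \<in> edges H \<and> f \<in> edges K \<and> ends H e = (h1, h2) \<and>
        (ends K f = (k1, k2) \<or> ends K f = (k2, k1)) \<and> g1 \<noteq> g2 \<and>
        g1 \<notin> edges H \<union> edges K \<and> g2 \<notin> edges H \<union> edges K \<and>
        S = \<lparr>verts = verts H \<union> verts K,
             edges = (edges H - {e}) \<union> (edges K - {f}) \<union> {g1, g2},
             ends = (\<lambda>x. if x \<in> edges H then ends H x else ends K x)(g1 := (h1, k1), g2 := (h2, k2))\<rparr>)"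

definition inc_edges :: "graph \<Rightarrow> nat \<Rightarrow> nat set" where
  "inc_edges G v = {e\<in>edges G. incident G e v}"

definition other_end :: "graph \<Rightarrow> nat \<Rightarrow> nat \<Rightarrow> nat" where
  "other_end G v e = (if fst (ends G e) = v then snd (ends G e) else fst (ends G e))"

text \<open>3-sum: delete u and v and join the dangling edge-ends bijectively (via phi);
  the joining edges keep the labels of the edges formerly at u.\<close>
definition three_sum :: "graph \<Rightarrow> graph \<Rightarrow> graph \<Rightarrow> bool" where
  "three_sum H K S \<longleftrightarrow> two_connected H \<and> cubic H \<and> two_connected K \<and> cubic K \<and>
     verts H \<inter> verts K = {} \<and> edges H \<inter> edges K = {} \<and>
     (\<exists>u v phi. u \<in> verts H \<and> v \<in> verts K \<and> bij_betw phi (inc_edges H u) (inc_edges K v) \<and>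
        S = \<lparr>verts = (verts H - {u}) \<union> (verts K - {v}),
             edges = edges H \<union> (edges K - inc_edges K v),
             ends = (\<lambda>x. if x \<in> inc_edges H u then (other_end H u x, other_end K v (phi x))
                         else if x \<in> edges H then ends H x else ends K x)\<rparr>)"

inductive reconstructs :: "graph multiset \<Rightarrow> graph \<Rightarrow> bool" where
  leaf: "iso H0 H \<Longrightarrow> reconstructs {#H0#} H"
| sum: "reconstructs D1 H \<Longrightarrow> reconstructs D2 K \<Longrightarrow> two_sum H K S \<or> three_sum H K S \<Longrightarrow>
          iso S S' \<Longrightarrow> reconstructs (D1 + D2) S'"

definition contract :: "graph \<Rightarrow> nat set \<Rightarrow> graph" where
  "contract G T = (let VT = edge_verts G T; w = (SOME x. x \<in> VT);
                       m = (\<lambda>x. if x \<in> VT then w else x) in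
     \<lparr>verts = (verts G - VT) \<union> {w}, edges = edges G - T,
      ends = (\<lambda>e. (m (fst (ends G e)), m (snd (ends G e))))\<rparr>)"

end

theory Submission
  imports Defs
begin

text \<open>
  An optimal 3-array assigns to every edge the set of matchings containing it; at every vertex these
  sets partition the three colours. Counting gives \<open>|E0| = |E2| + 2 |E3|\<close> for the numbers of edges
  covered 0, 2 and 3 times. If one matching contains all doubly covered edges, exchanging them in it
  with the uncovered ones yields a 3-edge-colouring; hence at most two uncovered edges already imply
  3-edge-colourability.

  Now induct on the number of vertices. Across a 2-cut, parity makes both cut edges equally covered;
  across a 3-cut whose edges are simply covered the array also restricts to both completions. As
  colourings of the completions could be glued, one completion is not colourable, so it has all three
  uncovered edges and the whole core, and the other one is colourable. In a 3-edge-connected graph a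
  nontrivial 3-cut meeting the core is covered 2, 2 and 1 times, and then on one side it can be
  replaced by a simply covered 3-cut, unless that side is a triangle containing an uncovered edge.
  Two such triangles cannot coexist: a Kempe change would produce a 3-edge-colouring. So contracting
  the only one leaves no nontrivial 3-cut.
\<close>

section \<open>Edge cuts\<close>

text \<open>The surviving factor must have \<open>C\<close> itself as its core, so completions keep
  the labels of inner edges and rename only cut edges. Cuts of size two are split off first: in a
  graph without them, a 3-cut with at least two vertices on each side is a minimum cut and hence
  independent, as a decomposition step demands. The obstacle is coverage 2, 2 and 1: at the new
  vertex of a completion each matching can be used only once, but five incidences would meet there,
  so the array does not restrict and the cut has to be moved. Coverage 2, 1 and 0 does restrict, yet
  it is impossible, since the uncovered edges would be shared so evenly that both completions are
  colourable. Contraction brings back no trouble: a cut of the contracted graph is a cut of the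
  original one that does not separate the triangle, so a nontrivial 3-cut left over would cut off a
  second such triangle. The core is described by cover counts throughout; its shape as a hexagon is
  only worked out when two triangles occur.\<close>

abbreviation star :: "graph \<Rightarrow> nat \<Rightarrow> nat set" where
  "star G v \<equiv> crossing G {v}"

text \<open>An edge crosses a symmetric difference exactly when it crosses one of the two sets but
  not both. Cut sizes are computed from this identity by adding or removing vertices.\<close>

lemma crossing_sym_diff:
  "crossing G ((X - Y) \<union> (Y - X)) =
     (crossing G X - crossing G Y) \<union> (crossing G Y - crossing G X)"
  unfolding crossing_def by auto

lemma crossing_compl: "wf_graph G \<Longrightarrow> crossing G (verts G - X) = crossing G X"
  unfolding crossing_def wf_graph_def by auto

lemma crossing_subset: "crossing G X \<subseteq> edges G"
  unfolding crossing_def by auto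

lemma finite_crossing: "wf_graph G \<Longrightarrow> finite (crossing G X)"
  using crossing_subset unfolding wf_graph_def by (meson finite_subset)

lemma card_sym_diff:
  assumes "finite A" "finite B"
  shows "card ((A - B) \<union> (B - A)) + 2 * card (A \<inter> B) = card A + card B"
proof -
  have "card ((A - B) \<union> (B - A)) = card (A - B) + card (B - A)"
    using assms by (intro card_Un_disjoint) auto
  moreover have "card A = card (A - B) + card (A \<inter> B)"
    using assms(1) by (subst card_Un_disjoint[symmetric]) (auto intro!: arg_cong[where f=card])
  moreover have "card B = card (B - A) + card (A \<inter> B)"
    using assms(2) by (subst card_Un_disjoint[symmetric]) (auto intro!: arg_cong[where f=card])
  ultimately show ?thesis by simp
qed

text \<open>For nested sets the difference is the symmetric difference, and an edge crossing both
  cuts disappears from the new one.\<close>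

lemma card_crossing_diff:
  assumes "wf_graph G" "Y \<subseteq> X"
  shows "card (crossing G (X - Y)) + 2 * card (crossing G X \<inter> crossing G Y)
    = card (crossing G X) + card (crossing G Y)"
proof -
  have "X - Y = (X - Y) \<union> (Y - X)" using assms(2) by auto
  then have "crossing G (X - Y) =
      (crossing G X - crossing G Y) \<union> (crossing G Y - crossing G X)"
    using crossing_sym_diff by metis
  then show ?thesis using card_sym_diff finite_crossing[OF assms(1)] by metis
qed

lemma adj_not_crossing:
  assumes "crossing G X = {}" "adj G u v" "u \<in> X"
  shows "v \<in> X"
  using assms unfolding adj_def crossing_def by force

lemma reach_not_crossing:
  assumes "crossing G X = {}" "reach G u v" "u \<in> X"
  shows "v \<in> X"
  using assms(2)[unfolded reach_def] assms(3)
  by (induction rule: rtranclp_induct) (auto intro: adj_not_crossing[OF assms(1)])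

lemma reach_edge:
  assumes "e \<in> edges G"
  shows "reach G u (fst (ends G e)) \<longleftrightarrow> reach G u (snd (ends G e))"
proof -
  have "adj G (fst (ends G e)) (snd (ends G e))" "adj G (snd (ends G e)) (fst (ends G e))"
    using assms unfolding adj_def by (metis prod.collapse)+
  then show ?thesis unfolding reach_def by (meson rtranclp.rtrancl_into_rtrancl)
qed

lemma crossing_reach_empty: "crossing G {x. reach G u x} = {}"
  unfolding crossing_def using reach_edge by auto

lemma crossing_Int_verts: "wf_graph G \<Longrightarrow> crossing G (X \<inter> verts G) = crossing G X"
  unfolding crossing_def wf_graph_def by auto

text \<open>Reachability and cuts are dual: the set reached from \<open>u\<close> has an empty cut,
  and a set with an empty cut cannot be left. Most later connectivity arguments are phrased through
  cut sizes.\<close>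

lemma connected_iff_crossing:
  assumes "wf_graph G"
  shows "connected G \<longleftrightarrow> verts G \<noteq> {} \<and>
    (\<forall>X. X \<subseteq> verts G \<and> X \<noteq> {} \<and> X \<noteq> verts G \<longrightarrow> crossing G X \<noteq> {})"
proof
  assume c: "connected G"
  show "verts G \<noteq> {} \<and> (\<forall>X. X \<subseteq> verts G \<and> X \<noteq> {} \<and> X \<noteq> verts G \<longrightarrow> crossing G X \<noteq> {})"
  proof (intro conjI allI impI)
    show "verts G \<noteq> {}" using c unfolding connected_def by simp
    fix X assume X: "X \<subseteq> verts G \<and> X \<noteq> {} \<and> X \<noteq> verts G"
    then obtain u v where "u \<in> X" "v \<in> verts G" "v \<notin> X" by auto
    moreover from this have "reach G u v" using c X unfolding connected_def by auto
    ultimately show "crossing G X \<noteq> {}" using reach_not_crossing by metis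
  qed
next
  assume r: "verts G \<noteq> {} \<and>
    (\<forall>X. X \<subseteq> verts G \<and> X \<noteq> {} \<and> X \<noteq> verts G \<longrightarrow> crossing G X \<noteq> {})"
  show "connected G" unfolding connected_def
  proof (intro conjI ballI)
    show "verts G \<noteq> {}" using r by simp
    fix u v assume uv: "u \<in> verts G" "v \<in> verts G"
    let ?X = "{x. reach G u x} \<inter> verts G"
    have "crossing G ?X = {}" using crossing_reach_empty crossing_Int_verts[OF assms] by metis
    moreover have "u \<in> ?X" using uv unfolding reach_def by simp
    moreover have "?X \<subseteq> verts G \<and> ?X \<noteq> {} \<and> ?X \<noteq> verts G \<longrightarrow> crossing G ?X \<noteq> {}"
      using r by (elim conjE) (erule spec)
    ultimately have "?X = verts G" by auto
    then show "reach G u v" using uv by blast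
  qed
qed

section \<open>Bridgeless cubic graphs\<close>

text \<open>Degrees and 2-edge-connectedness are both expressed by cut sizes, so that the
  completions of a side can be checked by counting. A star contains no loops, so loops are excluded
  separately.\<close>

definition bridgeless_cubic :: "graph \<Rightarrow> bool" where
  "bridgeless_cubic G \<longleftrightarrow> wf_graph G \<and> verts G \<noteq> {} \<and>
     (\<forall>e\<in>edges G. fst (ends G e) \<noteq> snd (ends G e)) \<and>
     (\<forall>v\<in>verts G. card (star G v) = 3) \<and>
     (\<forall>X. X \<subseteq> verts G \<and> X \<noteq> {} \<and> X \<noteq> verts G \<longrightarrow> 2 \<le> card (crossing G X))"

lemma degree_eq_card_star:
  assumes "wf_graph G"
  shows "degree G v =
    card (star G v) + 2 * card {e\<in>edges G. fst (ends G e) = v \<and> snd (ends G e) = v}"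
proof -
  let ?L = "{e\<in>edges G. fst (ends G e) = v \<and> snd (ends G e) = v}"
  let ?A = "{e\<in>edges G. fst (ends G e) = v \<and> snd (ends G e) \<noteq> v}"
  let ?B = "{e\<in>edges G. fst (ends G e) \<noteq> v \<and> snd (ends G e) = v}"
  have fin: "finite (edges G)" using assms unfolding wf_graph_def by auto
  have "{e\<in>edges G. fst (ends G e) = v} = ?A \<union> ?L" "{e\<in>edges G. snd (ends G e) = v} = ?B \<union> ?L"
    "star G v = ?A \<union> ?B"
    unfolding crossing_def by auto
  moreover have "card (?A \<union> ?L) = card ?A + card ?L" "card (?B \<union> ?L) = card ?B + card ?L"
    "card (?A \<union> ?B) = card ?A + card ?B"
    using fin by (intro card_Un_disjoint; auto)+
  ultimately show ?thesis unfolding degree_def by simp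
qed

lemma crossing_del_edges: "crossing (del_edges G S) X = crossing G X - S"
  unfolding crossing_def del_edges_def by auto

lemma wf_del_edges: "wf_graph G \<Longrightarrow> wf_graph (del_edges G S)"
  unfolding wf_graph_def del_edges_def by auto

lemma two_connected_iff_crossing:
  assumes "wf_graph G"
  shows "two_connected G \<longleftrightarrow> verts G \<noteq> {} \<and>
    (\<forall>X. X \<subseteq> verts G \<and> X \<noteq> {} \<and> X \<noteq> verts G \<longrightarrow> 2 \<le> card (crossing G X))" (is "?l = ?r")
proof -
  have v: "verts (del_edges G S) = verts G" for S unfolding del_edges_def by simp
  have *: "2 \<le> card (crossing G X) \<longleftrightarrow>
      crossing G X \<noteq> {} \<and> (\<forall>e\<in>edges G. crossing G X - {e} \<noteq> {})" for X
  proof -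
    have c: "card (crossing G X) < 2 \<longleftrightarrow> crossing G X = {} \<or> (\<exists>e. crossing G X = {e})"
      using finite_crossing[OF assms, of X] by (auto simp: less_2_cases_iff card_1_singleton_iff)
    have "\<not> 2 \<le> card (crossing G X) \<longleftrightarrow> crossing G X = {} \<or> (\<exists>e\<in>edges G. crossing G X \<subseteq> {e})"
      using c crossing_subset[of G X] unfolding linorder_not_le by blast
    then show ?thesis by blast
  qed
  show ?thesis
  proof
    assume t: ?l
    show ?r
    proof (intro conjI allI impI)
      show "verts G \<noteq> {}" using t unfolding two_connected_def connected_def by simp
      fix X assume X: "X \<subseteq> verts G \<and> X \<noteq> {} \<and> X \<noteq> verts G"
      then have "crossing G X \<noteq> {}"
        using t connected_iff_crossing[OF assms] unfolding two_connected_def by simp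
      moreover have "crossing G X - {e} \<noteq> {}" if "e \<in> edges G" for e
      proof -
        have "connected (del_edges G {e})" using t that unfolding two_connected_def by simp
        then show ?thesis using X
          unfolding connected_iff_crossing[OF wf_del_edges[OF assms]] v crossing_del_edges by simp
      qed
      ultimately show "2 \<le> card (crossing G X)" unfolding * by simp
    qed
  next
    assume r: ?r
    have "connected (del_edges G {e})" if "e \<in> edges G" for e
      unfolding connected_iff_crossing[OF wf_del_edges[OF assms]] v crossing_del_edges
      using r that unfolding * by simp
    moreover have "connected G"
      unfolding connected_iff_crossing[OF assms] using r unfolding * by simp
    ultimately show ?l unfolding two_connected_def by simp
  qed
qed

lemma bridgeless_cubic_iff: "bridgeless_cubic G \<longleftrightarrow> cubic G \<and> two_connected G"
proof
  assume b: "bridgeless_cubic G"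
  then have wf: "wf_graph G" unfolding bridgeless_cubic_def by simp
  have "degree G v = 3" if "v \<in> verts G" for v
  proof -
    have "{e\<in>edges G. fst (ends G e) = v \<and> snd (ends G e) = v} = {}"
      using b unfolding bridgeless_cubic_def by force
    then have "card {e\<in>edges G. fst (ends G e) = v \<and> snd (ends G e) = v} = 0" by (simp only: card.empty)
    moreover have "card (star G v) = 3" using b that unfolding bridgeless_cubic_def by simp
    ultimately show ?thesis using degree_eq_card_star[OF wf, of v] by linarith
  qed
  then show "cubic G \<and> two_connected G"
    using b two_connected_iff_crossing[OF wf] unfolding bridgeless_cubic_def cubic_def by simp
next
  assume c: "cubic G \<and> two_connected G"
  then have wf: "wf_graph G" unfolding cubic_def by simp
  have cut: "verts G \<noteq> {}" "\<And>X. X \<subseteq> verts G \<Longrightarrow> X \<noteq> {} \<Longrightarrow> X \<noteq> verts G \<Longrightarrow> 2 \<le> card (crossing G X)"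
    using c two_connected_iff_crossing[OF wf] by auto
  \<comment> \<open>A loop uses two of the three degrees at \<open>v\<close> and leaves a star of
    size one: a bridge, or impossible if \<open>v\<close> is the only vertex, whose star is
    empty.\<close>
  have no: "{e\<in>edges G. fst (ends G e) = v \<and> snd (ends G e) = v} = {}" if v: "v \<in> verts G" for v
  proof (rule ccontr)
    let ?L = "{e\<in>edges G. fst (ends G e) = v \<and> snd (ends G e) = v}"
    assume "?L \<noteq> {}"
    moreover have "finite ?L" using wf unfolding wf_graph_def by auto
    ultimately have "card ?L \<ge> 1" by (metis One_nat_def Suc_le_eq card_gt_0_iff)
    moreover have d: "card (star G v) + 2 * card ?L = 3"
      using c v degree_eq_card_star[OF wf, of v] unfolding cubic_def by simp
    ultimately have one: "card (star G v) = 1" by presburger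
    show False
    proof (cases "{v} = verts G")
      case True
      then have "star G v = {}" using wf unfolding wf_graph_def crossing_def by auto
      then show False using one by simp
    next
      case False
      then show False using cut(2)[of "{v}"] v one by auto
    qed
  qed
  have "card (star G v) = 3" if "v \<in> verts G" for v
  proof -
    have "degree G v = 3" using c that unfolding cubic_def by simp
    moreover have "card {e\<in>edges G. fst (ends G e) = v \<and> snd (ends G e) = v} = 0"
      using no[OF that] by (simp only: card.empty)
    ultimately show ?thesis using degree_eq_card_star[OF wf, of v] by linarith
  qed
  moreover have "fst (ends G e) \<noteq> snd (ends G e)" if "e \<in> edges G" for e
    using no[of "fst (ends G e)"] that wf unfolding wf_graph_def by auto
  ultimately show "bridgeless_cubic G" using wf cut unfolding bridgeless_cubic_def by blast
qed

lemma bridgeless_cubicD: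
  assumes "bridgeless_cubic G"
  shows "wf_graph G" "finite (verts G)" "finite (edges G)" "verts G \<noteq> {}"
    "\<And>v. v \<in> verts G \<Longrightarrow> card (star G v) = 3"
    "\<And>X. X \<subseteq> verts G \<Longrightarrow> X \<noteq> {} \<Longrightarrow> X \<noteq> verts G \<Longrightarrow> 2 \<le> card (crossing G X)"
    "\<And>X. finite (crossing G X)"
  using assms finite_crossing[of G] unfolding bridgeless_cubic_def by (simp_all add: wf_graph_def)

lemma edge_endsE:
  assumes "bridgeless_cubic G" "e \<in> edges G"
  obtains u v where "u \<in> verts G" "v \<in> verts G" "u \<noteq> v" "ends G e = (u, v)"
    "\<And>x. e \<in> star G x \<longleftrightarrow> x = u \<or> x = v" "\<And>X. e \<in> crossing G X \<longleftrightarrow> (u \<in> X) \<noteq> (v \<in> X)"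
proof -
  obtain u v where uv: "ends G e = (u, v)" by fastforce
  have "u \<in> verts G" "v \<in> verts G" "u \<noteq> v"
    using assms uv unfolding bridgeless_cubic_def wf_graph_def by force+
  moreover have "e \<in> crossing G X \<longleftrightarrow> (u \<in> X) \<noteq> (v \<in> X)" for X
    using assms(2) uv unfolding crossing_def by simp
  moreover from calculation have "e \<in> star G x \<longleftrightarrow> x = u \<or> x = v" for x by auto
  ultimately show thesis using that uv by blast
qed

lemma edge_ends_ex:
  assumes "bridgeless_cubic G" "e \<in> edges G"
  shows "\<exists>u v. u \<in> verts G \<and> v \<in> verts G \<and> u \<noteq> v \<and> ends G e = (u, v) \<and>
    (\<forall>x. e \<in> star G x \<longleftrightarrow> x = u \<or> x = v) \<and> (\<forall>X. e \<in> crossing G X \<longleftrightarrow> (u \<in> X) \<noteq> (v \<in> X))"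
  by (rule edge_endsE[OF assms]) auto

lemma in_star_iff:
  assumes "bridgeless_cubic G"
  shows "e \<in> star G v \<longleftrightarrow> e \<in> edges G \<and> incident G e v"
  using assms unfolding bridgeless_cubic_def incident_def crossing_def by auto

lemma star_verts:
  assumes "bridgeless_cubic G" "e \<in> star G v"
  shows "v \<in> verts G" "e \<in> edges G"
  using assms unfolding bridgeless_cubic_def wf_graph_def crossing_def by auto

text \<open>A weighted handshake count: without loops every edge lies in exactly two stars.\<close>

lemma sum_star:
  fixes g :: "nat \<Rightarrow> nat"
  assumes "bridgeless_cubic G"
  shows "(\<Sum>v\<in>verts G. \<Sum>e\<in>star G v. g e) = 2 * (\<Sum>e\<in>edges G. g e)"
proof -
  note f = bridgeless_cubicD[OF assms]
  have "(\<Sum>v\<in>verts G. \<Sum>e\<in>star G v. g e) = (\<Sum>v\<in>verts G. \<Sum>e\<in>{e\<in>edges G. e \<in> star G v}. g e)"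
    by (intro sum.cong) (auto dest: star_verts[OF assms])
  also have "\<dots> = (\<Sum>e\<in>edges G. \<Sum>v\<in>{v\<in>verts G. e \<in> star G v}. g e)"
    using f(2,3) by (rule sum.swap_restrict)
  also have "\<dots> = (\<Sum>e\<in>edges G. 2 * g e)"
  proof (intro sum.cong refl)
    fix e assume e: "e \<in> edges G"
    obtain u v where uv: "u \<in> verts G" "v \<in> verts G" "u \<noteq> v" "\<And>x. e \<in> star G x \<longleftrightarrow> x = u \<or> x = v"
      using edge_endsE[OF assms e] by metis
    then have "{v\<in>verts G. e \<in> star G v} = {u, v}" by auto
    then show "(\<Sum>v\<in>{v\<in>verts G. e \<in> star G v}. g e) = 2 * g e" using uv(3) by simp
  qed
  finally show ?thesis by (simp add: sum_distrib_left)
qed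

text \<open>Adding a vertex \<open>x\<close> to \<open>X\<close> replaces the cut by its symmetric
  difference with the star of \<open>x\<close>, which flips the parity of the number of edges from
  \<open>N\<close> in it. It is used with \<open>N\<close> the set of all edges and with
  \<open>N\<close> a perfect matching.\<close>

lemma even_card_crossing:
  assumes "bridgeless_cubic G" "X \<subseteq> verts G" "\<And>v. v \<in> X \<Longrightarrow> odd (card (N \<inter> star G v))"
  shows "even (card (N \<inter> crossing G X)) \<longleftrightarrow> even (card X)"
proof -
  note f = bridgeless_cubicD[OF assms(1)]
  have "finite X" using f(2) assms(2) finite_subset by blast
  then show ?thesis using assms(3)
  proof (induction X)
    case empty
    then show ?case by (simp add: crossing_def)
  next
    case (insert x X)
    have "insert x X = (X - {x}) \<union> ({x} - X)" using insert(2) by auto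
    then have "crossing G (insert x X) =
        (crossing G X - star G x) \<union> (star G x - crossing G X)"
      using crossing_sym_diff by metis
    then have "N \<inter> crossing G (insert x X) =
       (N \<inter> crossing G X - N \<inter> star G x) \<union> (N \<inter> star G x - N \<inter> crossing G X)" by auto
    then have "card (N \<inter> crossing G (insert x X)) + 2 * card ((N \<inter> crossing G X) \<inter> (N \<inter> star G x)) =
       card (N \<inter> crossing G X) + card (N \<inter> star G x)"
      using card_sym_diff[of "N \<inter> crossing G X" "N \<inter> star G x"] f(7) by simp
    then have "even (card (N \<inter> crossing G (insert x X))) \<longleftrightarrow>
       even (card (N \<inter> crossing G X) + card (N \<inter> star G x))"
      by (metis dvd_triv_left even_add)
    then show ?case using insert by simp
  qed
qed

lemma even_card_crossing_iff:
  assumes "bridgeless_cubic G" "X \<subseteq> verts G"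
  shows "even (card (crossing G X)) \<longleftrightarrow> even (card X)"
proof -
  have e: "edges G \<inter> crossing G Y = crossing G Y" for Y using crossing_subset by auto
  have "odd (card (edges G \<inter> star G v))" if "v \<in> X" for v
    using bridgeless_cubicD(5)[OF assms(1), of v] assms(2) that unfolding e by auto
  then show ?thesis using even_card_crossing[OF assms, of "edges G"] unfolding e by simp
qed

section \<open>Triples of perfect matchings\<close>

definition colours :: "nat set" where "colours = {0, 1, 2}"

lemma colours_simps [simp]: "finite colours" "card colours = 3"
  unfolding colours_def by simp_all

text \<open>A triple of perfect matchings, recorded as the set of indices of the members containing each
  edge. Unlike in \<^const>\<open>three_array\<close>, the three matchings need not be distinct.\<close>

definition cover3 :: "graph \<Rightarrow> (nat \<Rightarrow> nat set) \<Rightarrow> bool" where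
  "cover3 G k \<longleftrightarrow> (\<forall>v\<in>verts G. (\<Union>e\<in>star G v. k e) = colours \<and>
     (\<forall>e\<in>star G v. \<forall>e'\<in>star G v. e \<noteq> e' \<longrightarrow> k e \<inter> k e' = {}))"

text \<open>A star of a cubic graph without loops has three edges, so mapping it onto three colours
  is the same as colouring it injectively; properness becomes an equation between sets.\<close>

definition tait :: "graph \<Rightarrow> bool" where
  "tait G \<longleftrightarrow> (\<exists>c. \<forall>v\<in>verts G. c ` star G v = colours)"

definition covered :: "graph \<Rightarrow> (nat \<Rightarrow> nat set) \<Rightarrow> nat \<Rightarrow> nat set" where
  "covered G k j = {e\<in>edges G. card (k e) = j}"

lemma cover3D:
  assumes "cover3 G k" "v \<in> verts G"
  shows "(\<Union>e\<in>star G v. k e) = colours"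
    "\<And>e e'. e \<in> star G v \<Longrightarrow> e' \<in> star G v \<Longrightarrow> e \<noteq> e' \<Longrightarrow> k e \<inter> k e' = {}"
  using assms unfolding cover3_def by simp_all

lemma cover3_subset:
  assumes "bridgeless_cubic G" "cover3 G k" "e \<in> edges G"
  shows "k e \<subseteq> colours" "finite (k e)" "card (k e) \<le> 3"
proof -
  obtain u where u: "u \<in> verts G" "e \<in> star G u" using edge_endsE[OF assms(1,3)] by metis
  then have "(\<Union>e\<in>star G u. k e) = colours" using assms(2) unfolding cover3_def by simp
  then show s: "k e \<subseteq> colours" using u(2) by blast
  then show "finite (k e)" by (rule finite_subset) simp
  show "card (k e) \<le> 3" using card_mono[OF _ s] by simp
qed

lemma cover3_sum:
  assumes "bridgeless_cubic G" "cover3 G k" "v \<in> verts G"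
  shows "(\<Sum>e\<in>star G v. card (k e)) = 3"
proof -
  have u: "(\<Union>e\<in>star G v. k e) = colours"
    and d: "\<forall>e\<in>star G v. \<forall>e'\<in>star G v. e \<noteq> e' \<longrightarrow> k e \<inter> k e' = {}"
    using assms(2,3) unfolding cover3_def by auto
  have "\<forall>e\<in>star G v. finite (k e)"
    using cover3_subset(2)[OF assms(1,2)] star_verts(2)[OF assms(1)] by blast
  then have "card (\<Union>e\<in>star G v. k e) = (\<Sum>e\<in>star G v. card (k e))"
    using d bridgeless_cubicD(7)[OF assms(1)] by (intro card_UN_disjoint) auto
  then show ?thesis unfolding u by simp
qed

text \<open>At each vertex the cover counts add up to three, which is also the number of edges
  there. So the average cover count of an edge is one, and surpluses balance deficits.\<close>

lemma cover3_count:
  assumes "bridgeless_cubic G" "cover3 G k"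
  shows "card (covered G k 0) = card (covered G k 2) + 2 * card (covered G k 3)"
proof -
  note f = bridgeless_cubicD[OF assms(1)]
  have "2 * (\<Sum>e\<in>edges G. card (k e)) = (\<Sum>v\<in>verts G. 3)"
    using sum_star[OF assms(1), of "\<lambda>e. card (k e)"] cover3_sum[OF assms] by simp
  moreover have "2 * (\<Sum>e\<in>edges G. 1) = (\<Sum>v\<in>verts G. 3::nat)"
    using sum_star[OF assms(1), of "\<lambda>e. 1"] f(5) by simp
  ultimately have "(\<Sum>e\<in>edges G. card (k e)) = (\<Sum>e\<in>edges G. 1)" by simp
  \<comment> \<open>Edge by edge: a count of 2 exceeds one by 1, a count of 3 exceeds it by 2, and a
    count of 0 falls short by 1.\<close>
  moreover have "(\<Sum>e\<in>edges G. card (k e) + (if card (k e) = 0 then 1 else 0)) =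
     (\<Sum>e\<in>edges G. 1 + ((if card (k e) = 2 then 1 else 0) + 2 * (if card (k e) = 3 then 1 else 0)))"
  proof (rule sum.cong[OF refl])
    fix e assume "e \<in> edges G"
    then have "card (k e) \<le> 3" using cover3_subset(3)[OF assms] by simp
    then have "card (k e) = 0 \<or> card (k e) = 1 \<or> card (k e) = 2 \<or> card (k e) = 3" by presburger
    then show "card (k e) + (if card (k e) = 0 then 1 else 0) =
      1 + ((if card (k e) = 2 then 1 else 0) + 2 * (if card (k e) = 3 then 1 else 0))" by auto
  qed
  ultimately have "(\<Sum>e\<in>edges G. if card (k e) = 0 then 1 else 0) =
     (\<Sum>e\<in>edges G. if card (k e) = 2 then 1 else 0) +
      2 * (\<Sum>e\<in>edges G. if card (k e) = 3 then 1 else (0::nat))"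
    unfolding sum.distrib sum_distrib_left by linarith
  moreover have "(\<Sum>e\<in>edges G. if card (k e) = j then 1 else 0) = card (covered G k j)" for j
    unfolding covered_def using f(3) by (simp add: sum.If_cases Int_def)
  ultimately show ?thesis by simp
qed

text \<open>The three counts at \<open>v\<close> add up to three, so a surplus at \<open>e\<close>
  leaves at most one for the two other edges.\<close>

lemma cover3_partner:
  assumes "bridgeless_cubic G" "cover3 G k" "e \<in> star G v" "card (k e) \<ge> 2"
  obtains e' where "e' \<in> star G v" "card (k e') = 0"
proof (rule ccontr)
  assume no: "\<not> thesis"
  have v: "v \<in> verts G" using star_verts[OF assms(1,3)] by simp
  have fin: "finite (star G v)" using bridgeless_cubicD(7)[OF assms(1)] .
  have "(\<Sum>e\<in>star G v - {e}. 1) \<le> (\<Sum>e\<in>star G v - {e}. card (k e))"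
    using no that by (intro sum_mono) (metis DiffD1 One_nat_def not_less_eq_eq le0 le_zero_eq)
  moreover have "(\<Sum>e\<in>star G v - {e}. 1) = (2::nat)"
    using bridgeless_cubicD(5)[OF assms(1) v] assms(3) fin by simp
  ultimately show False
    using cover3_sum[OF assms(1,2) v] sum.remove[OF fin assms(3), of "\<lambda>e. card (k e)"] assms(4)
    by linarith
qed

lemma card_three_cases: "card A = 3 \<Longrightarrow> x \<in> A \<Longrightarrow> \<exists>y z. A = {x, y, z} \<and> x \<noteq> y \<and> x \<noteq> z \<and> y \<noteq> z"
  unfolding card_3_iff by blast

lemma card_three_cases2:
  "card A = 3 \<Longrightarrow> x \<in> A \<Longrightarrow> y \<in> A \<Longrightarrow> x \<noteq> y \<Longrightarrow> \<exists>z. A = {x, y, z} \<and> x \<noteq> z \<and> y \<noteq> z"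
  unfolding card_3_iff by blast

lemma card_three_eq:
  "card A = 3 \<Longrightarrow> {x, y, z} \<subseteq> A \<Longrightarrow> x \<noteq> y \<Longrightarrow> x \<noteq> z \<Longrightarrow> y \<noteq> z \<Longrightarrow> A = {x, y, z}"
  by (rule card_subset_eq[symmetric]) (auto intro: card_ge_0_finite)

lemma taitI: "(\<And>v. v \<in> verts G \<Longrightarrow> c ` star G v = colours) \<Longrightarrow> tait G"
  unfolding tait_def by (rule exI[of _ c]) simp

lemma taitI_singletons:
  fixes k :: "nat \<Rightarrow> nat set"
  assumes "\<And>v. v \<in> verts G \<Longrightarrow> (\<Union>e\<in>star G v. k e) = colours"
    "\<And>v e. v \<in> verts G \<Longrightarrow> e \<in> star G v \<Longrightarrow> card (k e) = 1"
  shows "tait G"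
  unfolding tait_def
proof (intro exI[of _ "\<lambda>e. the_elem (k e)"] ballI)
  fix v assume v: "v \<in> verts G"
  have "k e = {the_elem (k e)}" if "e \<in> star G v" for e
    using assms(2)[OF v that] by (metis card_1_singletonE the_elem_eq)
  then have "(\<lambda>e. the_elem (k e)) ` star G v = (\<Union>e\<in>star G v. k e)" by fastforce
  then show "(\<lambda>e. the_elem (k e)) ` star G v = colours" using assms(1)[OF v] by simp
qed

text \<open>If one of the three matchings contains all doubly covered edges, exchange in it the doubly
  covered edges with the uncovered ones.\<close>

lemma tait_if_common_colour:
  assumes "bridgeless_cubic G" "cover3 G k" "\<And>e. e \<in> edges G \<Longrightarrow> card (k e) \<le> 2" "i \<in> colours"
    "\<And>e. e \<in> edges G \<Longrightarrow> card (k e) = 2 \<Longrightarrow> i \<in> k e"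
  shows "tait G"
proof -
  define k' where "k' e = (if card (k e) = 2 then k e - {i} else if card (k e) = 0 then {i} else k e)" for e
  have e0: "k e = {}" if "e \<in> edges G" "card (k e) = 0" for e
    using cover3_subset(2)[OF assms(1,2) that(1)] that(2) by simp
  have "card (k' e) = 1" if "e \<in> edges G" for e
  proof -
    have "card (k e) = 0 \<or> card (k e) = 1 \<or> card (k e) = 2" using assms(3)[OF that] by linarith
    then show ?thesis using assms(5)[OF that] cover3_subset(2)[OF assms(1,2) that]
      unfolding k'_def by auto
  qed
  moreover have "(\<Union>e\<in>star G v. k' e) = colours" if v: "v \<in> verts G" for v
  proof
    have u: "(\<Union>e\<in>star G v. k e) = colours" using assms(2) v unfolding cover3_def by simp
    have "k' e \<subseteq> colours" if "e \<in> star G v" for e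
      using cover3_subset(1)[OF assms(1,2), of e] star_verts(2)[OF assms(1) that] assms(4)
      unfolding k'_def by auto
    then show "(\<Union>e\<in>star G v. k' e) \<subseteq> colours" by blast
    show "colours \<subseteq> (\<Union>e\<in>star G v. k' e)"
    proof
      fix j :: nat assume "j \<in> colours"
      then obtain e where e: "e \<in> star G v" "j \<in> k e" using u by blast
      show "j \<in> (\<Union>e\<in>star G v. k' e)"
      proof (cases "card (k e) = 2 \<and> j = i")
        case True
        then obtain e' where "e' \<in> star G v" "card (k e') = 0"
          using cover3_partner[OF assms(1,2) e(1)] by auto
        then have "e' \<in> star G v" "j \<in> k' e'" using True unfolding k'_def by auto
        then show ?thesis by blast
      next
        case False
        then have "j \<in> k' e" using e e0[of e] star_verts(2)[OF assms(1) e(1)] unfolding k'_def by auto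
        then show ?thesis using e(1) by blast
      qed
    qed
  qed
  ultimately show ?thesis using taitI_singletons[of G k'] star_verts(2)[OF assms(1)] by blast
qed

section \<open>Triples with at most three uncovered edges\<close>

lemma eq_Diff_of_Un_Int:
  fixes A :: "nat set"
  assumes "A \<union> B = colours" "A \<inter> B = {}"
  shows "B = colours - A"
  using assms by blast

text \<open>All other edges at the two ends of a triply covered edge \<open>e\<close> are uncovered.
  With at most three uncovered edges, some edge \<open>g\<close> must be parallel to
  \<open>e\<close>. The surroundings are then determined completely and can be recoloured by
  hand.\<close>

lemma no_triple_covered:
  assumes G: "bridgeless_cubic G" and k: "cover3 G k" and u3: "card (covered G k 0) \<le> 3"
    and nt: "\<not> tait G" and e: "e \<in> edges G"
  shows "card (k e) \<le> 2"
proof (rule ccontr)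
  note f = bridgeless_cubicD[OF G]
  have fin: "finite (covered G k j)" for j using f(3) unfolding covered_def by simp
  assume "\<not> card (k e) \<le> 2"
  then have t3: "card (k e) = 3" using cover3_subset(3)[OF G k e] by linarith
  then have ke: "k e = colours" using cover3_subset[OF G k e] by (intro card_subset_eq) auto
  have "e \<in> covered G k 3" using e t3 unfolding covered_def by simp
  then have "card (covered G k 3) \<noteq> 0" using fin by auto
  then have c3: "card (covered G k 3) = 1" and c2: "card (covered G k 0) = card (covered G k 2) + 2"
    using cover3_count[OF G k] u3 by presburger+
  have E3: "covered G k 3 = {e}" using c3 \<open>e \<in> covered G k 3\<close> by (metis card_1_singletonE singletonD)
  obtain u v where uv: "u \<in> verts G" "v \<in> verts G" "u \<noteq> v" "\<And>x. e \<in> star G x \<longleftrightarrow> x = u \<or> x = v"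
    using edge_endsE[OF G e] by metis
  have z: "star G x - {e} \<subseteq> covered G k 0" if "x = u \<or> x = v" for x
  proof
    fix h assume h: "h \<in> star G x - {e}"
    then have "k h \<inter> k e = {}" using k uv that unfolding cover3_def by blast
    moreover have "h \<in> edges G" using h star_verts(2)[OF G] by blast
    moreover from this have "k h \<subseteq> colours" using cover3_subset(1)[OF G k] by blast
    ultimately have "h \<in> edges G \<and> k h = {}" unfolding ke by blast
    then show "h \<in> covered G k 0" unfolding covered_def by simp
  qed
  have c: "card (star G x - {e}) = 2" if "x = u \<or> x = v" for x
    using f(5)[of x] f(7)[of "{x}"] uv that by auto
  have "(star G u - {e}) \<inter> (star G v - {e}) \<noteq> {}"
  proof
    assume "(star G u - {e}) \<inter> (star G v - {e}) = {}"
    then have "card ((star G u - {e}) \<union> (star G v - {e})) = 4"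
      using c f(7) by (subst card_Un_disjoint) auto
    moreover have "card ((star G u - {e}) \<union> (star G v - {e})) \<le> card (covered G k 0)"
      using z fin by (intro card_mono) auto
    ultimately show False using u3 by linarith
  qed
  then obtain g where g: "g \<in> star G u" "g \<in> star G v" "g \<noteq> e" by auto
  obtain h where h: "star G u = {e, g, h}" "h \<noteq> e" "h \<noteq> g"
    using card_three_cases2[of "star G u" e g] f(5) uv g by metis
  obtain h' where h': "star G v = {e, g, h'}" "h' \<noteq> e" "h' \<noteq> g"
    using card_three_cases2[of "star G v" e g] f(5) uv g by metis
  show False
  proof (cases "h = h'")
    case True
    \<comment> \<open>Three parallel edges between \<open>u\<close> and \<open>v\<close> form the
      whole graph, and they receive the three colours.\<close>
    have "{u, v} = ({u} - {v}) \<union> ({v} - {u})" using uv(3) by auto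
    then have "crossing G {u, v} = (star G u - star G v) \<union> (star G v - star G u)"
      using crossing_sym_diff by metis
    then have "crossing G {u, v} = {}" using h h' True by auto
    then have V: "verts G = {u, v}" using f(6)[of "{u, v}"] uv by fastforce
    have "(\<lambda>x. if x = e then 0 else if x = g then 1 else 2) ` star G x = colours"
      if "x \<in> verts G" for x
    proof -
      have "star G x = {e, g, h}" using that V h h' True by auto
      then show ?thesis using h g unfolding colours_def by auto
    qed
    then have "tait G" by (rule taitI)
    then show False using nt by simp
  next
    case False
    have E0: "covered G k 0 = {g, h, h'}"
    proof (rule card_seteq[symmetric, OF fin])
      show "{g, h, h'} \<subseteq> covered G k 0" using z[of u] z[of v] h h' g by auto
      show "card (covered G k 0) \<le> card {g, h, h'}" using u3 h h' g False by auto
    qed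
    have "card {g, h, h'} = 3" using False h h' by auto
    then have "card (covered G k 2) = 1" using E0 c2 by simp
    then obtain s where s: "covered G k 2 = {s}" by (metis card_1_singletonE)
    \<comment> \<open>The far end \<open>x\<close> of an uncovered edge \<open>hh\<close> has cover
      counts 0, 2 and 1, and the 2 can only belong to the unique doubly covered edge
      \<open>s\<close>. Applied to \<open>h\<close> and \<open>h'\<close>, this makes
      \<open>s\<close> join their far ends.\<close>
    have dbl: "\<exists>d x. d \<noteq> s \<and> d \<noteq> hh \<and> hh \<noteq> s \<and> x \<in> verts G \<and> x \<noteq> w \<and> star G x = {hh, s, d} \<and>
        (\<forall>y. hh \<in> star G y \<longleftrightarrow> y = w \<or> y = x) \<and> x \<noteq> u \<and> x \<noteq> v \<and> k d = colours - k s"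
      if w: "w = u \<or> w = v" "hh \<in> star G w" "hh \<noteq> e" "hh \<noteq> g" "hh \<notin> star G u \<or> hh \<notin> star G v" for w hh
    proof -
      have hE: "hh \<in> edges G" using star_verts(2)[OF G w(2)] .
      obtain x where x: "x \<in> verts G" "x \<noteq> w" "\<forall>y. hh \<in> star G y \<longleftrightarrow> y = w \<or> y = x"
        using edge_endsE[OF G hE] w(2) by metis
      have xuv: "x \<noteq> u" "x \<noteq> v" using x w by auto
      have h0: "k hh = {}" using z[OF w(1)] w cover3_subset(2)[OF G k hE]
        unfolding covered_def by auto
      obtain y1 y2 where y: "star G x = {hh, y1, y2}" "hh \<noteq> y1" "hh \<noteq> y2" "y1 \<noteq> y2"
        using card_three_cases[of "star G x" hh] f(5) x by metis
      have yE: "y1 \<in> edges G" "y2 \<in> edges G" "e \<notin> star G x"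
        using star_verts(2)[OF G, of _ x] y xuv uv(4) by auto
      have sum: "card (k y1) + card (k y2) = 3"
        using cover3_sum[OF G k x(1)] y h0 by simp
      moreover have "y1 \<notin> covered G k 3" "y2 \<notin> covered G k 3" using E3 yE y by auto
      ultimately have "card (k y1) = 2 \<or> card (k y2) = 2"
        using yE unfolding covered_def using cover3_subset(3)[OF G k yE(1)] cover3_subset(3)[OF G k yE(2)]
        by (auto; presburger)
      then have "y1 = s \<or> y2 = s" using s yE unfolding covered_def by auto
      then obtain d where d: "star G x = {hh, s, d}" "d \<noteq> s" "hh \<noteq> s" "d \<noteq> hh"
        using y by (metis insert_commute)
      have "k hh \<union> (k s \<union> k d) = colours" "k s \<inter> k d = {}"
        using cover3D(1)[OF k x(1)] cover3D(2)[OF k x(1), of s d] d by simp_all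
      then have "k d = colours - k s" unfolding h0 by (intro eq_Diff_of_Un_Int) simp_all
      then show ?thesis using d x xuv by metis
    qed
    obtain d x where dx: "d \<noteq> s" "d \<noteq> h" "h \<noteq> s" "x \<in> verts G" "star G x = {h, s, d}"
       "x \<noteq> u" "x \<noteq> v" "k d = colours - k s" "\<And>y. h \<in> star G y \<longleftrightarrow> y = u \<or> y = x"
      using dbl[of u h] h h' False by auto
    obtain d' y where dy: "d' \<noteq> s" "d' \<noteq> h'" "h' \<noteq> s" "y \<in> verts G" "star G y = {h', s, d'}"
       "y \<noteq> u" "y \<noteq> v" "k d' = colours - k s" "\<And>x. h' \<in> star G x \<longleftrightarrow> x = v \<or> x = y"
      using dbl[of v h'] h h' False by auto
    have sE: "s \<in> edges G" "card (k s) = 2" using s unfolding covered_def by auto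
    \<comment> \<open>If \<open>x = y\<close>, the third edge at \<open>x\<close> is the uncovered
      \<open>h'\<close>, whereas \<open>colours - k s\<close> has one element.\<close>
    have xy: "x \<noteq> y"
    proof
      assume "x = y"
      then have "d = h'" using dx dy False by auto
      moreover have "h' \<in> covered G k 0" using E0 by simp
      ultimately have "card (k d) = 0" unfolding covered_def by simp
      moreover have "card (colours - k s) = 1"
        using sE cover3_subset[OF G k sE(1)] by (simp add: card_Diff_subset)
      ultimately show False using dx(8) by simp
    qed
    obtain i j where ij: "k s = {i, j}" "i \<noteq> j" using sE(2) by (meson card_2_iff)
    have "card (colours - k s) = 1"
      using sE cover3_subset[OF G k sE(1)] by (simp add: card_Diff_subset)
    then obtain l where l: "colours - k s = {l}" by (meson card_1_singletonE)
    have ijl: "{i, j, l} = colours" 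
      using l ij(1) cover3_subset(1)[OF G k sE(1)] by blast
    have sxy: "s \<in> star G z \<longleftrightarrow> z = x \<or> z = y" for z
      using edge_endsE[OF G sE(1)] dx(5) dy(5) xy by (metis insertI1 insertI2)
    have gg: "g \<in> star G z \<longleftrightarrow> z = u \<or> z = v" for z
      using edge_endsE[OF G, of g] star_verts(2)[OF G g(1)] g uv(3) by metis
    \<comment> \<open>The parallel edges \<open>e\<close> and \<open>g\<close> take \<open>l\<close>
      and \<open>i\<close>, so \<open>h\<close> and \<open>h'\<close> both take \<open>j\<close>. At
      \<open>x\<close> and \<open>y\<close> this \<open>j\<close> and the colour \<open>i\<close> of
      \<open>s\<close> complete the colour \<open>l\<close> of the third edge.\<close>
    define c where "c a = (if a = e then l else if a = g then i else if a = h then j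
      else if a = h' then j else if a = s then i else the_elem (k a))" for a
    have dd: "the_elem (k d) = l" "the_elem (k d') = l" using dx(8) dy(8) l by auto
    have cd: "c d = l" "c d' = l"
    proof -
      have "d \<notin> covered G k 0 \<union> covered G k 2 \<union> covered G k 3"
        "d' \<notin> covered G k 0 \<union> covered G k 2 \<union> covered G k 3"
        using dx(8) dy(8) l unfolding covered_def by auto
      then show "c d = l" "c d' = l" using dd E0 E3 s unfolding c_def by auto
    qed
    have cv: "c e = l" "c g = i" "c h = j" "c h' = j" "c s = i"
      using h h' g(3) dx(3) dy(3) s t3 sE(2) E0 unfolding c_def covered_def by auto
    have "c ` star G z = colours" if zV: "z \<in> verts G" for z
    proof -
      consider "z = u" | "z = v" | "z = x" | "z = y" | "z \<notin> {u, v, x, y}" by blast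
      then show ?thesis
      proof cases
        case 1 then show ?thesis using h(1) ijl cv by auto
      next
        case 2 then show ?thesis using h'(1) ijl cv by auto
      next
        case 3 then show ?thesis using dx(5) ijl cv cd by auto
      next
        case 4 then show ?thesis using dy(5) ijl cv cd by auto
      next
        case 5
        have un: "(\<Union>a\<in>star G z. k a) = colours" using k zV unfolding cover3_def by simp
        have n: "e \<notin> star G z" "g \<notin> star G z" "h \<notin> star G z" "h' \<notin> star G z" "s \<notin> star G z"
          using 5 uv(4) gg dx(9) dy(9) sxy by auto
        have "k a = {c a}" if a: "a \<in> star G z" for a
        proof -
          have aE: "a \<in> edges G" using star_verts(2)[OF G a] .
          have "a \<notin> covered G k 0 \<union> covered G k 2 \<union> covered G k 3" using n a E0 E3 s by auto
          then have "card (k a) \<noteq> 0" "card (k a) \<noteq> 2" "card (k a) \<noteq> 3"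
            using aE unfolding covered_def by auto
          then have "card (k a) = 1" using cover3_subset(3)[OF G k aE] by presburger
          then have "k a = {the_elem (k a)}" by (metis card_1_singletonE the_elem_eq)
          moreover have "c a = the_elem (k a)" using n a unfolding c_def by auto
          ultimately show ?thesis by simp
        qed
        then have "c ` star G z = (\<Union>a\<in>star G z. k a)" by fastforce
        then show ?thesis using un by simp
      qed
    qed
    then have "tait G" by (rule taitI)
    then show False using nt by simp
  qed
qed

lemma two_subsets_meet:
  fixes A :: "nat set"
  assumes "A \<subseteq> colours" "B \<subseteq> colours" "card A = 2" "card B = 2"
  shows "A \<inter> B \<noteq> {}"
proof
  assume "A \<inter> B = {}"
  then have "card (A \<union> B) = 4" using assms by (subst card_Un_disjoint) (auto intro: finite_subset)
  moreover have "card (A \<union> B) \<le> card colours" using assms by (intro card_mono) auto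
  ultimately show False by simp
qed

text \<open>Without triple coverage, uncovered and doubly covered edges are equally many. Two
  2-element sets of colours meet, so with at most two doubly covered edges
  \<open>tait_if_common_colour\<close> would apply. The last claim serves later to tell the three
  matchings apart.\<close>

lemma not_tait_cover3:
  assumes G: "bridgeless_cubic G" and k: "cover3 G k" and u3: "card (covered G k 0) \<le> 3"
    and nt: "\<not> tait G"
  shows "card (covered G k 0) = 3" "card (covered G k 2) = 3"
    "\<And>e. e \<in> edges G \<Longrightarrow> card (k e) \<le> 2"
    "\<And>i. i \<in> colours \<Longrightarrow> \<exists>e\<in>edges G. card (k e) = 2 \<and> i \<notin> k e"
proof -
  note f = bridgeless_cubicD[OF G]
  show n3: "\<And>e. e \<in> edges G \<Longrightarrow> card (k e) \<le> 2" using no_triple_covered[OF G k u3 nt] .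
  show com: "\<And>i. i \<in> colours \<Longrightarrow> \<exists>e\<in>edges G. card (k e) = 2 \<and> i \<notin> k e"
    using tait_if_common_colour[OF G k n3] nt by blast
  have "covered G k 3 = {}" using n3 unfolding covered_def by fastforce
  then have c: "card (covered G k 0) = card (covered G k 2)" using cover3_count[OF G k] by simp
  have fin: "finite (covered G k 2)" using f(3) unfolding covered_def by simp
  have sub: "\<And>e. e \<in> covered G k 2 \<Longrightarrow> k e \<subseteq> colours \<and> card (k e) = 2"
    using cover3_subset(1)[OF G k] unfolding covered_def by auto
  have "\<not> card (covered G k 2) \<le> 2"
  proof
    assume le: "card (covered G k 2) \<le> 2"
    obtain e where e: "e \<in> covered G k 2" using com[of 0] unfolding covered_def colours_def by auto
    have "\<exists>e'\<in>covered G k 2. covered G k 2 = {e, e'}"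
    proof (cases "covered G k 2 = {e}")
      case False
      then obtain e' where e': "e' \<in> covered G k 2" "e' \<noteq> e" using e by blast
      have "{e, e'} = covered G k 2" using e e' le by (intro card_seteq[OF fin]) auto
      then show ?thesis using e' by blast
    qed auto
    then obtain e' where e': "e' \<in> covered G k 2" "covered G k 2 = {e, e'}" by blast
    obtain i where i: "i \<in> k e" "i \<in> k e'"
      using two_subsets_meet sub[OF e] sub[OF e'(1)] by blast
    then have "i \<in> colours" using sub[OF e] by blast
    from com[OF this] obtain s where "s \<in> covered G k 2" "i \<notin> k s" unfolding covered_def by blast
    then show False using i e' by auto
  qed
  then show "card (covered G k 0) = 3" "card (covered G k 2) = 3" using c u3 by linarith+
qed

lemma tait_if_all_covered:
  assumes "bridgeless_cubic G" "cover3 G k" "card (covered G k 0) = 0"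
  shows "tait G"
  using not_tait_cover3(1)[OF assms(1,2)] assms(3) by fastforce

section \<open>The colouring defect\<close>

lemma three_edge_colourable_iff_tait:
  assumes G: "bridgeless_cubic G"
  shows "three_edge_colourable G \<longleftrightarrow> tait G"
proof
  assume "three_edge_colourable G"
  then obtain c :: "nat \<Rightarrow> nat" where c: "\<And>e. e \<in> edges G \<Longrightarrow> c e < 3"
     "\<And>e1 e2. e1 \<in> edges G \<Longrightarrow> e2 \<in> edges G \<Longrightarrow> e1 \<noteq> e2 \<Longrightarrow>
        (\<exists>v. incident G e1 v \<and> incident G e2 v) \<Longrightarrow> c e1 \<noteq> c e2"
    unfolding three_edge_colourable_def by blast
  show "tait G"
  proof (rule taitI)
    fix v assume v: "v \<in> verts G"
    have "inj_on c (star G v)"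
      by (rule inj_onI) (meson c(2) in_star_iff[OF G])
    then have "card (c ` star G v) = 3" using bridgeless_cubicD(5)[OF G v] card_image by metis
    moreover have "c ` star G v \<subseteq> colours"
      using c(1) star_verts(2)[OF G] unfolding colours_def by fastforce
    ultimately show "c ` star G v = colours" by (intro card_subset_eq) simp_all
  qed
next
  assume "tait G"
  then obtain c where c: "\<And>v. v \<in> verts G \<Longrightarrow> c ` star G v = colours" unfolding tait_def by blast
  have "c e < 3" if eE: "e \<in> edges G" for e
  proof -
    obtain v where "v \<in> verts G" "e \<in> star G v" using edge_endsE[OF G eE] by metis
    then have "c e \<in> colours" using c by blast
    then show ?thesis unfolding colours_def by auto
  qed
  moreover have "c e1 \<noteq> c e2"
    if "e1 \<in> edges G" "e2 \<in> edges G" "e1 \<noteq> e2" "incident G e1 v" "incident G e2 v" for e1 e2 v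
  proof -
    have s: "e1 \<in> star G v" "e2 \<in> star G v" using that in_star_iff[OF G] by auto
    then have v: "v \<in> verts G" using star_verts(1)[OF G] by blast
    have "inj_on c (star G v)"
      using c[OF v] bridgeless_cubicD(5,7)[OF G] v by (intro eq_card_imp_inj_on) simp_all
    then show ?thesis using s that(3) by (meson inj_onD)
  qed
  ultimately show "three_edge_colourable G"
    using G unfolding three_edge_colourable_def bridgeless_cubic_def
    by (intro exI[of _ c] conjI ballI impI) (simp, simp, metis)
qed

lemma cover3_of_three_array:
  assumes G: "bridgeless_cubic G" and A: "three_array G A"
  obtains k where "cover3 G k" "\<And>e. cover_count A e = card (k e)"
proof -
  have cA: "card A = 3" and pm: "\<And>M. M \<in> A \<Longrightarrow> perfect_matching G M"
    using A unfolding three_array_def by auto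
  then have "finite A" by (intro card_ge_0_finite) simp
  then obtain m where m: "bij_betw m colours A"
    using cA by (metis colours_simps finite_same_card_bij)
  define k where "k e = {i\<in>colours. e \<in> m i}" for e
  have "cover_count A e = card (k e)" for e
  proof -
    have "{M\<in>A. e \<in> M} = m ` k e" using m unfolding k_def bij_betw_def by auto
    moreover have "inj_on m (k e)" using m unfolding k_def bij_betw_def by (auto intro: inj_on_subset)
    ultimately show ?thesis unfolding cover_count_def by (simp add: card_image)
  qed
  moreover have "cover3 G k" unfolding cover3_def
  proof (intro ballI conjI impI)
    fix v assume v: "v \<in> verts G"
    have one: "\<exists>e. {e \<in> m i. incident G e v} = {e}" "m i \<subseteq> edges G" if "i \<in> colours" for i
    proof -
      have "m i \<in> A" using m that unfolding bij_betw_def by auto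
      then have "perfect_matching G (m i)" by (rule pm)
      then show "\<exists>e. {e \<in> m i. incident G e v} = {e}" "m i \<subseteq> edges G"
        using v unfolding perfect_matching_def by (simp_all add: card_1_singleton_iff)
    qed
    show "(\<Union>e\<in>star G v. k e) = colours"
    proof
      show "(\<Union>e\<in>star G v. k e) \<subseteq> colours" unfolding k_def by auto
      show "colours \<subseteq> (\<Union>e\<in>star G v. k e)"
      proof
        fix i assume i: "i \<in> colours"
        obtain e where "{e \<in> m i. incident G e v} = {e}" using one(1)[OF i] by blast
        then have "e \<in> m i" "incident G e v" by auto
        then have "e \<in> star G v" using one(2)[OF i] in_star_iff[OF G] by blast
        then show "i \<in> (\<Union>e\<in>star G v. k e)" using i \<open>e \<in> m i\<close> unfolding k_def by blast
      qed
    qed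
    fix e e' assume e: "e \<in> star G v" "e' \<in> star G v" "e \<noteq> e'"
    show "k e \<inter> k e' = {}"
    proof (rule ccontr)
      assume "k e \<inter> k e' \<noteq> {}"
      then obtain i where i: "i \<in> colours" "e \<in> m i" "e' \<in> m i" unfolding k_def by blast
      obtain d where "{e \<in> m i. incident G e v} = {d}" using one(1)[OF i(1)] by blast
      moreover have "incident G e v" "incident G e' v" using e in_star_iff[OF G] by auto
      ultimately have "e = d" "e' = d" using i by blast+
      then show False using e(3) by simp
    qed
  qed
  ultimately show thesis using that by blast
qed

text \<open>A 3-array is a set of size three, so the matchings must be pairwise different;
  hypothesis \<open>d\<close> supplies a separating edge for each pair.\<close>

lemma three_array_of_cover3:
  assumes G: "bridgeless_cubic G" and k: "cover3 G k"
    and d: "\<And>i j. i \<in> colours \<Longrightarrow> j \<in> colours \<Longrightarrow> i \<noteq> j \<Longrightarrow> \<exists>e\<in>edges G. (i \<in> k e) \<noteq> (j \<in> k e)"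
  obtains A where "three_array G A" "\<And>e. e \<in> edges G \<Longrightarrow> cover_count A e = card (k e)"
proof -
  define m where "m i = {e\<in>edges G. i \<in> k e}" for i
  have inj: "inj_on m colours"
  proof (rule inj_onI, rule ccontr)
    fix i j assume ij: "i \<in> colours" "j \<in> colours" "m i = m j" "i \<noteq> j"
    then obtain e where "e \<in> edges G" "(i \<in> k e) \<noteq> (j \<in> k e)" using d by blast
    then show False using ij(3) unfolding m_def by blast
  qed
  have "three_array G (m ` colours)" unfolding three_array_def
  proof (intro conjI ballI)
    show "card (m ` colours) = 3" using card_image[OF inj] by simp
    fix M assume "M \<in> m ` colours"
    then obtain i where i: "i \<in> colours" "M = m i" by blast
    show "perfect_matching G M" unfolding perfect_matching_def
    proof (intro conjI ballI)
      show "M \<subseteq> edges G" using i unfolding m_def by blast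
      show "fst (ends G e) \<noteq> snd (ends G e)" if "e \<in> M" for e
        using that i G unfolding m_def bridgeless_cubic_def by blast
      fix v assume v: "v \<in> verts G"
      obtain e where e: "e \<in> star G v" "i \<in> k e" using cover3D(1)[OF k v] i(1) by blast
      have "{e \<in> M. incident G e v} = {e}"
      proof -
        have "e' = e" if "e' \<in> M" "incident G e' v" for e'
        proof (rule ccontr)
          assume "e' \<noteq> e"
          moreover have "e' \<in> star G v" "i \<in> k e'" using that i in_star_iff[OF G] unfolding m_def by auto
          ultimately show False using cover3D(2)[OF k v, of e' e] e by blast
        qed
        moreover have "e \<in> M" "incident G e v" using e i in_star_iff[OF G] unfolding m_def by auto
        ultimately show ?thesis by blast
      qed
      then show "card {e \<in> M. incident G e v} = 1" by simp
    qed
  qed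
  moreover have "cover_count (m ` colours) e = card (k e)" if e: "e \<in> edges G" for e
  proof -
    have "k e \<subseteq> colours" using cover3_subset(1)[OF G k e] .
    then have "{M \<in> m ` colours. e \<in> M} = m ` k e" "inj_on m (k e)"
      using e inj unfolding m_def by (auto intro: inj_on_subset)
    then show ?thesis unfolding cover_count_def by (simp add: card_image)
  qed
  ultimately show thesis using that by blast
qed

text \<open>The invariant of the induction. A triple in a non-colourable graph always leaves at
  least three edges uncovered, so optimality of the triple and defect three follow from this
  predicate.\<close>

definition hex_cover :: "graph \<Rightarrow> (nat \<Rightarrow> nat set) \<Rightarrow> bool" where
  "hex_cover G k \<longleftrightarrow> bridgeless_cubic G \<and> \<not> tait G \<and> cover3 G k \<and> card (covered G k 0) = 3"

lemma uncovered_eq: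
  assumes "\<And>e. e \<in> edges G \<Longrightarrow> cover_count A e = card (k e)"
  shows "uncovered G A = covered G k 0"
  using assms unfolding uncovered_def covered_def by auto

lemma tait_cover3:
  assumes G: "bridgeless_cubic G" and c: "\<And>v. v \<in> verts G \<Longrightarrow> c ` star G v = colours"
  shows "cover3 G (\<lambda>e. {c e})"
proof -
  have "inj_on c (star G v)" if "v \<in> verts G" for v
    using c[OF that] bridgeless_cubicD(5,7)[OF G] that by (intro eq_card_imp_inj_on) simp_all
  moreover have "(\<Union>e\<in>star G v. {c e}) = c ` star G v" for v by blast
  ultimately show ?thesis unfolding cover3_def
    using c by (simp) (metis inj_on_def)
qed

lemma hexagonal_coreE:
  assumes G: "bridgeless_cubic G" and h: "hexagonal_core G C"
  obtains k where "hex_cover G k" "C = {e\<in>edges G. card (k e) \<noteq> 1}"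
proof -
  obtain A where A: "df G = 3" "three_array G A" "card (uncovered G A) = 3" "core G A = C"
    using h unfolding hexagonal_core_def optimal_def by auto
  obtain k where k: "cover3 G k" "\<And>e. cover_count A e = card (k e)"
    using cover3_of_three_array[OF G A(2)] by metis
  \<comment> \<open>A colouring gives an array without uncovered edges; its classes are distinct
    because every colour occurs at any vertex. The defect would be 0.\<close>
  have "\<not> tait G"
  proof
    assume "tait G"
    then obtain c where c: "\<And>v. v \<in> verts G \<Longrightarrow> c ` star G v = colours" unfolding tait_def by blast
    have co: "cover3 G (\<lambda>e. {c e})" using tait_cover3[OF G c] .
    obtain v where v: "v \<in> verts G" using bridgeless_cubicD(4)[OF G] by blast
    have "\<exists>e\<in>edges G. (i \<in> {c e}) \<noteq> (j \<in> {c e})" if ij: "i \<in> colours" "i \<noteq> j" for i j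
    proof -
      have "i \<in> c ` star G v" using c[OF v] ij by simp
      then obtain e where "e \<in> star G v" "c e = i" by blast
      then show ?thesis using star_verts(2)[OF G] ij by auto
    qed
    then obtain A' where A': "three_array G A'" "\<And>e. e \<in> edges G \<Longrightarrow> cover_count A' e = card {c e}"
      using three_array_of_cover3[OF G co] by blast
    then have "uncovered G A' = {}" unfolding uncovered_def by auto
    then have "card (uncovered G A') = 0" by simp
    then have "df G \<le> 0" unfolding df_def using A'(1) by (intro Least_le) blast
    then show False using A(1) by simp
  qed
  moreover have "card (covered G k 0) = 3" using A(3) uncovered_eq[of G A k] k(2) by simp
  moreover have "C = {e\<in>edges G. card (k e) \<noteq> 1}" using A(4) k(2) unfolding core_def by simp
  ultimately show thesis using that G k(1) unfolding hex_cover_def by blast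
qed

lemma hex_coverD:
  assumes "hex_cover G k"
  shows "bridgeless_cubic G" "\<not> tait G" "cover3 G k" "card (covered G k 0) = 3"
    "card (covered G k 2) = 3" "\<And>e. e \<in> edges G \<Longrightarrow> card (k e) \<le> 2"
    "\<And>i. i \<in> colours \<Longrightarrow> \<exists>e\<in>edges G. card (k e) = 2 \<and> i \<notin> k e"
proof -
  show h: "bridgeless_cubic G" "\<not> tait G" "cover3 G k" "card (covered G k 0) = 3"
    using assms unfolding hex_cover_def by auto
  show "card (covered G k 2) = 3" "\<And>e. e \<in> edges G \<Longrightarrow> card (k e) \<le> 2"
    "\<And>i. i \<in> colours \<Longrightarrow> \<exists>e\<in>edges G. card (k e) = 2 \<and> i \<notin> k e"
    using not_tait_cover3[OF h(1,3) _ h(2)] h(4) by auto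
qed

lemma hexagonal_coreI:
  assumes h: "hex_cover G k"
  shows "df G = 3" "hexagonal_core G {e\<in>edges G. card (k e) \<noteq> 1}"
proof -
  note d = hex_coverD[OF h]
  \<comment> \<open>If matchings \<open>i\<close> and \<open>j\<close> agreed, a doubly covered edge
    missing \<open>i\<close> would miss \<open>j\<close> too, but two 2-element colour sets
    meet.\<close>
  have "\<exists>e\<in>edges G. (i \<in> k e) \<noteq> (j \<in> k e)" if ij: "i \<in> colours" "j \<in> colours" "i \<noteq> j" for i j
  proof (rule ccontr)
    assume no: "\<not> (\<exists>e\<in>edges G. (i \<in> k e) \<noteq> (j \<in> k e))"
    obtain e where e: "e \<in> edges G" "card (k e) = 2" "i \<notin> k e" using d(7)[OF ij(1)] by blast
    have "j \<notin> k e" using no e by blast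
    then have "{i, j} \<inter> k e = {}" using e by blast
    moreover have "{i, j} \<subseteq> colours" "card {i, j} = 2" using ij by auto
    ultimately show False
      using two_subsets_meet[of "{i, j}" "k e"] e cover3_subset(1)[OF d(1,3) e(1)] by blast
  qed
  then obtain A where A: "three_array G A" "\<And>e. e \<in> edges G \<Longrightarrow> cover_count A e = card (k e)"
    using three_array_of_cover3[OF d(1,3)] by blast
  have c3: "card (uncovered G A) = 3" using uncovered_eq[of G A k] A(2) d(4) by simp
  show "df G = 3" unfolding df_def
  proof (rule Least_equality)
    show "\<exists>A. three_array G A \<and> card (uncovered G A) = 3" using A(1) c3 by blast
    fix n assume "\<exists>A. three_array G A \<and> card (uncovered G A) = n"
    then obtain A' where A': "three_array G A'" "card (uncovered G A') = n" by blast
    obtain k' where k': "cover3 G k'" "\<And>e. cover_count A' e = card (k' e)"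
      using cover3_of_three_array[OF d(1) A'(1)] by metis
    have "card (covered G k' 0) = n" using A'(2) uncovered_eq[of G A' k'] k'(2) by simp
    then show "3 \<le> n" using not_tait_cover3(1)[OF d(1) k'(1) _ d(2)] by linarith
  qed
  then show "hexagonal_core G {e\<in>edges G. card (k e) \<noteq> 1}"
    using A c3 unfolding hexagonal_core_def optimal_def core_def by force
qed

section \<open>Small cuts\<close>

definition proper_cut :: "graph \<Rightarrow> nat set \<Rightarrow> bool" where
  "proper_cut G X \<longleftrightarrow> X \<subseteq> verts G \<and> X \<noteq> {} \<and> X \<noteq> verts G"

lemma proper_cut_compl: "proper_cut G X \<Longrightarrow> proper_cut G (verts G - X)"
  unfolding proper_cut_def by blast

lemma double_compl: "X \<subseteq> verts G \<Longrightarrow> verts G - (verts G - X) = X"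
  by blast

text \<open>For an edge crossing \<open>X\<close> this is its end inside \<open>X\<close>.
  Independence of a cut becomes injectivity of this map, once for \<open>X\<close> and once for its
  complement.\<close>

definition inend :: "graph \<Rightarrow> nat set \<Rightarrow> nat \<Rightarrow> nat" where
  "inend G X f = (if fst (ends G f) \<in> X then fst (ends G f) else snd (ends G f))"

lemma inend_crossing:
  assumes "bridgeless_cubic G" "f \<in> crossing G X"
  shows "inend G X f \<in> X" "\<And>v. v \<in> X \<Longrightarrow> f \<in> star G v \<longleftrightarrow> v = inend G X f"
    "ends G f = (inend G X f, inend G (verts G - X) f) \<or>
     ends G f = (inend G (verts G - X) f, inend G X f)"
proof -
  have fE: "f \<in> edges G" using assms(2) crossing_subset by blast
  obtain u v where uv: "u \<in> verts G" "v \<in> verts G" "u \<noteq> v" "ends G f = (u, v)"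
    "\<forall>x. f \<in> star G x \<longleftrightarrow> x = u \<or> x = v" "\<forall>X. f \<in> crossing G X \<longleftrightarrow> (u \<in> X) \<noteq> (v \<in> X)"
    using edge_ends_ex[OF assms(1) fE] by blast
  then show "inend G X f \<in> X" "\<And>v. v \<in> X \<Longrightarrow> f \<in> star G v \<longleftrightarrow> v = inend G X f"
    "ends G f = (inend G X f, inend G (verts G - X) f) \<or>
     ends G f = (inend G (verts G - X) f, inend G X f)"
    using assms(2) unfolding inend_def by auto
qed

lemma in_crossing_subset_iff:
  assumes "bridgeless_cubic G" "f \<in> crossing G X" "Z \<subseteq> X"
  shows "f \<in> crossing G Z \<longleftrightarrow> inend G X f \<in> Z"
proof -
  have fE: "f \<in> edges G" using assms(2) crossing_subset by blast
  obtain u v where uv: "u \<in> verts G" "v \<in> verts G" "u \<noteq> v" "ends G f = (u, v)"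
    "\<forall>x. f \<in> star G x \<longleftrightarrow> x = u \<or> x = v" "\<forall>X. f \<in> crossing G X \<longleftrightarrow> (u \<in> X) \<noteq> (v \<in> X)"
    using edge_ends_ex[OF assms(1) fE] by blast
  then show ?thesis using assms(2,3) unfolding inend_def by auto
qed

text \<open>If two cut edges met at \<open>v\<close> in \<open>X\<close>, moving \<open>v\<close> to
  the other side would lose at least two cut edges and gain at most one. The condition
  \<open>2 \<le> card X\<close> keeps the smaller set non-empty.\<close>

lemma inend_inj:
  assumes G: "bridgeless_cubic G" and X: "X \<subseteq> verts G" "2 \<le> card X"
    and min: "\<And>Z. proper_cut G Z \<Longrightarrow> card (crossing G X) \<le> card (crossing G Z)"
  shows "inj_on (inend G X) (crossing G X)"
proof (rule inj_onI, rule ccontr)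
  fix f f' assume f: "f \<in> crossing G X" "f' \<in> crossing G X" "inend G X f = inend G X f'" "f \<noteq> f'"
  define v where "v = inend G X f"
  have v: "v \<in> X" "f \<in> star G v" "f' \<in> star G v"
    using inend_crossing[OF G f(1)] inend_crossing[OF G f(2)] f(3) unfolding v_def by auto
  have "card {f, f'} \<le> card (crossing G X \<inter> star G v)"
    using f v bridgeless_cubicD(7)[OF G] by (intro card_mono) auto
  then have "2 \<le> card (crossing G X \<inter> star G v)" using f(4) by simp
  moreover have "card (star G v) = 3" using bridgeless_cubicD(5)[OF G, of v] v X by blast
  moreover have "card (crossing G (X - {v})) + 2 * card (crossing G X \<inter> star G v)
    = card (crossing G X) + card (star G v)"
    using v by (intro card_crossing_diff bridgeless_cubicD(1)[OF G]) auto
  ultimately have less: "card (crossing G (X - {v})) < card (crossing G X)" by linarith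
  have "X \<noteq> {v}" using X(2) by auto
  then have "X - {v} \<noteq> {}" using v(1) by blast
  then have "proper_cut G (X - {v})" using X v unfolding proper_cut_def by blast
  then show False using min less by fastforce
qed

lemma star_induced: "v \<in> X \<Longrightarrow> star (induced G X) v = star G v - crossing G X"
  unfolding induced_def crossing_def by auto

lemma crossing_induced: "Z \<subseteq> X \<Longrightarrow> crossing (induced G X) Z = crossing G Z - crossing G X"
  unfolding induced_def crossing_def by auto

lemma edges_induced:
  assumes "wf_graph G" "X \<subseteq> verts G"
  shows "edges G = edges (induced G X) \<union> edges (induced G (verts G - X)) \<union> crossing G X"
    "edges (induced G X) \<inter> edges (induced G (verts G - X)) = {}"
    "edges (induced G X) \<inter> crossing G X = {}"
  using assms unfolding induced_def crossing_def wf_graph_def by auto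

lemma edges_induced_subset: "edges (induced G X) \<subseteq> edges G"
  unfolding induced_def by auto

lemma wf_induced: "wf_graph G \<Longrightarrow> X \<subseteq> verts G \<Longrightarrow> wf_graph (induced G X)"
  unfolding wf_graph_def induced_def by (auto intro: finite_subset)

text \<open>If \<open>X\<close> fell apart into \<open>Z\<close> and \<open>X - Z\<close>, its cut
  would be the disjoint union of their cuts, which have at least two edges each. That makes
  four.\<close>

lemma connected_induced:
  assumes G: "bridgeless_cubic G" and X: "proper_cut G X" "card (crossing G X) \<le> 3"
  shows "connected (induced G X)"
proof -
  note f = bridgeless_cubicD[OF G]
  have XV: "X \<subseteq> verts G" using X(1) unfolding proper_cut_def by simp
  have v: "verts (induced G X) = X" unfolding induced_def by simp
  show ?thesis unfolding connected_iff_crossing[OF wf_induced[OF f(1) XV]] v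
  proof (intro conjI allI impI)
    show "X \<noteq> {}" using X(1) unfolding proper_cut_def by simp
    fix Z assume Z: "Z \<subseteq> X \<and> Z \<noteq> {} \<and> Z \<noteq> X"
    show "crossing (induced G X) Z \<noteq> {}"
    proof
      assume "crossing (induced G X) Z = {}"
      then have "crossing G Z \<subseteq> crossing G X" using crossing_induced Z by auto
      then have "card (crossing G X \<inter> crossing G Z) = card (crossing G Z)" by (simp add: Int_absorb1)
      then have "card (crossing G (X - Z)) + card (crossing G Z) = card (crossing G X)"
        using card_crossing_diff[OF f(1), of Z X] Z by simp
      moreover have "2 \<le> card (crossing G Z)" "2 \<le> card (crossing G (X - Z))"
        using Z XV X(1) unfolding proper_cut_def by (intro f(6); blast)+
      ultimately show False using X(2) by linarith
    qed
  qed
qed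

section \<open>Cuts along which a graph may be decomposed\<close>

lemma small_indep_cutI:
  assumes G: "bridgeless_cubic G" and X: "proper_cut G X" "card (crossing G X) \<in> {2, 3}"
    and inj: "inj_on (inend G X) (crossing G X)" "inj_on (inend G (verts G - X)) (crossing G X)"
  shows "small_indep_cut G (crossing G X) X"
proof -
  have XV: "X \<subseteq> verts G" using X(1) unfolding proper_cut_def by simp
  have cc: "crossing G (verts G - X) = crossing G X" using crossing_compl bridgeless_cubicD(1)[OF G] by blast
  have "independent G (crossing G X)" unfolding independent_def
  proof (intro ballI impI notI)
    fix e1 e2 assume e: "e1 \<in> crossing G X" "e2 \<in> crossing G X" "e1 \<noteq> e2"
      and "\<exists>v. incident G e1 v \<and> incident G e2 v"
    then obtain v where v: "e1 \<in> star G v" "e2 \<in> star G v"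
      using in_star_iff[OF G] crossing_subset[of G X] by blast
    then have vV: "v \<in> verts G" using star_verts(1)[OF G] by blast
    show False
    proof (cases "v \<in> X")
      case True
      then have "v = inend G X e1" "v = inend G X e2" using inend_crossing(2)[OF G] e v by blast+
      then show False using inj(1) e by (metis inj_onD)
    next
      case False
      then have "v \<in> verts G - X" using vV by simp
      then have "v = inend G (verts G - X) e1" "v = inend G (verts G - X) e2"
        using inend_crossing(2)[OF G, of _ "verts G - X"] e v cc by blast+
      then show False using inj(2) e by (metis inj_onD)
    qed
  qed
  moreover have "connected (induced G X)" "connected (induced G (verts G - X))"
    using connected_induced[OF G X(1)] connected_induced[OF G proper_cut_compl[OF X(1)]] X(2) cc
    by auto
  ultimately show ?thesis using X(2) XV unfolding small_indep_cut_def by simp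
qed

text \<open>The degree of a vertex drops by the number of cut edges ending there, and injectivity
  makes this number zero or one.\<close>

lemma two_valent_induced:
  assumes G: "bridgeless_cubic G" and X: "X \<subseteq> verts G" and inj: "inj_on (inend G X) (crossing G X)"
  shows "two_valent (induced G X) = inend G X ` crossing G X"
proof -
  note f = bridgeless_cubicD[OF G]
  have d: "degree (induced G X) v = 3 - card (star G v \<inter> crossing G X)" if v: "v \<in> X" for v
  proof -
    have "{e \<in> edges (induced G X). fst (ends (induced G X) e) = v \<and> snd (ends (induced G X) e) = v} = {}"
      using G unfolding induced_def bridgeless_cubic_def by fastforce
    then have "degree (induced G X) v = card (star G v - crossing G X)"
      using degree_eq_card_star[OF wf_induced[OF f(1) X], of v] star_induced[OF v, of G]
      by (metis (no_types, lifting) add.right_neutral card.empty mult_0_right)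
    then show ?thesis using f(5)[of v] f(7)[of "{v}"] v X by (simp add: card_Diff_subset_Int subsetD)
  qed
  have s: "star G v \<inter> crossing G X = {f\<in>crossing G X. inend G X f = v}" if "v \<in> X" for v
    using inend_crossing(2)[OF G _ that] by blast
  show ?thesis
  proof (intro set_eqI iffI)
    fix v assume "v \<in> two_valent (induced G X)"
    then have v: "v \<in> X" "degree (induced G X) v = 2" unfolding two_valent_def induced_def by auto
    then have "card (star G v \<inter> crossing G X) \<noteq> 0" using d by fastforce
    then have "{f\<in>crossing G X. inend G X f = v} \<noteq> {}" using s[OF v(1)] by force
    then show "v \<in> inend G X ` crossing G X" by blast
  next
    fix v assume "v \<in> inend G X ` crossing G X"
    then obtain f where f: "f \<in> crossing G X" "v = inend G X f" by blast
    then have v: "v \<in> X" using inend_crossing(1)[OF G] by blast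
    have "star G v \<inter> crossing G X = {f}" unfolding s[OF v] using f inj by (auto dest: inj_onD)
    then have "degree (induced G X) v = 2" using d[OF v] by simp
    then show "v \<in> two_valent (induced G X)" using v unfolding two_valent_def induced_def by simp
  qed
qed

section \<open>Sides of a cut\<close>

text \<open>\<open>H\<close> is the completion of the side \<open>X\<close>; the map \<open>\<psi>\<close> sends an edge of \<open>G\<close> meeting \<open>X\<close> to the
  edge of \<open>H\<close> that replaces it. It identifies the two edges of a 2-cut.\<close>

definition side :: "graph \<Rightarrow> nat set \<Rightarrow> graph \<Rightarrow> (nat \<Rightarrow> nat) \<Rightarrow> bool" where
  "side G X H \<psi> \<longleftrightarrow> bridgeless_cubic H \<and> X \<subseteq> verts H \<and>
     (\<forall>v\<in>X. star H v = \<psi> ` star G v \<and> inj_on \<psi> (star G v)) \<and>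
     (\<forall>v\<in>verts H - X. star H v = \<psi> ` crossing G X \<and> inj_on \<psi> (crossing G X)) \<and>
     (\<forall>e\<in>edges (induced G X). \<psi> e = e) \<and>
     edges H = edges (induced G X) \<union> \<psi> ` crossing G X \<and> \<psi> ` crossing G X \<inter> edges G = {}"

lemma sideD:
  assumes "side G X H \<psi>"
  shows "bridgeless_cubic H" "X \<subseteq> verts H"
    "\<And>v. v \<in> X \<Longrightarrow> star H v = \<psi> ` star G v" "\<And>v. v \<in> X \<Longrightarrow> inj_on \<psi> (star G v)"
    "\<And>v. v \<in> verts H \<Longrightarrow> v \<notin> X \<Longrightarrow> star H v = \<psi> ` crossing G X"
    "\<And>v. v \<in> verts H \<Longrightarrow> v \<notin> X \<Longrightarrow> inj_on \<psi> (crossing G X)"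
    "\<And>e. e \<in> edges (induced G X) \<Longrightarrow> \<psi> e = e"
    "edges H = edges (induced G X) \<union> \<psi> ` crossing G X" "\<psi> ` crossing G X \<inter> edges G = {}"
  using assms unfolding side_def by simp_all

lemma star_split: "v \<in> X \<Longrightarrow> e \<in> star G v \<Longrightarrow> e \<in> edges (induced G X) \<or> e \<in> crossing G X"
  unfolding induced_def crossing_def by auto

text \<open>The restricted cover is well defined if cut edges identified by \<open>\<psi>\<close>
  carry equal sets (\<open>fib\<close>). It is a cover at an added vertex, present when
  \<open>verts H\<close> differs from \<open>X\<close>, if the cut edges partition the colours
  (\<open>w\<close>). The last conclusion counts an image under \<open>\<psi>\<close>, because the
  two edges of a 2-cut become one edge.\<close>

lemma side_cover3:
  assumes G: "bridgeless_cubic G" and X: "X \<subseteq> verts G" and s: "side G X H \<psi>" and k: "cover3 G k"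
    and fib: "\<And>f f'. f \<in> crossing G X \<Longrightarrow> f' \<in> crossing G X \<Longrightarrow> \<psi> f = \<psi> f' \<Longrightarrow> k f = k f'"
    and w: "verts H \<noteq> X \<Longrightarrow> (\<Union>f\<in>crossing G X. k f) = colours \<and>
      (\<forall>f\<in>crossing G X. \<forall>f'\<in>crossing G X. f \<noteq> f' \<longrightarrow> k f \<inter> k f' = {})"
  obtains k1 where "cover3 H k1" "\<And>e. e \<in> edges (induced G X) \<Longrightarrow> k1 e = k e"
    "\<And>f. f \<in> crossing G X \<Longrightarrow> k1 (\<psi> f) = k f"
    "\<And>j. card (covered H k1 j) = card {e\<in>edges (induced G X). card (k e) = j} +
        card (\<psi> ` {f\<in>crossing G X. card (k f) = j})"
proof -
  note d = sideD[OF s]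
  \<comment> \<open>New labels lie outside \<open>edges G\<close>; such a label takes the value of
    any cut edge that it replaces.\<close>
  define k1 where "k1 x = (if x \<in> edges G then k x else k (SOME f. f \<in> crossing G X \<and> \<psi> f = x))" for x
  have in1: "k1 e = k e" if "e \<in> edges (induced G X)" for e
    using that edges_induced_subset unfolding k1_def by auto
  have cr: "k1 (\<psi> f) = k f" if "f \<in> crossing G X" for f
  proof -
    define g where "g = (SOME f'. f' \<in> crossing G X \<and> \<psi> f' = \<psi> f)"
    have "g \<in> crossing G X \<and> \<psi> g = \<psi> f" unfolding g_def by (rule someI[of _ f]) (simp add: that)
    then have "k g = k f" using fib[of g f] that by simp
    moreover have "\<psi> f \<notin> edges G" using d(9) that by blast
    ultimately show ?thesis unfolding k1_def g_def by simp
  qed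
  have st: "k1 (\<psi> e) = k e" if "v \<in> X" "e \<in> star G v" for v e
    using star_split[OF that] in1 cr d(7) by metis
  have c3: "cover3 H k1" unfolding cover3_def
  proof (intro ballI conjI impI)
    fix v assume v: "v \<in> verts H"
    show "(\<Union>e\<in>star H v. k1 e) = colours"
    proof (cases "v \<in> X")
      case True
      have "(\<Union>e\<in>star H v. k1 e) = (\<Union>e\<in>star G v. k e)" unfolding d(3)[OF True] using st[OF True] by simp
      then show ?thesis using cover3D(1)[OF k subsetD[OF X True]] by simp
    next
      case False
      then have "verts H \<noteq> X" using v by blast
      moreover have "(\<Union>e\<in>star H v. k1 e) = (\<Union>e\<in>crossing G X. k e)"
        unfolding d(5)[OF v False] using cr by simp
      ultimately show ?thesis using w by simp
    qed
    fix e e' assume e: "e \<in> star H v" "e' \<in> star H v" "e \<noteq> e'"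
    show "k1 e \<inter> k1 e' = {}"
    proof (cases "v \<in> X")
      case True
      then obtain x y where "x \<in> star G v" "y \<in> star G v" "e = \<psi> x" "e' = \<psi> y"
        using e(1,2) unfolding d(3)[OF True] by blast
      then show ?thesis
        using e(3) st[OF True] cover3D(2)[OF k subsetD[OF X True], of x y] by metis
    next
      case False
      then have "verts H \<noteq> X" using v by blast
      moreover obtain x y where "x \<in> crossing G X" "y \<in> crossing G X" "e = \<psi> x" "e' = \<psi> y"
        using e(1,2) unfolding d(5)[OF v False] by blast
      ultimately show ?thesis using e(3) cr w by metis
    qed
  qed
  have "card (covered H k1 j) = card {e\<in>edges (induced G X). card (k e) = j} +
        card (\<psi> ` {f\<in>crossing G X. card (k f) = j})" for j
  proof -
    have "covered H k1 j = {e\<in>edges (induced G X). card (k e) = j} \<union> \<psi> ` {f\<in>crossing G X. card (k f) = j}"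
      unfolding covered_def d(8) using in1 cr by auto
    moreover have "finite (edges (induced G X))"
      using edges_induced_subset bridgeless_cubicD(3)[OF G] by (rule finite_subset)
    ultimately show ?thesis using d(9) edges_induced_subset[of G X] bridgeless_cubicD(7)[OF G, of X]
      by (simp, intro card_Un_disjoint) auto
  qed
  then show thesis using that c3 in1 cr by blast
qed

text \<open>The colouring of the second side is permuted by \<open>p\<close> so that both agree on
  the cut; a cut edge can then be read on either side.\<close>

lemma side_tait_merge:
  assumes G: "bridgeless_cubic G" and X: "X \<subseteq> verts G"
    and s1: "side G X H1 \<psi>1" and s2: "side G (verts G - X) H2 \<psi>2"
    and c1: "\<And>v. v \<in> verts H1 \<Longrightarrow> c1 ` star H1 v = colours"
    and c2: "\<And>v. v \<in> verts H2 \<Longrightarrow> c2 ` star H2 v = colours"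
    and p: "p ` colours = colours" and m: "\<And>f. f \<in> crossing G X \<Longrightarrow> p (c2 (\<psi>2 f)) = c1 (\<psi>1 f)"
  shows "tait G"
proof (rule taitI)
  define c where "c e = (if e \<in> edges (induced G X) \<or> e \<in> crossing G X then c1 (\<psi>1 e) else p (c2 (\<psi>2 e)))" for e
  fix v assume v: "v \<in> verts G"
  show "c ` star G v = colours"
  proof (cases "v \<in> X")
    case True
    have "c e = c1 (\<psi>1 e)" if "e \<in> star G v" for e using star_split[OF True that] unfolding c_def by simp
    then have "c ` star G v = c1 ` (\<psi>1 ` star G v)" by (simp add: image_image)
    also have "\<dots> = c1 ` star H1 v" using sideD(3)[OF s1 True] by simp
    also have "\<dots> = colours" using c1 sideD(2)[OF s1] True by blast
    finally show ?thesis .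
  next
    case False
    then have v': "v \<in> verts G - X" using v by simp
    have "c e = p (c2 (\<psi>2 e))" if "e \<in> star G v" for e
    proof (cases "e \<in> crossing G X")
      case True
      then show ?thesis using m unfolding c_def by simp
    next
      case F: False
      have "e \<notin> edges (induced G X)" using that False unfolding induced_def crossing_def by auto
      then show ?thesis using F unfolding c_def by simp
    qed
    then have "c ` star G v = p ` (c2 ` (\<psi>2 ` star G v))" by (simp add: image_image)
    also have "\<dots> = p ` (c2 ` star H2 v)" using sideD(3)[OF s2 v'] by simp
    also have "c2 ` star H2 v = colours" using c2 sideD(2)[OF s2] v' by blast
    finally show ?thesis using p by simp
  qed
qed

text \<open>A perfect matching meets every star in one edge, so modulo two it meets a cut in as many
  edges as the cut has.\<close>

lemma cover3_parity:
  assumes G: "bridgeless_cubic G" and k: "cover3 G k" and X: "X \<subseteq> verts G" and i: "i \<in> colours"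
  shows "even (card {f\<in>crossing G X. i \<in> k f}) \<longleftrightarrow> even (card (crossing G X))"
proof -
  have "odd (card ({e. i \<in> k e} \<inter> star G v))" if v: "v \<in> X" for v
  proof -
    have vV: "v \<in> verts G" using v X by blast
    obtain e where e: "e \<in> star G v" "i \<in> k e" using cover3D(1)[OF k vV] i by blast
    have "{e. i \<in> k e} \<inter> star G v = {e}" using e cover3D(2)[OF k vV e(1)] by blast
    then show ?thesis by simp
  qed
  then have "even (card ({e. i \<in> k e} \<inter> crossing G X)) \<longleftrightarrow> even (card X)"
    by (rule even_card_crossing[OF G X])
  moreover have "{e. i \<in> k e} \<inter> crossing G X = {f\<in>crossing G X. i \<in> k f}" by blast
  ultimately show ?thesis using even_card_crossing_iff[OF G X] by simp
qed

section \<open>Completions\<close>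

definition comp2 :: "graph \<Rightarrow> nat set \<Rightarrow> nat \<Rightarrow> nat \<Rightarrow> nat \<Rightarrow> graph" where
  "comp2 G X e a b = \<lparr>verts = X, edges = insert e (edges (induced G X)), ends = (ends G)(e := (a, b))\<rparr>"

definition comp3 :: "graph \<Rightarrow> nat set \<Rightarrow> nat \<Rightarrow> nat \<Rightarrow> nat \<Rightarrow> nat \<Rightarrow> nat \<Rightarrow> nat \<Rightarrow> nat \<Rightarrow> graph" where
  "comp3 G X w e1 e2 e3 a1 a2 a3 = \<lparr>verts = insert w X, edges = edges (induced G X) \<union> {e1, e2, e3},
     ends = (ends G)(e1 := (w, a1), e2 := (w, a2), e3 := (w, a3))\<rparr>"

text \<open>The point beyond bookkeeping is that no bridge appears. A set containing at most one end
  of the new edge has a cut as large as in \<open>G\<close>, since the new edge replaces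
  \<open>f1\<close> or \<open>f2\<close>; for a set containing both ends one passes to its
  complement in \<open>X\<close>.\<close>

lemma side_comp2:
  assumes G: "bridgeless_cubic G" and X: "proper_cut G X"
    and c: "crossing G X = {f1, f2}" "f1 \<noteq> f2" and inj: "inj_on (inend G X) (crossing G X)"
    and e: "e \<notin> edges G"
  shows "side G X (comp2 G X e (inend G X f1) (inend G X f2)) (id(f1 := e, f2 := e))"
proof -
  note f = bridgeless_cubicD[OF G]
  define a where "a = inend G X f1"
  define b where "b = inend G X f2"
  define H where "H = comp2 G X e a b"
  define \<psi> where "\<psi> = id(f1 := e, f2 := e)"
  have XV: "X \<subseteq> verts G" using X unfolding proper_cut_def by simp
  have f12: "f1 \<in> crossing G X" "f2 \<in> crossing G X" using c by auto
  have fE: "f1 \<in> edges G" "f2 \<in> edges G" using f12 crossing_subset by auto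
  have ab: "a \<in> X" "b \<in> X" "a \<noteq> b"
    using inend_crossing(1)[OF G] f12 inj c(2) unfolding a_def b_def by (auto dest: inj_onD)
  have fi: "f1 \<in> crossing G Z \<longleftrightarrow> a \<in> Z" "f2 \<in> crossing G Z \<longleftrightarrow> b \<in> Z" if "Z \<subseteq> X" for Z
    using in_crossing_subset_iff[OF G f12(1) that] in_crossing_subset_iff[OF G f12(2) that]
    unfolding a_def b_def by auto
  have cr: "crossing H Z = (crossing G Z - {f1, f2}) \<union> (if (a \<in> Z) \<noteq> (b \<in> Z) then {e} else {})"
    if Z: "Z \<subseteq> X" for Z
  proof -
    have "crossing H Z = (crossing G Z - crossing G X) \<union> (if (a \<in> Z) \<noteq> (b \<in> Z) then {e} else {})"
      using Z e unfolding H_def comp2_def crossing_def induced_def by auto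
    then show ?thesis unfolding c(1) .
  qed
  have vH: "verts H = X" unfolding H_def comp2_def by simp
  have eH: "edges H = insert e (edges (induced G X))" unfolding H_def comp2_def by simp
  have wf: "wf_graph H"
    using ab wf_induced[OF f(1) XV] unfolding wf_graph_def H_def comp2_def induced_def by auto
  have st: "star H v = \<psi> ` star G v" if v: "v \<in> X" for v
  proof -
    have "star H v = (star G v - {f1, f2}) \<union> (if (a = v) \<noteq> (b = v) then {e} else {})"
      using cr[of "{v}"] v by auto
    moreover have "f1 \<in> star G v \<longleftrightarrow> a = v" "f2 \<in> star G v \<longleftrightarrow> b = v" using fi[of "{v}"] v by auto
    ultimately show ?thesis using ab(3) unfolding \<psi>_def by (auto simp: image_iff)
  qed
  have inj': "inj_on \<psi> (star G v)" if v: "v \<in> X" for v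
  proof (rule inj_onI)
    fix x y assume xy: "x \<in> star G v" "y \<in> star G v" "\<psi> x = \<psi> y"
    have "f1 \<in> star G v \<longleftrightarrow> a = v" "f2 \<in> star G v \<longleftrightarrow> b = v" using fi[of "{v}"] v by auto
    moreover have "x \<noteq> e" "y \<noteq> e" using xy star_verts(2)[OF G] e by auto
    ultimately show "x = y" using xy ab(3) unfolding \<psi>_def by (auto split: if_splits)
  qed
  have cut: "2 \<le> card (crossing H Z)" if Z: "Z \<subseteq> X" "Z \<noteq> {}" "Z \<noteq> X" for Z
  proof -
    have *: "2 \<le> card (crossing H Z)" if Z: "Z \<subseteq> X" "Z \<noteq> {}" "\<not> (a \<in> Z \<and> b \<in> Z)" for Z
    proof -
      have "Z \<noteq> verts G" using ab XV Z by blast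
      then have g: "2 \<le> card (crossing G Z)" using f(6)[of Z] Z XV by blast
      have e': "e \<notin> crossing G Z" using e crossing_subset by blast
      consider "a \<notin> Z" "b \<notin> Z" | "a \<in> Z" "b \<notin> Z" | "a \<notin> Z" "b \<in> Z" using Z by blast
      then show ?thesis
      proof cases
        case 1
        then have "crossing H Z = crossing G Z" using cr[OF Z(1)] fi[OF Z(1)] by auto
        then show ?thesis using g by simp
      next
        case 2
        then have "crossing H Z = insert e (crossing G Z - {f1})" "f1 \<in> crossing G Z"
          using cr[OF Z(1)] fi[OF Z(1)] by auto
        then show ?thesis using g f(7)[of Z] e' by simp
      next
        case 3
        then have "crossing H Z = insert e (crossing G Z - {f2})" "f2 \<in> crossing G Z"
          using cr[OF Z(1)] fi[OF Z(1)] by auto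
        then show ?thesis using g f(7)[of Z] e' by simp
      qed
    qed
    show ?thesis
    proof (cases "a \<in> Z \<and> b \<in> Z")
      case True
      then have "2 \<le> card (crossing H (X - Z))" using Z by (intro *) auto
      then show ?thesis using crossing_compl[OF wf, of Z] vH by simp
    next
      case False
      then show ?thesis using * Z by blast
    qed
  qed
  have "card (star H v) = 3" if "v \<in> X" for v
    using st[OF that] card_image[OF inj'[OF that]] f(5)[of v] that XV by auto
  moreover have "fst (ends H x) \<noteq> snd (ends H x)" if "x \<in> edges H" for x
    using that ab(3) G unfolding H_def comp2_def induced_def bridgeless_cubic_def by auto
  moreover have "X \<noteq> {}" using ab by blast
  ultimately have "bridgeless_cubic H" unfolding bridgeless_cubic_def vH using wf cut by blast
  moreover have "\<psi> ` crossing G X = {e}" unfolding c(1) \<psi>_def using c(2) by auto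
  moreover have "\<psi> x = x" if "x \<in> edges (induced G X)" for x
    using that edges_induced(3)[OF f(1) XV] f12 unfolding \<psi>_def by auto
  ultimately have "side G X H \<psi>" unfolding side_def vH eH using st inj' e by auto
  then show ?thesis unfolding H_def \<psi>_def a_def b_def .
qed

text \<open>The completion is \<open>G\<close> with the complement of \<open>X\<close> shrunk to
  \<open>w\<close>. Hence a set avoiding \<open>w\<close> has the same cut as in \<open>G\<close> up
  to relabelling, and a set containing \<open>w\<close> is replaced by its complement.\<close>

lemma side_comp3:
  assumes G: "bridgeless_cubic G" and X: "proper_cut G X"
    and c: "crossing G X = {f1, f2, f3}" "distinct [f1, f2, f3]"
    and e: "{e1, e2, e3} \<inter> edges G = {}" "distinct [e1, e2, e3]" and w: "w \<notin> verts G"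
  shows "side G X (comp3 G X w e1 e2 e3 (inend G X f1) (inend G X f2) (inend G X f3))
    (id(f1 := e1, f2 := e2, f3 := e3))"
proof -
  note f = bridgeless_cubicD[OF G]
  define a1 where "a1 = inend G X f1"
  define a2 where "a2 = inend G X f2"
  define a3 where "a3 = inend G X f3"
  define H where "H = comp3 G X w e1 e2 e3 a1 a2 a3"
  define \<psi> where "\<psi> = id(f1 := e1, f2 := e2, f3 := e3)"
  have XV: "X \<subseteq> verts G" and Xp: "X \<noteq> {}" "X \<noteq> verts G" using X unfolding proper_cut_def by auto
  have wX: "w \<notin> X" using w XV by blast
  have fX: "f1 \<in> crossing G X" "f2 \<in> crossing G X" "f3 \<in> crossing G X" using c by auto
  have a: "a1 \<in> X" "a2 \<in> X" "a3 \<in> X"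
    using inend_crossing(1)[OF G] fX unfolding a1_def a2_def a3_def by auto
  have fi: "f1 \<in> crossing G Z \<longleftrightarrow> a1 \<in> Z" "f2 \<in> crossing G Z \<longleftrightarrow> a2 \<in> Z" "f3 \<in> crossing G Z \<longleftrightarrow> a3 \<in> Z"
    if "Z \<subseteq> X" for Z
    using in_crossing_subset_iff[OF G _ that] fX unfolding a1_def a2_def a3_def by auto
  have cr: "crossing H Z = \<psi> ` crossing G Z" if Z: "Z \<subseteq> X" for Z
  proof -
    have wZ: "w \<notin> Z" using Z wX by blast
    have "crossing H Z = (crossing G Z - crossing G X) \<union>
      ((if a1 \<in> Z then {e1} else {}) \<union> (if a2 \<in> Z then {e2} else {}) \<union> (if a3 \<in> Z then {e3} else {}))"
    proof -
      have "x \<in> crossing H Z \<longleftrightarrow> x \<in> (crossing G Z - crossing G X)" if "x \<notin> {e1, e2, e3}" for x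
        using that Z unfolding H_def comp3_def crossing_def induced_def by auto
      moreover have "e1 \<in> crossing H Z \<longleftrightarrow> a1 \<in> Z" "e2 \<in> crossing H Z \<longleftrightarrow> a2 \<in> Z" "e3 \<in> crossing H Z \<longleftrightarrow> a3 \<in> Z"
        using e(2) wZ unfolding H_def comp3_def crossing_def by auto
      moreover have "e1 \<notin> crossing G Z" "e2 \<notin> crossing G Z" "e3 \<notin> crossing G Z"
        using e(1) crossing_subset by auto
      ultimately have "x \<in> crossing H Z \<longleftrightarrow> x \<in> (crossing G Z - crossing G X) \<union>
        ((if a1 \<in> Z then {e1} else {}) \<union> (if a2 \<in> Z then {e2} else {}) \<union> (if a3 \<in> Z then {e3} else {}))"
        for x using e(2) by (cases "x \<in> {e1, e2, e3}") auto
      then show ?thesis by blast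
    qed
    then show ?thesis using fi[OF Z] c(2) unfolding c(1) \<psi>_def by (auto simp: image_iff)
  qed
  have vH: "verts H = insert w X" unfolding H_def comp3_def by simp
  have eH: "edges H = edges (induced G X) \<union> {e1, e2, e3}" unfolding H_def comp3_def by simp
  have wf: "wf_graph H"
    using a wf_induced[OF f(1) XV] unfolding wf_graph_def H_def comp3_def induced_def by auto
  have injE: "inj_on \<psi> (edges G)"
    using e unfolding \<psi>_def by (intro inj_onI) (auto split: if_splits)
  have injc: "inj_on \<psi> (crossing G Z)" for Z using injE crossing_subset by (rule inj_on_subset)
  have cc: "card (crossing H Z) = card (crossing G Z)" if "Z \<subseteq> X" for Z
    using cr[OF that] card_image[OF injc] by simp
  have sw: "star H w = \<psi> ` crossing G X"
  proof -
    have "verts H - X = {w}" using vH wX by auto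
    then have "star H w = crossing H X" using crossing_compl[OF wf, of X] by simp
    then show ?thesis using cr[of X] by simp
  qed
  have cut: "2 \<le> card (crossing H Z)" if Z: "Z \<subseteq> verts H" "Z \<noteq> {}" "Z \<noteq> verts H" for Z
  proof -
    have *: "2 \<le> card (crossing H Z)" if Z: "Z \<subseteq> X" "Z \<noteq> {}" for Z
      unfolding cc[OF Z(1)] using Z XV Xp by (intro f(6)) auto
    show ?thesis
    proof (cases "w \<in> Z")
      case True
      then have "2 \<le> card (crossing H (verts H - Z))" using Z vH by (intro *) auto
      then show ?thesis using crossing_compl[OF wf, of Z] by simp
    next
      case False
      then show ?thesis using Z vH by (intro *) auto
    qed
  qed
  have "card (star H v) = 3" if "v \<in> verts H" for v
  proof (cases "v = w")
    case True
    then show ?thesis using sw card_image[OF injc, of X] c by simp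
  next
    case False
    then have "v \<in> X" using that vH by simp
    then show ?thesis using cc[of "{v}"] f(5)[of v] XV by auto
  qed
  moreover have "fst (ends H x) \<noteq> snd (ends H x)" if "x \<in> edges H" for x
    using that a wX G unfolding H_def comp3_def induced_def bridgeless_cubic_def by auto
  moreover have "verts H \<noteq> {}" using vH by blast
  ultimately have "bridgeless_cubic H" unfolding bridgeless_cubic_def using wf cut by blast
  moreover have "\<psi> ` crossing G X = {e1, e2, e3}" unfolding c(1) \<psi>_def using c(2) by auto
  moreover have "\<psi> x = x" if "x \<in> edges (induced G X)" for x
    using that edges_induced(3)[OF f(1) XV] fX unfolding \<psi>_def by auto
  ultimately have "side G X H \<psi>" unfolding side_def vH eH using cr[of "{_}"] injc sw e(1) by auto
  then show ?thesis unfolding H_def \<psi>_def a1_def a2_def a3_def .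
qed

text \<open>The same two graphs have to serve the decomposition step and the sum that undoes it, so
  both facts are kept together. The sum recovers \<open>G\<close> up to \<open>iso\<close>, since
  labels and orientations of the joining edges may differ.\<close>

definition split_pair :: "graph \<Rightarrow> nat set \<Rightarrow> graph \<Rightarrow> (nat \<Rightarrow> nat) \<Rightarrow> graph \<Rightarrow> (nat \<Rightarrow> nat) \<Rightarrow> bool" where
  "split_pair G X H1 \<psi>1 H2 \<psi>2 \<longleftrightarrow> side G X H1 \<psi>1 \<and> side G (verts G - X) H2 \<psi>2 \<and>
     split_along_cut G H1 H2 \<and> (\<exists>S. (two_sum H1 H2 S \<or> three_sum H1 H2 S) \<and> iso S G)"

lemma fresh_nats: "finite A \<Longrightarrow> \<exists>m. \<forall>n\<ge>m. n \<notin> (A :: nat set)"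
  by (meson finite_nat_set_iff_bounded linorder_not_less)

lemma inc_edges_eq_star: "bridgeless_cubic G \<Longrightarrow> inc_edges G v = star G v"
  using in_star_iff unfolding inc_edges_def by blast

lemma split_two_cut:
  assumes G: "bridgeless_cubic G" and X: "proper_cut G X" and c2: "card (crossing G X) = 2"
  obtains H1 \<psi>1 H2 \<psi>2 where "split_pair G X H1 \<psi>1 H2 \<psi>2" "verts H1 = X" "verts H2 = verts G - X"
    "\<forall>f\<in>crossing G X. \<forall>f'\<in>crossing G X. \<psi>1 f = \<psi>1 f' \<and> \<psi>2 f = \<psi>2 f'"
proof -
  note f = bridgeless_cubicD[OF G]
  let ?Y = "verts G - X"
  have XV: "X \<subseteq> verts G" and Xp: "X \<noteq> {}" "X \<noteq> verts G" using X unfolding proper_cut_def by auto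
  have Y: "proper_cut G ?Y" using proper_cut_compl[OF X] .
  have cY: "crossing G ?Y = crossing G X" using crossing_compl[OF f(1)] .
  \<comment> \<open>By parity a side of a 2-cut has an even number of vertices, so at least two;
    this is what makes the cut independent.\<close>
  have size: "2 \<le> card Z" if "proper_cut G Z" "card (crossing G Z) = 2" for Z
  proof -
    have Z: "Z \<subseteq> verts G" "Z \<noteq> {}" using that unfolding proper_cut_def by auto
    then have "even (card Z)" using even_card_crossing_iff[OF G Z(1)] that(2) by simp
    moreover have "card Z \<noteq> 0" using Z f(2) finite_subset by fastforce
    ultimately show ?thesis by presburger
  qed
  have min: "2 \<le> card (crossing G Z)" if "proper_cut G Z" for Z
    using f(6) that unfolding proper_cut_def by blast
  have inj: "inj_on (inend G X) (crossing G X)"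
    using inend_inj[OF G XV size[OF X c2]] min unfolding c2 by blast
  have injY: "inj_on (inend G ?Y) (crossing G X)"
    using inend_inj[OF G _ size[OF Y]] min unfolding cY c2 by blast
  obtain f1 f2 where c: "crossing G X = {f1, f2}" "f1 \<noteq> f2" using c2 by (meson card_2_iff)
  have fX: "f1 \<in> crossing G X" "f2 \<in> crossing G X" using c by auto
  obtain m where m: "\<forall>n\<ge>m. n \<notin> edges G" using fresh_nats[OF f(3)] by blast
  define e where "e = m"
  define e' where "e' = Suc m"
  have ee: "e \<notin> edges G" "e' \<notin> edges G" "e \<noteq> e'" using m unfolding e_def e'_def by auto
  define a1 a2 b1 b2 where ab: "a1 = inend G X f1" "a2 = inend G X f2" "b1 = inend G ?Y f1" "b2 = inend G ?Y f2"
  define H1 where "H1 = comp2 G X e a1 a2"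
  define H2 where "H2 = comp2 G ?Y e' b1 b2"
  have s1: "side G X H1 (id(f1 := e, f2 := e))"
    using side_comp2[OF G X c inj ee(1)] unfolding H1_def ab .
  have s2: "side G ?Y H2 (id(f1 := e', f2 := e'))"
    using side_comp2[OF G Y _ c(2) _ ee(2)] injY unfolding cY H2_def ab using c(1) by blast
  have v1: "verts H1 = X" and v2: "verts H2 = ?Y" unfolding H1_def H2_def comp2_def by simp_all
  have tv: "two_valent (induced G X) = {a1, a2}" "two_valent (induced G ?Y) = {b1, b2}"
    using two_valent_induced[OF G XV inj] two_valent_induced[OF G _ injY[folded cY]] c cY
    unfolding ab by auto
  have ne: "a1 \<noteq> a2" "b1 \<noteq> b2" using inj injY fX c(2) unfolding ab by (auto dest: inj_onD)
  have i1: "edges (induced G X) \<subseteq> edges G" "edges (induced G ?Y) \<subseteq> edges G"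
    using edges_induced_subset by auto
  have "completion G (crossing G X) (induced G X) H1"
    unfolding completion_def H1_def comp2_def
    by (intro disjI1 conjI c2 exI[of _ a1] exI[of _ a2] exI[of _ e] tv ne ee) (simp add: induced_def)
  moreover have "completion G (crossing G X) (induced G ?Y) H2"
    unfolding completion_def H2_def comp2_def
    by (intro disjI1 conjI c2 exI[of _ b1] exI[of _ b2] exI[of _ e'] tv ne ee) (simp add: induced_def)
  ultimately have spl: "split_along_cut G H1 H2"
    using small_indep_cutI[OF G X _ inj injY] c2 unfolding split_along_cut_def by blast
  \<comment> \<open>Reusing the labels \<open>f1\<close> and \<open>f2\<close> for the joining edges
    lets the identity be the isomorphism to \<open>G\<close>, up to the orientation of these two
    edges.\<close>
  define S where "S = \<lparr>verts = verts H1 \<union> verts H2,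
             edges = (edges H1 - {e}) \<union> (edges H2 - {e'}) \<union> {f1, f2},
             ends = (\<lambda>x. if x \<in> edges H1 then ends H1 x else ends H2 x)(f1 := (a1, b1), f2 := (a2, b2))\<rparr>"
  have E1: "edges H1 = insert e (edges (induced G X))" and E2: "edges H2 = insert e' (edges (induced G ?Y))"
    unfolding H1_def H2_def comp2_def by simp_all
  note ei = edges_induced[OF f(1) XV]
  have fn: "f1 \<notin> edges H1 \<union> edges H2" "f2 \<notin> edges H1 \<union> edges H2"
    using fX ei edges_induced(3)[OF f(1), of ?Y] crossing_subset[of G X] ee unfolding E1 E2 cY by auto
  have "two_sum H1 H2 S" unfolding two_sum_def
  proof (intro conjI)
    show "two_connected H1" "cubic H1" "two_connected H2" "cubic H2"
      using sideD(1)[OF s1] sideD(1)[OF s2] bridgeless_cubic_iff by auto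
    show "verts H1 \<inter> verts H2 = {}" unfolding v1 v2 by blast
    show "edges H1 \<inter> edges H2 = {}" unfolding E1 E2 using ee i1 ei(2) by auto
    show "\<exists>e f g1 g2 h1 h2 k1 k2. e \<in> edges H1 \<and> f \<in> edges H2 \<and> ends H1 e = (h1, h2) \<and>
        (ends H2 f = (k1, k2) \<or> ends H2 f = (k2, k1)) \<and> g1 \<noteq> g2 \<and>
        g1 \<notin> edges H1 \<union> edges H2 \<and> g2 \<notin> edges H1 \<union> edges H2 \<and>
        S = \<lparr>verts = verts H1 \<union> verts H2,
             edges = (edges H1 - {e}) \<union> (edges H2 - {f}) \<union> {g1, g2},
             ends = (\<lambda>x. if x \<in> edges H1 then ends H1 x else ends H2 x)(g1 := (h1, k1), g2 := (h2, k2))\<rparr>"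
    proof (rule exI[of _ e], rule exI[of _ e'], rule exI[of _ f1], rule exI[of _ f2],
        rule exI[of _ a1], rule exI[of _ a2], rule exI[of _ b1], rule exI[of _ b2], intro conjI fn c(2))
      show "e \<in> edges H1" "e' \<in> edges H2" unfolding E1 E2 by simp_all
      show "ends H1 e = (a1, a2)" unfolding H1_def comp2_def by simp
      show "ends H2 e' = (b1, b2) \<or> ends H2 e' = (b2, b1)" unfolding H2_def comp2_def by simp
      show "S = \<lparr>verts = verts H1 \<union> verts H2,
             edges = (edges H1 - {e}) \<union> (edges H2 - {e'}) \<union> {f1, f2},
             ends = (\<lambda>x. if x \<in> edges H1 then ends H1 x else ends H2 x)(f1 := (a1, b1), f2 := (a2, b2))\<rparr>"
        by (rule S_def)
    qed
  qed
  moreover have "iso S G" unfolding iso_def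
  proof (intro exI[of _ id] conjI ballI)
    have "verts S = verts G" unfolding S_def v1 v2 using XV by auto
    then show "bij_betw id (verts S) (verts G)" by simp
    have "edges S = edges G" unfolding S_def E1 E2 using ei(1) c(1) i1 ee by auto
    then show "bij_betw id (edges S) (edges G)" by simp
    fix x assume x: "x \<in> edges S"
    have "ends G x = ends S x \<or> ends G x = (snd (ends S x), fst (ends S x))"
    proof -
      consider "x = f1" | "x = f2" | "x \<noteq> f1" "x \<noteq> f2" "x \<in> edges (induced G X)"
        | "x \<noteq> f1" "x \<noteq> f2" "x \<in> edges (induced G ?Y)" "x \<notin> edges (induced G X)"
        using x unfolding S_def E1 E2 by auto
      then show ?thesis
      proof cases
        case 1
        then show ?thesis using inend_crossing(3)[OF G fX(1)] c(2) unfolding S_def ab by auto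
      next
        case 2
        then show ?thesis using inend_crossing(3)[OF G fX(2)] c(2) unfolding S_def ab by auto
      next
        case 3
        then have "x \<noteq> e" using i1 ee by auto
        then show ?thesis using 3 unfolding S_def E1 by (simp add: H1_def comp2_def)
      next
        case 4
        then have "x \<noteq> e" "x \<noteq> e'" using i1 ee by auto
        then show ?thesis using 4 unfolding S_def E1 by (simp add: H2_def comp2_def)
      qed
    qed
    then show "ends G (id x) = (id (fst (ends S x)), id (snd (ends S x))) \<or>
      ends G (id x) = (id (snd (ends S x)), id (fst (ends S x)))" by simp
  qed
  ultimately have "split_pair G X H1 (id(f1 := e, f2 := e)) H2 (id(f1 := e', f2 := e'))"
    unfolding split_pair_def using s1 s2 spl by blast
  moreover have "\<forall>x\<in>crossing G X. \<forall>y\<in>crossing G X.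
      (id(f1 := e, f2 := e)) x = (id(f1 := e, f2 := e)) y \<and>
      (id(f1 := e', f2 := e')) x = (id(f1 := e', f2 := e')) y"
    unfolding c(1) by auto
  ultimately show thesis by (rule that[OF _ v1 v2])
qed

lemma split_three_cut:
  assumes G: "bridgeless_cubic G" and X: "proper_cut G X" and c3: "card (crossing G X) = 3"
    and inj: "inj_on (inend G X) (crossing G X)" and injY: "inj_on (inend G (verts G - X)) (crossing G X)"
  obtains H1 \<psi>1 H2 \<psi>2 w1 w2 where "split_pair G X H1 \<psi>1 H2 \<psi>2"
    "verts H1 = insert w1 X" "verts H2 = insert w2 (verts G - X)" "w1 \<notin> verts G" "w2 \<notin> verts G"
    "inj_on \<psi>1 (crossing G X)" "inj_on \<psi>2 (crossing G X)"
proof -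
  note f = bridgeless_cubicD[OF G]
  let ?Y = "verts G - X"
  have XV: "X \<subseteq> verts G" and Xp: "X \<noteq> {}" "X \<noteq> verts G" using X unfolding proper_cut_def by auto
  have Y: "proper_cut G ?Y" using proper_cut_compl[OF X] .
  have cY: "crossing G ?Y = crossing G X" using crossing_compl[OF f(1)] .
  obtain f1 f2 f3 where c: "crossing G X = {f1, f2, f3}" "distinct [f1, f2, f3]"
    using c3 unfolding card_3_iff by auto
  have fX: "f1 \<in> crossing G X" "f2 \<in> crossing G X" "f3 \<in> crossing G X" using c by auto
  have fd: "f1 \<noteq> f2" "f1 \<noteq> f3" "f2 \<noteq> f3" using c(2) by auto
  obtain m where m: "\<forall>n\<ge>m. n \<notin> edges G" using fresh_nats[OF f(3)] by blast
  obtain n where n: "\<forall>i\<ge>n. i \<notin> verts G" using fresh_nats[OF f(2)] by blast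
  define w1 w2 where w: "w1 = n" "w2 = Suc n"
  have wn: "w1 \<notin> verts G" "w2 \<notin> verts G" "w1 \<noteq> w2" using n unfolding w by auto
  \<comment> \<open>Six different fresh labels, as the two summands must have disjoint edge
    sets.\<close>
  define e1 e2 e3 d1 d2 d3 where ed: "e1 = m" "e2 = m + 1" "e3 = m + 2" "d1 = m + 3" "d2 = m + 4" "d3 = m + 5"
  have en: "e1 \<notin> edges G" "e2 \<notin> edges G" "e3 \<notin> edges G" "d1 \<notin> edges G" "d2 \<notin> edges G" "d3 \<notin> edges G"
    using m unfolding ed by auto
  have dist: "distinct [e1, e2, e3]" "distinct [d1, d2, d3]" "{e1, e2, e3} \<inter> {d1, d2, d3} = {}"
    unfolding ed by auto
  have ei0: "{e1, e2, e3} \<inter> edges G = {}" "{d1, d2, d3} \<inter> edges G = {}" using en by auto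
  define a1 a2 a3 where a: "a1 = inend G X f1" "a2 = inend G X f2" "a3 = inend G X f3"
  define b1 b2 b3 where b: "b1 = inend G ?Y f1" "b2 = inend G ?Y f2" "b3 = inend G ?Y f3"
  define H1 where "H1 = comp3 G X w1 e1 e2 e3 a1 a2 a3"
  define H2 where "H2 = comp3 G ?Y w2 d1 d2 d3 b1 b2 b3"
  define \<psi>1 where "\<psi>1 = id(f1 := e1, f2 := e2, f3 := e3)"
  define \<psi>2 where "\<psi>2 = id(f1 := d1, f2 := d2, f3 := d3)"
  have s1: "side G X H1 \<psi>1"
    using side_comp3[OF G X c ei0(1) dist(1) wn(1)] unfolding H1_def a \<psi>1_def .
  have s2: "side G ?Y H2 \<psi>2"
    using side_comp3[OF G Y c(1)[folded cY] c(2) ei0(2) dist(2) wn(2)] unfolding H2_def b \<psi>2_def .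
  have v1: "verts H1 = insert w1 X" and v2: "verts H2 = insert w2 ?Y"
    unfolding H1_def H2_def comp3_def by simp_all
  have tv: "two_valent (induced G X) = {a1, a2, a3}" "two_valent (induced G ?Y) = {b1, b2, b3}"
    using two_valent_induced[OF G XV inj] two_valent_induced[OF G _ injY[folded cY]] c cY
    unfolding a b by auto
  have da: "distinct [a1, a2, a3]" using inj fX fd unfolding a by (auto dest: inj_onD)
  have db: "distinct [b1, b2, b3]" using injY fX fd unfolding b by (auto dest: inj_onD)
  have i1: "edges (induced G X) \<subseteq> edges G" "edges (induced G ?Y) \<subseteq> edges G"
    using edges_induced_subset by auto
  have "completion G (crossing G X) (induced G X) H1"
    unfolding completion_def H1_def comp3_def
    by (intro disjI2 conjI c3 exI[of _ a1] exI[of _ a2] exI[of _ a3] exI[of _ w1] exI[of _ e1]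
      exI[of _ e2] exI[of _ e3] tv da wn dist ei0) (simp add: induced_def)
  moreover have "completion G (crossing G X) (induced G ?Y) H2"
    unfolding completion_def H2_def comp3_def
    by (intro disjI2 conjI c3 exI[of _ b1] exI[of _ b2] exI[of _ b3] exI[of _ w2] exI[of _ d1]
      exI[of _ d2] exI[of _ d3] tv db wn dist ei0) (simp add: induced_def)
  ultimately have spl: "split_along_cut G H1 H2"
    using small_indep_cutI[OF G X _ inj injY] c3 unfolding split_along_cut_def by blast
  note ei = edges_induced[OF f(1) XV]
  have E1: "edges H1 = edges (induced G X) \<union> {e1, e2, e3}"
    and E2: "edges H2 = edges (induced G ?Y) \<union> {d1, d2, d3}"
    unfolding H1_def H2_def comp3_def by simp_all
  have wX: "w1 \<notin> X" "w2 \<notin> ?Y" using wn XV by auto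
  have inc1: "inc_edges H1 w1 = {e1, e2, e3}"
    using inc_edges_eq_star[OF sideD(1)[OF s1]] sideD(5)[OF s1, of w1] v1 wX c fd unfolding \<psi>1_def by auto
  have inc2: "inc_edges H2 w2 = {d1, d2, d3}"
    using inc_edges_eq_star[OF sideD(1)[OF s2]] sideD(5)[OF s2, of w2] v2 wX c fd cY unfolding \<psi>2_def by auto
  define phi where "phi = (\<lambda>x. if x = e1 then d1 else if x = e2 then d2 else d3)"
  define S where "S = \<lparr>verts = (verts H1 - {w1}) \<union> (verts H2 - {w2}),
             edges = edges H1 \<union> (edges H2 - inc_edges H2 w2),
             ends = (\<lambda>x. if x \<in> inc_edges H1 w1 then (other_end H1 w1 x, other_end H2 w2 (phi x))
                         else if x \<in> edges H1 then ends H1 x else ends H2 x)\<rparr>"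
  have bij: "bij_betw phi {e1, e2, e3} {d1, d2, d3}"
    using dist unfolding bij_betw_def inj_on_def phi_def by auto
  have "three_sum H1 H2 S" unfolding three_sum_def
  proof (intro conjI)
    show "two_connected H1" "cubic H1" "two_connected H2" "cubic H2"
      using sideD(1)[OF s1] sideD(1)[OF s2] bridgeless_cubic_iff by auto
    show "verts H1 \<inter> verts H2 = {}" unfolding v1 v2 using wn XV by auto
    show "edges H1 \<inter> edges H2 = {}" unfolding E1 E2 using en dist(3) i1 ei(2) by auto
    show "\<exists>u v phi. u \<in> verts H1 \<and> v \<in> verts H2 \<and> bij_betw phi (inc_edges H1 u) (inc_edges H2 v) \<and>
        S = \<lparr>verts = (verts H1 - {u}) \<union> (verts H2 - {v}),
             edges = edges H1 \<union> (edges H2 - inc_edges H2 v),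
             ends = (\<lambda>x. if x \<in> inc_edges H1 u then (other_end H1 u x, other_end H2 v (phi x))
                         else if x \<in> edges H1 then ends H1 x else ends H2 x)\<rparr>"
      using bij v1 v2 unfolding inc1[symmetric] inc2[symmetric] S_def
      by (intro exI[of _ w1] exI[of _ w2] exI[of _ phi] conjI) simp_all
  qed
  \<comment> \<open>A 3-sum keeps the labels \<open>e1\<close>, \<open>e2\<close>, \<open>e3\<close>
    of the edges at the deleted vertex of \<open>H1\<close>, so these are renamed back to the cut
    edges; \<open>\<psi>1\<close> is the inverse renaming.\<close>
  moreover have "iso S G" unfolding iso_def
  proof (rule exI[of _ id], rule exI[of _ "id(e1 := f1, e2 := f2, e3 := f3)"], intro conjI ballI)
    let ?g = "id(e1 := f1, e2 := f2, e3 := f3)"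
    have "verts S = verts G" unfolding S_def v1 v2 using XV wX wn by auto
    then show "bij_betw id (verts S) (verts G)" by simp
    have ES: "edges S = edges (induced G X) \<union> {e1, e2, e3} \<union> edges (induced G ?Y)"
      unfolding S_def E1 inc2 E2 using en i1 by auto
    have EG: "edges G = edges (induced G X) \<union> edges (induced G ?Y) \<union> {f1, f2, f3}" using ei(1) c(1) by simp
    have nf: "f1 \<notin> edges (induced G X)" "f2 \<notin> edges (induced G X)" "f3 \<notin> edges (induced G X)"
       "f1 \<notin> edges (induced G ?Y)" "f2 \<notin> edges (induced G ?Y)" "f3 \<notin> edges (induced G ?Y)"
      using fX ei(3) edges_induced(3)[OF f(1), of ?Y] cY by auto
    have ne: "\<And>x. x \<in> edges (induced G X) \<union> edges (induced G ?Y) \<Longrightarrow> x \<noteq> e1 \<and> x \<noteq> e2 \<and> x \<noteq> e3 \<and> x \<noteq> d1 \<and> x \<noteq> d2 \<and> x \<noteq> d3"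
      using en i1 by auto
    have ed': "e1 \<noteq> e2" "e1 \<noteq> e3" "e2 \<noteq> e3" "d1 \<noteq> d2" "d1 \<noteq> d3" "d2 \<noteq> d3" using dist by auto
    show "bij_betw ?g (edges S) (edges G)"
    proof (rule bij_betw_byWitness[where f' = \<psi>1])
      show "\<forall>x\<in>edges S. \<psi>1 (?g x) = x"
        unfolding ES \<psi>1_def using nf ne fd ed' by auto
      show "\<forall>x\<in>edges G. ?g (\<psi>1 x) = x"
        unfolding EG \<psi>1_def using nf ne fd ed' by auto
      show "?g ` edges S \<subseteq> edges G" unfolding ES EG using ne ed' by auto
      show "\<psi>1 ` edges G \<subseteq> edges S" unfolding ES EG \<psi>1_def using nf fd by auto
    qed
    fix x assume x: "x \<in> edges S"
    have "ends G (?g x) = ends S x \<or> ends G (?g x) = (snd (ends S x), fst (ends S x))"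
    proof -
      have en1: "ends H1 e1 = (w1, a1)" "ends H1 e2 = (w1, a2)" "ends H1 e3 = (w1, a3)"
        "ends H2 d1 = (w2, b1)" "ends H2 d2 = (w2, b2)" "ends H2 d3 = (w2, b3)"
        using ed' unfolding H1_def H2_def comp3_def by auto
      have eS: "ends S e1 = (a1, b1)" "ends S e2 = (a2, b2)" "ends S e3 = (a3, b3)"
        unfolding S_def inc1 phi_def using ed' en1 by (simp_all add: other_end_def)
      consider "x = e1" | "x = e2" | "x = e3" | "x \<in> edges (induced G X)"
        | "x \<in> edges (induced G ?Y)" "x \<notin> edges (induced G X)"
        using x unfolding ES by auto
      then show ?thesis
      proof cases
        case 1
        then show ?thesis using inend_crossing(3)[OF G fX(1)] ed' eS unfolding a b by auto
      next
        case 2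
        then show ?thesis using inend_crossing(3)[OF G fX(2)] ed' eS unfolding a b by auto
      next
        case 3
        then show ?thesis using inend_crossing(3)[OF G fX(3)] ed' eS unfolding a b by auto
      next
        case 4
        then have "ends S x = ends H1 x" unfolding S_def inc1 E1 using ne by auto
        also have "\<dots> = ends G x" using 4 ne unfolding H1_def comp3_def by auto
        finally show ?thesis using 4 ne by auto
      next
        case 5
        then have "ends S x = ends H2 x" unfolding S_def inc1 E1 using ne by auto
        also have "\<dots> = ends G x" using 5 ne unfolding H2_def comp3_def by auto
        finally show ?thesis using 5 ne by auto
      qed
    qed
    then show "ends G (?g x) = (id (fst (ends S x)), id (snd (ends S x))) \<or>
      ends G (?g x) = (id (snd (ends S x)), id (fst (ends S x)))" by simp
  qed
  ultimately have sp: "split_pair G X H1 \<psi>1 H2 \<psi>2"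
    unfolding split_pair_def using s1 s2 spl by blast
  have "inj_on \<psi>1 (crossing G X)" "inj_on \<psi>2 (crossing G X)"
    using sideD(6)[OF s1, of w1] sideD(6)[OF s2, of w2] wX v1 v2 cY by auto
  then show thesis using that sp v1 v2 wn by blast
qed

section \<open>Factorizations\<close>

definition factorizes :: "graph \<Rightarrow> graph multiset \<Rightarrow> bool" where
  "factorizes G D \<longleftrightarrow> decomposition G D \<and> reconstructs D G"

lemma factorizes_refl: "factorizes G {#G#}"
proof -
  have "iso G G" unfolding iso_def by (rule exI[of _ id], rule exI[of _ id]) simp
  then show ?thesis unfolding factorizes_def using decomposition.base reconstructs.leaf by blast
qed

text \<open>The induction runs over the decomposition of \<open>K\<close>; the other factors
  \<open>D\<close> form a context in which each of its steps is repeated. Thus the two sides of a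
  cut can be decomposed one after the other.\<close>

lemma decomposition_replace:
  assumes "decomposition K D'" "decomposition G (D + {#K#})"
  shows "decomposition G (D + D')"
  using assms
proof (induction rule: decomposition.induct)
  case (step D' H H1 H2)
  have "decomposition G (D + D' - {#H#} + {#H1, H2#})"
    using step by (intro decomposition.step) auto
  moreover have "D + D' - {#H#} + {#H1, H2#} = D + (D' - {#H#} + {#H1, H2#})"
  proof -
    obtain D0 where D0: "D' = add_mset H D0" using multi_member_split[OF step(2)] by blast
    show ?thesis unfolding D0 by simp
  qed
  ultimately show ?case by simp
qed

lemma factorizes_split:
  assumes s: "split_pair G X H1 \<psi>1 H2 \<psi>2" and f: "factorizes H1 D1" "factorizes H2 D2"
  shows "factorizes G (D1 + D2)"
proof -
  have "split_along_cut G H1 H2" and S: "\<exists>S. (two_sum H1 H2 S \<or> three_sum H1 H2 S) \<and> iso S G"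
    using s unfolding split_pair_def by auto
  then have "decomposition G ({#G#} - {#G#} + {#H1, H2#})"
    by (intro decomposition.step[OF decomposition.base]) auto
  then have "decomposition G ({#H2#} + {#H1#})" by (simp add: add_mset_commute)
  then have "decomposition G ({#H2#} + D1)"
    using decomposition_replace f(1) unfolding factorizes_def by blast
  then have "decomposition G (D1 + {#H2#})" by (simp add: add.commute)
  then have "decomposition G (D1 + D2)"
    using decomposition_replace f(2) unfolding factorizes_def by blast
  then show ?thesis using S f reconstructs.sum unfolding factorizes_def by blast
qed

section \<open>Colourings and covers across a small cut\<close>

definition restricts :: "graph \<Rightarrow> nat set \<Rightarrow> graph \<Rightarrow> (nat \<Rightarrow> nat) \<Rightarrow> (nat \<Rightarrow> nat set) \<Rightarrow> (nat \<Rightarrow> nat set) \<Rightarrow> bool" where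
  "restricts G X H \<psi> k k1 \<longleftrightarrow> cover3 H k1 \<and> (\<forall>e\<in>edges (induced G X). k1 e = k e) \<and>
    (\<forall>f\<in>crossing G X. k1 (\<psi> f) = k f) \<and>
    (\<forall>j. card (covered H k1 j) = card {e\<in>edges (induced G X). card (k e) = j} +
        card (\<psi> ` {f\<in>crossing G X. card (k f) = j}))"

section \<open>Covers restricted to the two sides of a cut\<close>

lemma card_covered_split:
  assumes G: "bridgeless_cubic G" and X: "X \<subseteq> verts G"
  shows "card (covered G k j) = card {e\<in>edges (induced G X). card (k e) = j} +
    card {e\<in>edges (induced G (verts G - X)). card (k e) = j} + card {f\<in>crossing G X. card (k f) = j}"
proof -
  note f = bridgeless_cubicD[OF G]
  note ei = edges_induced[OF f(1) X]
  have e3: "edges (induced G (verts G - X)) \<inter> crossing G X = {}"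
    using edges_induced(3)[OF f(1), of "verts G - X"] crossing_compl[OF f(1)] by auto
  have fin: "finite (edges (induced G X))" "finite (edges (induced G (verts G - X)))"
    using f(3) edges_induced_subset finite_subset by blast+
  let ?A = "{e\<in>edges (induced G X). card (k e) = j}"
  let ?B = "{e\<in>edges (induced G (verts G - X)). card (k e) = j}"
  let ?C = "{f\<in>crossing G X. card (k f) = j}"
  have "covered G k j = (?A \<union> ?B) \<union> ?C" using ei(1) unfolding covered_def by blast
  moreover have "card ((?A \<union> ?B) \<union> ?C) = card (?A \<union> ?B) + card ?C"
    using fin f(7)[of X] ei(3) e3 by (intro card_Un_disjoint) auto
  moreover have "card (?A \<union> ?B) = card ?A + card ?B"
    using fin ei(2) by (intro card_Un_disjoint) auto
  ultimately show ?thesis by simp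
qed

text \<open>Each colour occurs an even number of times on two edges, so it is on both or on
  neither.\<close>

lemma two_cut_cover_eq:
  assumes G: "bridgeless_cubic G" and k: "cover3 G k" and X: "X \<subseteq> verts G" and c: "card (crossing G X) = 2"
    and f: "f \<in> crossing G X" "f' \<in> crossing G X"
  shows "k f = k f'"
proof -
  have sub: "k f \<subseteq> k f'" if f: "f \<in> crossing G X" "f' \<in> crossing G X" for f f'
  proof
    fix i assume i: "i \<in> k f"
    have "f \<in> edges G" using f crossing_subset by blast
    then have "i \<in> colours" using i cover3_subset(1)[OF G k] by blast
    then have ev: "even (card {f\<in>crossing G X. i \<in> k f})" using cover3_parity[OF G k X] c by simp
    show "i \<in> k f'"
    proof (rule ccontr)
      assume n: "i \<notin> k f'"
      then have "f \<noteq> f'" using i by blast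
      then have "{f, f'} = crossing G X"
        using c f bridgeless_cubicD(7)[OF G] by (intro card_seteq) simp_all
      then have "{f\<in>crossing G X. i \<in> k f} = {f}" using i n by blast
      then show False using ev by simp
    qed
  qed
  show ?thesis using sub[OF f] sub[OF f(2,1)] by blast
qed

lemma side_restricts:
  assumes G: "bridgeless_cubic G" and X: "X \<subseteq> verts G" and s: "side G X H \<psi>" and k: "cover3 G k"
    and fib: "\<And>f f'. f \<in> crossing G X \<Longrightarrow> f' \<in> crossing G X \<Longrightarrow> \<psi> f = \<psi> f' \<Longrightarrow> k f = k f'"
    and w: "verts H \<noteq> X \<Longrightarrow> (\<Union>f\<in>crossing G X. k f) = colours \<and>
      (\<forall>f\<in>crossing G X. \<forall>f'\<in>crossing G X. f \<noteq> f' \<longrightarrow> k f \<inter> k f' = {})"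
  shows "\<exists>k1. restricts G X H \<psi> k k1"
proof (rule side_cover3[OF G X s k])
  fix k1
  assume "cover3 H k1" "\<And>e. e \<in> edges (induced G X) \<Longrightarrow> k1 e = k e"
    "\<And>f. f \<in> crossing G X \<Longrightarrow> k1 (\<psi> f) = k f"
    "\<And>j. card (covered H k1 j) = card {e\<in>edges (induced G X). card (k e) = j} +
        card (\<psi> ` {f\<in>crossing G X. card (k f) = j})"
  then show ?thesis unfolding restricts_def by (intro exI[of _ k1]) simp
qed (erule (2) fib, erule w)

lemma restricts_two_cut:
  assumes G: "bridgeless_cubic G" and k: "cover3 G k" and X: "X \<subseteq> verts G" and c: "card (crossing G X) = 2"
    and s: "side G X H \<psi>" "verts H = X"
  shows "\<exists>k1. restricts G X H \<psi> k k1"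
proof (rule side_restricts[OF G X s(1) k])
  fix f f' assume "f \<in> crossing G X" "f' \<in> crossing G X"
  then show "k f = k f'" by (rule two_cut_cover_eq[OF G k X c])
qed (use s(2) in simp)

lemma restricts_three_cut:
  assumes G: "bridgeless_cubic G" and k: "cover3 G k" and X: "X \<subseteq> verts G"
    and s: "side G X H \<psi>" "inj_on \<psi> (crossing G X)"
    and w: "(\<Union>f\<in>crossing G X. k f) = colours"
      "\<And>f f'. f \<in> crossing G X \<Longrightarrow> f' \<in> crossing G X \<Longrightarrow> f \<noteq> f' \<Longrightarrow> k f \<inter> k f' = {}"
  shows "\<exists>k1. restricts G X H \<psi> k k1"
proof (rule side_restricts[OF G X s(1) k])
  fix f f' assume "f \<in> crossing G X" "f' \<in> crossing G X" "\<psi> f = \<psi> f'"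
  then have "f = f'" using inj_onD[OF s(2)] by simp
  then show "k f = k f'" by simp
qed (use w in simp)

lemma restricts_tait:
  assumes "bridgeless_cubic H" "restricts G X H \<psi> (\<lambda>e. {c e}) k1"
  shows "tait H"
proof -
  have "cover3 H k1" "card (covered H k1 0) = 0" using assms(2) unfolding restricts_def by simp_all
  then show ?thesis using tait_if_all_covered[OF assms(1)] by blast
qed

section \<open>Colourings restricted to the sides and glued again\<close>

lemma tait_side_two_cut:
  assumes G: "bridgeless_cubic G" and X: "X \<subseteq> verts G" and c: "card (crossing G X) = 2"
    and s: "side G X H \<psi>" "verts H = X" and t: "tait G"
  shows "tait H"
proof -
  obtain c' where c': "\<And>v. v \<in> verts G \<Longrightarrow> c' ` star G v = colours" using t unfolding tait_def by blast
  obtain k1 where "restricts G X H \<psi> (\<lambda>e. {c' e}) k1"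
    using restricts_two_cut[OF G tait_cover3[OF G c'] X c s] by blast
  then show ?thesis using restricts_tait sideD(1)[OF s(1)] by blast
qed

text \<open>By parity each colour occurs an odd number of times on the three cut edges, hence
  exactly once, as the added vertex requires.\<close>

lemma tait_side_three_cut:
  assumes G: "bridgeless_cubic G" and X: "X \<subseteq> verts G" and c: "card (crossing G X) = 3"
    and s: "side G X H \<psi>" "inj_on \<psi> (crossing G X)" and t: "tait G"
  shows "tait H"
proof -
  obtain c' where c': "\<And>v. v \<in> verts G \<Longrightarrow> c' ` star G v = colours" using t unfolding tait_def by blast
  note k = tait_cover3[OF G c']
  have ex: "i \<in> c' ` crossing G X" if "i \<in> colours" for i
  proof -
    have "odd (card {f\<in>crossing G X. i \<in> {c' f}})" using cover3_parity[OF G k X that] c by simp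
    then have "{f\<in>crossing G X. i \<in> {c' f}} \<noteq> {}" by (metis card.empty even_zero)
    then show ?thesis by blast
  qed
  have "c' f \<in> colours" if f: "f \<in> crossing G X" for f
  proof -
    have "f \<in> edges G" using f crossing_subset by blast
    then show ?thesis using cover3_subset(1)[OF G k] by blast
  qed
  then have im: "c' ` crossing G X = colours" using ex by blast
  then have "inj_on c' (crossing G X)"
    using c bridgeless_cubicD(7)[OF G] by (intro eq_card_imp_inj_on) simp_all
  moreover have "(\<Union>f\<in>crossing G X. {c' f}) = colours" using im by blast
  moreover have "{c' f} \<inter> {c' f'} = {}" if "f \<in> crossing G X" "f' \<in> crossing G X" "f \<noteq> f'" for f f'
    using inj_onD[OF calculation(1)] that by auto
  ultimately obtain k1 where "restricts G X H \<psi> (\<lambda>e. {c' e}) k1"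
    using restricts_three_cut[OF G k X s] by blast
  then show ?thesis using restricts_tait sideD(1)[OF s(1)] by blast
qed

lemma tait_merge_two_cut:
  assumes G: "bridgeless_cubic G" and X: "X \<subseteq> verts G" and c: "crossing G X \<noteq> {}"
    and s: "side G X H1 \<psi>1" "side G (verts G - X) H2 \<psi>2"
    and const: "\<And>f f'. f \<in> crossing G X \<Longrightarrow> f' \<in> crossing G X \<Longrightarrow> \<psi>1 f = \<psi>1 f' \<and> \<psi>2 f = \<psi>2 f'"
    and t: "tait H1" "tait H2"
  shows "tait G"
proof -
  obtain c1 where c1: "\<And>v. v \<in> verts H1 \<Longrightarrow> c1 ` star H1 v = colours" using t(1) unfolding tait_def by blast
  obtain c2 where c2: "\<And>v. v \<in> verts H2 \<Longrightarrow> c2 ` star H2 v = colours" using t(2) unfolding tait_def by blast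
  obtain f0 where f0: "f0 \<in> crossing G X" using c by blast
  define x where "x = c2 (\<psi>2 f0)"
  define y where "y = c1 (\<psi>1 f0)"
  have "\<psi>1 f0 \<in> edges H1" "\<psi>2 f0 \<in> edges H2"
    using sideD(8)[OF s(1)] sideD(8)[OF s(2)] f0 crossing_compl[OF bridgeless_cubicD(1)[OF G], of X] by auto
  then have xy: "x \<in> colours" "y \<in> colours"
    using cover3_subset(1)[OF sideD(1)[OF s(1)] tait_cover3[OF sideD(1)[OF s(1)] c1]]
      cover3_subset(1)[OF sideD(1)[OF s(2)] tait_cover3[OF sideD(1)[OF s(2)] c2]]
    unfolding x_def y_def by auto
  \<comment> \<open>A 2-cut is represented by one edge on each side, so a single exchange of the
    colours \<open>x\<close> and \<open>y\<close> of these edges makes the sides agree.\<close>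
  define p where "p = (id :: nat \<Rightarrow> nat)(x := y, y := x)"
  have "p ` colours \<subseteq> colours" using xy unfolding p_def by auto
  moreover have "p (p z) = z" for z unfolding p_def by auto
  ultimately have "p ` colours = colours" by (metis image_eqI subset_antisym subsetI subsetD)
  moreover have "p (c2 (\<psi>2 f)) = c1 (\<psi>1 f)" if f: "f \<in> crossing G X" for f
  proof -
    have "\<psi>1 f = \<psi>1 f0" "\<psi>2 f = \<psi>2 f0" using const[OF f f0] by auto
    then show ?thesis unfolding p_def x_def y_def by auto
  qed
  ultimately show ?thesis using side_tait_merge[OF G X s c1 c2] by blast
qed

text \<open>At the added vertices both colourings are bijections from the cut edges to the colours;
  \<open>p\<close> is one of them after the inverse of the other.\<close>

lemma tait_merge_three_cut:
  assumes G: "bridgeless_cubic G" and X: "X \<subseteq> verts G" and c: "card (crossing G X) = 3"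
    and s: "side G X H1 \<psi>1" "side G (verts G - X) H2 \<psi>2"
    and w: "w1 \<in> verts H1 - X" "w2 \<in> verts H2 - (verts G - X)"
    and t: "tait H1" "tait H2"
  shows "tait G"
proof -
  obtain c1 where c1: "\<And>v. v \<in> verts H1 \<Longrightarrow> c1 ` star H1 v = colours" using t(1) unfolding tait_def by blast
  obtain c2 where c2: "\<And>v. v \<in> verts H2 \<Longrightarrow> c2 ` star H2 v = colours" using t(2) unfolding tait_def by blast
  have cc: "crossing G (verts G - X) = crossing G X" using crossing_compl bridgeless_cubicD(1)[OF G] by blast
  have i1: "(\<lambda>f. c1 (\<psi>1 f)) ` crossing G X = colours"
    using c1[of w1] sideD(5)[OF s(1), of w1] w by (simp add: image_image)
  have i2: "(\<lambda>f. c2 (\<psi>2 f)) ` crossing G X = colours"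
    using c2[of w2] sideD(5)[OF s(2), of w2] w cc by (simp add: image_image)
  have inj: "inj_on (\<lambda>f. c2 (\<psi>2 f)) (crossing G X)"
    using i2 c bridgeless_cubicD(7)[OF G] by (intro eq_card_imp_inj_on) simp_all
  define p where "p x = c1 (\<psi>1 (inv_into (crossing G X) (\<lambda>f. c2 (\<psi>2 f)) x))" for x
  have p: "p (c2 (\<psi>2 f)) = c1 (\<psi>1 f)" if "f \<in> crossing G X" for f
    unfolding p_def using inv_into_f_f[OF inj that] by simp
  have "p ` colours = p ` (\<lambda>f. c2 (\<psi>2 f)) ` crossing G X" using i2 by simp
  also have "\<dots> = (\<lambda>f. c1 (\<psi>1 f)) ` crossing G X" using p by (simp add: image_image)
  finally have "p ` colours = colours" using i1 by simp
  then show ?thesis using side_tait_merge[OF G X s c1 c2 _ p] by blast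
qed

text \<open>Stated for loopless connected graphs, because it is applied to a contracted graph too.
  The set reached from \<open>u\<close> after deleting \<open>S\<close> is cut off by edges of
  \<open>S\<close>, and each side contains the two distinct ends of some circuit edge.\<close>

lemma not_cyc_edge_conn_cut:
  assumes wf: "wf_graph G" and l: "\<And>e. e \<in> edges G \<Longrightarrow> fst (ends G e) \<noteq> snd (ends G e)"
    and con: "connected G" and n: "\<not> cyc_edge_conn 4 G"
  shows "\<exists>X. X \<subseteq> verts G \<and> card (crossing G X) \<le> 3 \<and> 2 \<le> card X \<and> 2 \<le> card (verts G - X)"
proof -
  obtain S D1 D2 u v where S: "S \<subseteq> edges G" "card S < 4" "circuit (del_edges G S) D1" "circuit (del_edges G S) D2"
    "u \<in> edge_verts G D1" "v \<in> edge_verts G D2" "\<not> reach (del_edges G S) u v"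
    using n con unfolding cyc_edge_conn_def by blast
  let ?R = "{x. reach (del_edges G S) u x}"
  define X where "X = ?R \<inter> verts G"
  have fin: "finite (verts G)" "finite S" using wf S(1) finite_subset unfolding wf_graph_def by auto
  have "crossing (del_edges G S) ?R = {}" by (rule crossing_reach_empty)
  then have "crossing G X \<subseteq> S" unfolding X_def crossing_Int_verts[OF wf] crossing_del_edges by blast
  then have "card (crossing G X) \<le> card S" by (rule card_mono[OF fin(2)])
  then have c3: "card (crossing G X) \<le> 3" using S(2) by linarith
  have two: "\<exists>y. y \<noteq> x \<and> x \<in> verts G \<and> y \<in> verts G \<and> (reach (del_edges G S) u x \<longleftrightarrow> reach (del_edges G S) u y)"
    if x: "circuit (del_edges G S) D" "x \<in> edge_verts G D" for D x
  proof -
    obtain e where e: "e \<in> D" "incident G e x" using x(2) unfolding edge_verts_def by blast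
    have e2: "e \<in> edges (del_edges G S)" using e x(1) unfolding circuit_def by blast
    then have eE: "e \<in> edges G" and en: "ends (del_edges G S) e = ends G e" unfolding del_edges_def by auto
    have "reach (del_edges G S) u (fst (ends G e)) \<longleftrightarrow> reach (del_edges G S) u (snd (ends G e))"
      using reach_edge[OF e2] en by simp
    moreover have "fst (ends G e) \<in> verts G" "snd (ends G e) \<in> verts G" using wf eE unfolding wf_graph_def by auto
    ultimately show ?thesis using e(2) l[OF eE] unfolding incident_def by metis
  qed
  have card2: "2 \<le> card A" if "x \<in> A" "y \<in> A" "x \<noteq> y" "A \<subseteq> verts G" for A x y
  proof -
    have "card {x, y} \<le> card A" using that fin finite_subset by (intro card_mono) auto
    then show ?thesis using that by simp
  qed
  obtain y where y: "y \<noteq> u" "u \<in> verts G" "y \<in> verts G" "reach (del_edges G S) u y"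
    using two[OF S(3,5)] unfolding reach_def by blast
  have "u \<in> X" "y \<in> X" using y unfolding X_def reach_def by auto
  then have "2 \<le> card X" using card2[of u X y] y unfolding X_def by blast
  moreover obtain z where z: "z \<noteq> v" "v \<in> verts G" "z \<in> verts G" "\<not> reach (del_edges G S) u z"
    using two[OF S(4,6)] S(7) by blast
  moreover have "2 \<le> card (verts G - X)" using card2[of v "verts G - X" z] z S(7) unfolding X_def by blast
  moreover have "X \<subseteq> verts G" unfolding X_def by blast
  ultimately show ?thesis using c3 by blast
qed

lemma three_cutE:
  assumes G: "bridgeless_cubic G" and no2: "\<And>X. proper_cut G X \<Longrightarrow> card (crossing G X) \<noteq> 2"
    and n: "\<not> cyc_edge_conn 4 G"
  obtains X where "proper_cut G X" "card (crossing G X) = 3" "2 \<le> card X" "2 \<le> card (verts G - X)"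
proof -
  note f = bridgeless_cubicD[OF G]
  have con: "connected G" using G unfolding bridgeless_cubic_iff two_connected_def by simp
  have l: "fst (ends G e) \<noteq> snd (ends G e)" if "e \<in> edges G" for e
    using G that unfolding bridgeless_cubic_def by simp
  obtain X where X: "X \<subseteq> verts G" "card (crossing G X) \<le> 3" "2 \<le> card X" "2 \<le> card (verts G - X)"
    using not_cyc_edge_conn_cut[OF f(1) l con n] by blast
  have p: "proper_cut G X" using X(1,3,4) unfolding proper_cut_def by auto
  then have "2 \<le> card (crossing G X)" using f(6) unfolding proper_cut_def by blast
  then have "card (crossing G X) = 3" using no2[OF p] X(2) by linarith
  then show thesis using that p X by blast
qed

lemma three_cut_inj:
  assumes G: "bridgeless_cubic G" and no2: "\<And>X. proper_cut G X \<Longrightarrow> card (crossing G X) \<noteq> 2"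
    and X: "proper_cut G X" "card (crossing G X) = 3" "2 \<le> card X"
  shows "inj_on (inend G X) (crossing G X)"
proof (rule inend_inj[OF G _ X(3)])
  show "X \<subseteq> verts G" using X(1) unfolding proper_cut_def by simp
  fix Z assume Z: "proper_cut G Z"
  then have "2 \<le> card (crossing G Z)" using bridgeless_cubicD(6)[OF G] unfolding proper_cut_def by blast
  then show "card (crossing G X) \<le> card (crossing G Z)" using no2[OF Z] X(2) by linarith
qed

section \<open>Colourable graphs\<close>

lemma card_verts_split:
  assumes "bridgeless_cubic G" "X \<subseteq> verts G"
  shows "card (verts G) = card X + card (verts G - X)"
proof -
  have "finite X" using assms bridgeless_cubicD(2) finite_subset by blast
  then show ?thesis using assms bridgeless_cubicD(2)[OF assms(1)] card_mono[of "verts G" X]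
    by (simp add: card_Diff_subset)
qed

lemma proper_cut_card:
  assumes G: "bridgeless_cubic G" and X: "proper_cut G X"
  shows "card X < card (verts G)" "card (verts G - X) < card (verts G)"
  using X bridgeless_cubicD(2)[OF G] unfolding proper_cut_def by (auto intro!: psubset_card_mono)

definition colour_factors :: "graph multiset \<Rightarrow> bool" where
  "colour_factors D \<longleftrightarrow> (\<forall>H. H \<in># D \<longrightarrow> cyc_edge_conn 4 H \<and> three_edge_colourable H)"

lemma colour_factors_add: "colour_factors D1 \<Longrightarrow> colour_factors D2 \<Longrightarrow> colour_factors (D1 + D2)"
  unfolding colour_factors_def by auto

lemma tait_factorizes:
  assumes "bridgeless_cubic G" "tait G"
  shows "\<exists>D. factorizes G D \<and> colour_factors D"
  using assms
proof (induction "card (verts G)" arbitrary: G rule: less_induct)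
  case less
  note G = less.prems(1)
  note t = less.prems(2)
  note f = bridgeless_cubicD[OF G]
  have combine: ?case
    if s: "split_pair G X H1 \<psi>1 H2 \<psi>2" and t12: "tait H1" "tait H2"
      and c: "card (verts H1) < card (verts G)" "card (verts H2) < card (verts G)" for X H1 \<psi>1 H2 \<psi>2
  proof -
    have b: "bridgeless_cubic H1" "bridgeless_cubic H2"
      using s sideD(1) unfolding split_pair_def by blast+
    obtain D1 where D1: "factorizes H1 D1" "colour_factors D1" using less.hyps[OF c(1) b(1) t12(1)] by blast
    obtain D2 where D2: "factorizes H2 D2" "colour_factors D2" using less.hyps[OF c(2) b(2) t12(2)] by blast
    show ?thesis using factorizes_split[OF s D1(1) D2(1)] colour_factors_add[OF D1(2) D2(2)] by blast
  qed
  show ?case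
  proof (cases "\<exists>X. proper_cut G X \<and> card (crossing G X) = 2")
    case True
    then obtain X where X: "proper_cut G X" "card (crossing G X) = 2" by blast
    have XV: "X \<subseteq> verts G" using X(1) unfolding proper_cut_def by simp
    obtain H1 \<psi>1 H2 \<psi>2 where s: "split_pair G X H1 \<psi>1 H2 \<psi>2" "verts H1 = X" "verts H2 = verts G - X"
      "\<forall>f\<in>crossing G X. \<forall>f'\<in>crossing G X. \<psi>1 f = \<psi>1 f' \<and> \<psi>2 f = \<psi>2 f'"
      by (rule split_two_cut[OF G X])
    have s12: "side G X H1 \<psi>1" "side G (verts G - X) H2 \<psi>2" using s(1) unfolding split_pair_def by auto
    have cY: "card (crossing G (verts G - X)) = 2" using crossing_compl[OF f(1)] X(2) by simp
    have "tait H1" using tait_side_two_cut[OF G XV X(2) s12(1) s(2) t] .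
    moreover have "tait H2" using tait_side_two_cut[OF G _ cY s12(2) s(3) t] by blast
    ultimately show ?thesis using combine[OF s(1)] proper_cut_card[OF G X(1)] s(2,3) by simp
  next
    case False
    then have no2: "\<And>X. proper_cut G X \<Longrightarrow> card (crossing G X) \<noteq> 2" by blast
    show ?thesis
    proof (cases "cyc_edge_conn 4 G")
      case True
      then have "colour_factors {#G#}"
        using t three_edge_colourable_iff_tait[OF G] unfolding colour_factors_def by simp
      then show ?thesis using factorizes_refl by blast
    next
      case False
      obtain X where X: "proper_cut G X" "card (crossing G X) = 3" "2 \<le> card X" "2 \<le> card (verts G - X)"
        by (rule three_cutE[OF G no2 False])
      have XV: "X \<subseteq> verts G" using X(1) unfolding proper_cut_def by simp
      have cY: "crossing G (verts G - X) = crossing G X" using crossing_compl[OF f(1)] .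
      have cY3: "card (crossing G (verts G - X)) = 3" using cY X(2) by simp
      have inj: "inj_on (inend G X) (crossing G X)" using three_cut_inj[OF G no2 X(1,2,3)] .
      have injY: "inj_on (inend G (verts G - X)) (crossing G X)"
        using three_cut_inj[OF G no2 proper_cut_compl[OF X(1)] cY3 X(4)] cY by simp
      obtain H1 \<psi>1 H2 \<psi>2 w1 w2 where s: "split_pair G X H1 \<psi>1 H2 \<psi>2"
        "verts H1 = insert w1 X" "verts H2 = insert w2 (verts G - X)" "w1 \<notin> verts G" "w2 \<notin> verts G"
        "inj_on \<psi>1 (crossing G X)" "inj_on \<psi>2 (crossing G X)"
        by (rule split_three_cut[OF G X(1,2) inj injY])
      have s12: "side G X H1 \<psi>1" "side G (verts G - X) H2 \<psi>2" using s(1) unfolding split_pair_def by auto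
      have "tait H1" using tait_side_three_cut[OF G XV X(2) s12(1) s(6) t] .
      moreover have "tait H2" using tait_side_three_cut[OF G _ cY3 s12(2) _ t] s(7) cY by simp
      \<comment> \<open>One vertex is added to each side, so the sizes decrease because both sides
        have at least two vertices.\<close>
      moreover have "card (verts H1) \<le> Suc (card X)" "card (verts H2) \<le> Suc (card (verts G - X))"
        unfolding s(2,3) by (simp_all add: card_insert_le_m1 card_insert_if)
      then have "card (verts H1) < card (verts G)" "card (verts H2) < card (verts G)"
        using card_verts_split[OF G XV] X(3,4) by linarith+
      ultimately show ?thesis using combine[OF s(1)] by blast
    qed
  qed
qed

section \<open>Splitting a graph of defect three\<close>

definition core_edges :: "graph \<Rightarrow> (nat \<Rightarrow> nat set) \<Rightarrow> nat set" where
  "core_edges G k = {e\<in>edges G. card (k e) \<noteq> 1}"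

text \<open>One round of the reduction: \<open>K\<close> is the colourable completion that is split
  off, \<open>H\<close> the one that inherits the core. The last clause is quantified over
  factorizations, since both parts are decomposed further.\<close>

definition hex_reduces :: "graph \<Rightarrow> (nat \<Rightarrow> nat set) \<Rightarrow> bool" where
  "hex_reduces G k \<longleftrightarrow> (\<exists>H k1 K. hex_cover H k1 \<and> core_edges H k1 = core_edges G k \<and>
     bridgeless_cubic K \<and> tait K \<and> card (verts H) < card (verts G) \<and>
     (\<forall>D1 D2. factorizes H D1 \<longrightarrow> factorizes K D2 \<longrightarrow> factorizes G (D1 + D2)))"

text \<open>A non-colourable completion needs three uncovered edges, which is all there are. The
  other one has none, so by counting all its edges are covered once, including those that replace
  the cut. Hence all core edges lie inside \<open>X\<close>, where labels are unchanged, and the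
  cores are equal as sets of labels.\<close>

lemma hex_side:
  assumes h: "hex_cover G k" and X: "X \<subseteq> verts G"
    and s: "side G X H1 \<psi>1" "side G (verts G - X) H2 \<psi>2"
    and r: "restricts G X H1 \<psi>1 k k1" "restricts G (verts G - X) H2 \<psi>2 k k2"
    and sum: "card (covered H1 k1 0) + card (covered H2 k2 0) = 3" and nt: "\<not> tait H1"
  shows "hex_cover H1 k1" "tait H2" "core_edges H1 k1 = core_edges G k"
proof -
  note G = hex_coverD(1)[OF h]
  note wf = bridgeless_cubicD(1)[OF G]
  have cY: "crossing G (verts G - X) = crossing G X" using crossing_compl[OF wf] .
  have b: "bridgeless_cubic H1" "bridgeless_cubic H2" using sideD(1) s by blast+
  have k1: "cover3 H1 k1" "\<And>e. e \<in> edges (induced G X) \<Longrightarrow> k1 e = k e"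
    "\<And>f. f \<in> crossing G X \<Longrightarrow> k1 (\<psi>1 f) = k f"
    using r(1) unfolding restricts_def by simp_all
  have k2: "cover3 H2 k2" "\<And>e. e \<in> edges (induced G (verts G - X)) \<Longrightarrow> k2 e = k e"
    "\<And>f. f \<in> crossing G X \<Longrightarrow> k2 (\<psi>2 f) = k f"
    using r(2) unfolding restricts_def cY by simp_all
  have u1: "card (covered H1 k1 0) = 3" using not_tait_cover3(1)[OF b(1) k1(1) _ nt] sum by linarith
  then have u2: "card (covered H2 k2 0) = 0" using sum by simp
  show "hex_cover H1 k1" using u1 b nt k1(1) unfolding hex_cover_def by simp
  show "tait H2" using tait_if_all_covered[OF b(2) k2(1) u2] .
  have "card (covered H2 k2 2) = 0" "card (covered H2 k2 3) = 0"
    using cover3_count[OF b(2) k2(1)] u2 by simp_all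
  then have emp: "covered H2 k2 0 = {}" "covered H2 k2 2 = {}" "covered H2 k2 3 = {}"
    using u2 bridgeless_cubicD(3)[OF b(2)] unfolding covered_def by simp_all
  have one: "card (k2 e) = 1" if e: "e \<in> edges H2" for e
  proof -
    have "card (k2 e) \<noteq> 0" "card (k2 e) \<noteq> 2" "card (k2 e) \<noteq> 3" using emp e unfolding covered_def by auto
    then show ?thesis using cover3_subset(3)[OF b(2) k2(1) e] by presburger
  qed
  have oneY: "card (k e) = 1" if "e \<in> edges (induced G (verts G - X))" for e
    using one[of e] k2(2)[OF that] that sideD(8)[OF s(2)] by simp
  have oneC: "card (k e) = 1" if "e \<in> crossing G X" for e
    using one[of "\<psi>2 e"] k2(3)[OF that] that sideD(8)[OF s(2)] cY by simp
  have "core_edges H1 k1 = {e\<in>edges (induced G X). card (k e) \<noteq> 1}"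
    unfolding core_edges_def sideD(8)[OF s(1)] using k1(2,3) oneC by auto
  moreover have "core_edges G k = {e\<in>edges (induced G X). card (k e) \<noteq> 1}"
    unfolding core_edges_def using edges_induced(1)[OF wf X] oneC oneY by blast
  ultimately show "core_edges H1 k1 = core_edges G k" by simp
qed

lemma hex_split:
  assumes h: "hex_cover G k" and X: "X \<subseteq> verts G" and s: "split_pair G X H1 \<psi>1 H2 \<psi>2"
    and r: "restricts G X H1 \<psi>1 k k1" "restricts G (verts G - X) H2 \<psi>2 k k2"
    and sum: "card (covered H1 k1 0) + card (covered H2 k2 0) = 3"
    and merge: "tait H1 \<Longrightarrow> tait H2 \<Longrightarrow> tait G"
    and c: "card (verts H1) < card (verts G)" "card (verts H2) < card (verts G)"
  shows "hex_reduces G k"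
proof -
  have s12: "side G X H1 \<psi>1" "side G (verts G - X) H2 \<psi>2" using s unfolding split_pair_def by auto
  have b: "bridgeless_cubic H1" "bridgeless_cubic H2" using sideD(1) s12 by blast+
  have fac: "factorizes G (D1 + D2)" if "factorizes H1 D1" "factorizes H2 D2" for D1 D2
    using factorizes_split[OF s that] .
  have "\<not> tait H1 \<or> \<not> tait H2" using merge hex_coverD(2)[OF h] by blast
  then show ?thesis
  proof
    assume "\<not> tait H1"
    note q = hex_side[OF h X s12 r sum this]
    show ?thesis unfolding hex_reduces_def
      by (rule exI[of _ H1], rule exI[of _ k1], rule exI[of _ H2]) (use q b c fac in blast)
  next
    assume nt: "\<not> tait H2"
    have q: "hex_cover H2 k2" "tait H1" "core_edges H2 k2 = core_edges G k"
      using hex_side[OF h Diff_subset s12(2) _ r(2) _ _ nt, of H1 \<psi>1 k1] s12(1) r(1) sum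
      unfolding double_compl[OF X] by (simp_all add: add.commute)
    have fac': "factorizes G (D1 + D2)" if "factorizes H2 D1" "factorizes H1 D2" for D1 D2
      using fac[OF that(2,1)] by (simp add: add.commute)
    show ?thesis unfolding hex_reduces_def
      by (rule exI[of _ H2], rule exI[of _ k2], rule exI[of _ H1]) (use q b c fac' in blast)
  qed
qed

lemma hex_two_cut:
  assumes h: "hex_cover G k" and X: "proper_cut G X" "card (crossing G X) = 2"
  shows "hex_reduces G k"
proof -
  note G = hex_coverD(1)[OF h]
  note k = hex_coverD(3)[OF h]
  note f = bridgeless_cubicD[OF G]
  have XV: "X \<subseteq> verts G" using X(1) unfolding proper_cut_def by simp
  obtain H1 \<psi>1 H2 \<psi>2 where s: "split_pair G X H1 \<psi>1 H2 \<psi>2" "verts H1 = X" "verts H2 = verts G - X"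
    "\<forall>f\<in>crossing G X. \<forall>f'\<in>crossing G X. \<psi>1 f = \<psi>1 f' \<and> \<psi>2 f = \<psi>2 f'"
    by (rule split_two_cut[OF G X])
  have s12: "side G X H1 \<psi>1" "side G (verts G - X) H2 \<psi>2" using s(1) unfolding split_pair_def by auto
  have cY: "crossing G (verts G - X) = crossing G X" using crossing_compl[OF f(1)] .
  have cY2: "card (crossing G (verts G - X)) = 2" using cY X(2) by simp
  have c0: "crossing G X \<noteq> {}" using X(2) by force
  obtain k1 where k1: "restricts G X H1 \<psi>1 k k1" using restricts_two_cut[OF G k XV X(2) s12(1) s(2)] by blast
  obtain k2 where k2: "restricts G (verts G - X) H2 \<psi>2 k k2"
    using restricts_two_cut[OF G k _ cY2 s12(2) s(3)] by blast
  let ?Z = "{f\<in>crossing G X. card (k f) = 0}"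
  \<comment> \<open>The two cut edges are uncovered together or not at all. If they are, the pair
    becomes one edge in each completion, so the total number of uncovered edges is
    preserved.\<close>
  have "card (\<psi>1 ` ?Z) + card (\<psi>2 ` ?Z) = card ?Z"
  proof (cases "?Z = {}")
    case True
    show ?thesis unfolding True by simp
  next
    case False
    then obtain f0 where f0: "f0 \<in> crossing G X" "card (k f0) = 0" by blast
    have "?Z = crossing G X" using two_cut_cover_eq[OF G k XV X(2) _ f0(1)] f0(2) by auto
    moreover have "\<psi>1 ` crossing G X = {\<psi>1 f0}" "\<psi>2 ` crossing G X = {\<psi>2 f0}" using s(4) f0(1) by blast+
    ultimately show ?thesis using X(2) by simp
  qed
  then have "card (covered H1 k1 0) + card (covered H2 k2 0) = 3"
    using k1 k2 card_covered_split[OF G XV, of k 0] hex_coverD(4)[OF h] unfolding restricts_def cY by simp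
  moreover have "tait G" if "tait H1" "tait H2"
    by (rule tait_merge_two_cut[OF G XV c0 s12 _ that]) (use s(4) in blast)
  ultimately show ?thesis using hex_split[OF h XV s(1) k1 k2] proper_cut_card[OF G X(1)] s(2,3) by simp
qed

text \<open>Count pairs of a cut edge and a matching containing it. Every matching meets the cut an
  odd number of times, so a total of three leaves exactly one for each matching, and the cut edges
  carry a partition of the colours.\<close>

lemma three_cut_partition:
  assumes G: "bridgeless_cubic G" and k: "cover3 G k" and X: "X \<subseteq> verts G" and c: "card (crossing G X) = 3"
  shows "(\<Sum>f\<in>crossing G X. card (k f)) = (\<Sum>i\<in>colours. card {f\<in>crossing G X. i \<in> k f})"
    "\<And>i. i \<in> colours \<Longrightarrow> odd (card {f\<in>crossing G X. i \<in> k f})"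
    "(\<Sum>f\<in>crossing G X. card (k f)) = 3 \<Longrightarrow> (\<Union>f\<in>crossing G X. k f) = colours"
    "\<And>f f'. (\<Sum>f\<in>crossing G X. card (k f)) = 3 \<Longrightarrow> f \<in> crossing G X \<Longrightarrow> f' \<in> crossing G X \<Longrightarrow>
       f \<noteq> f' \<Longrightarrow> k f \<inter> k f' = {}"
proof -
  note f = bridgeless_cubicD[OF G]
  have sub: "k f \<subseteq> colours" if "f \<in> crossing G X" for f
    using cover3_subset(1)[OF G k, of f] crossing_subset that by blast
  have "(\<Sum>f\<in>crossing G X. card (k f)) = (\<Sum>f\<in>crossing G X. \<Sum>i\<in>{i\<in>colours. i \<in> k f}. 1)"
  proof (rule sum.cong[OF refl])
    fix f assume "f \<in> crossing G X"
    then have "{i\<in>colours. i \<in> k f} = k f" using sub by blast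
    then show "card (k f) = (\<Sum>i\<in>{i\<in>colours. i \<in> k f}. 1)" by simp
  qed
  also have "\<dots> = (\<Sum>i\<in>colours. \<Sum>f\<in>{f\<in>crossing G X. i \<in> k f}. 1)"
    using f(7) by (intro sum.swap_restrict) simp_all
  finally show sum: "(\<Sum>f\<in>crossing G X. card (k f)) = (\<Sum>i\<in>colours. card {f\<in>crossing G X. i \<in> k f})" by simp
  show odd: "\<And>i. i \<in> colours \<Longrightarrow> odd (card {f\<in>crossing G X. i \<in> k f})"
    using cover3_parity[OF G k X] c by simp
  have one: "card {f\<in>crossing G X. i \<in> k f} = 1" if s3: "(\<Sum>f\<in>crossing G X. card (k f)) = 3" and i: "i \<in> colours" for i
  proof -
    have pos: "1 \<le> card {f\<in>crossing G X. j \<in> k f}" if "j \<in> colours" for j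
      using odd[OF that] by (metis One_nat_def Suc_leI neq0_conv even_zero)
    have "(\<Sum>j\<in>colours - {i}. 1) \<le> (\<Sum>j\<in>colours - {i}. card {f\<in>crossing G X. j \<in> k f})"
      using pos by (intro sum_mono) simp
    moreover have "(\<Sum>j\<in>colours - {i}. (1::nat)) = 2" using i by simp
    moreover have "(\<Sum>j\<in>colours. card {f\<in>crossing G X. j \<in> k f}) =
      card {f\<in>crossing G X. i \<in> k f} + (\<Sum>j\<in>colours - {i}. card {f\<in>crossing G X. j \<in> k f})"
      using i by (intro sum.remove) simp_all
    ultimately show ?thesis using pos[OF i] s3 sum by linarith
  qed
  show "(\<Union>f\<in>crossing G X. k f) = colours" if s3: "(\<Sum>f\<in>crossing G X. card (k f)) = 3"
  proof
    show "(\<Union>f\<in>crossing G X. k f) \<subseteq> colours" using sub by blast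
    show "colours \<subseteq> (\<Union>f\<in>crossing G X. k f)"
    proof
      fix i assume "i \<in> colours"
      then have "{f\<in>crossing G X. i \<in> k f} \<noteq> {}" using one[OF s3] by (metis card.empty zero_neq_one)
      then show "i \<in> (\<Union>f\<in>crossing G X. k f)" by blast
    qed
  qed
  show "k g \<inter> k g' = {}" if s3: "(\<Sum>f\<in>crossing G X. card (k f)) = 3"
    and g: "g \<in> crossing G X" "g' \<in> crossing G X" "g \<noteq> g'" for g g'
  proof (rule ccontr)
    assume "k g \<inter> k g' \<noteq> {}"
    then obtain i where i: "i \<in> k g" "i \<in> k g'" by blast
    then have "card {f\<in>crossing G X. i \<in> k f} = 1" using one[OF s3] sub g by blast
    then obtain x where "{f\<in>crossing G X. i \<in> k f} = {x}" by (meson card_1_singletonE)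
    then have "g = x" "g' = x" using i g by blast+
    then show False using g(3) by simp
  qed
qed

lemma hex_simple_three_cut:
  assumes h: "hex_cover G k" and X: "proper_cut G X" "card (crossing G X) = 3" "2 \<le> card X" "2 \<le> card (verts G - X)"
    and no2: "\<And>X. proper_cut G X \<Longrightarrow> card (crossing G X) \<noteq> 2"
    and simple: "\<And>f. f \<in> crossing G X \<Longrightarrow> card (k f) = 1"
  shows "hex_reduces G k"
proof -
  note G = hex_coverD(1)[OF h]
  note k = hex_coverD(3)[OF h]
  note f = bridgeless_cubicD[OF G]
  have XV: "X \<subseteq> verts G" using X(1) unfolding proper_cut_def by simp
  have cY: "crossing G (verts G - X) = crossing G X" using crossing_compl[OF f(1)] .
  have cY3: "card (crossing G (verts G - X)) = 3" using cY X(2) by simp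
  have inj: "inj_on (inend G X) (crossing G X)" using three_cut_inj[OF G no2 X(1,2,3)] .
  have injY: "inj_on (inend G (verts G - X)) (crossing G X)"
    using three_cut_inj[OF G no2 proper_cut_compl[OF X(1)] cY3 X(4)] cY by simp
  obtain H1 \<psi>1 H2 \<psi>2 w1 w2 where s: "split_pair G X H1 \<psi>1 H2 \<psi>2"
    "verts H1 = insert w1 X" "verts H2 = insert w2 (verts G - X)" "w1 \<notin> verts G" "w2 \<notin> verts G"
    "inj_on \<psi>1 (crossing G X)" "inj_on \<psi>2 (crossing G X)"
    by (rule split_three_cut[OF G X(1,2) inj injY])
  have s12: "side G X H1 \<psi>1" "side G (verts G - X) H2 \<psi>2" using s(1) unfolding split_pair_def by auto
  have s3: "(\<Sum>f\<in>crossing G X. card (k f)) = 3" using simple X(2) by simp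
  note p = three_cut_partition(3,4)[OF G k XV X(2) s3]
  obtain k1 where k1: "restricts G X H1 \<psi>1 k k1"
    using restricts_three_cut[OF G k XV s12(1) s(6) p] by blast
  obtain k2 where k2: "restricts G (verts G - X) H2 \<psi>2 k k2"
    using restricts_three_cut[OF G k Diff_subset s12(2)] s(7) p unfolding cY by blast
  have z: "{f\<in>crossing G X. card (k f) = 0} = {}" using simple by auto
  have "card (covered H1 k1 0) = card {e\<in>edges (induced G X). card (k e) = 0}"
    "card (covered H2 k2 0) = card {e\<in>edges (induced G (verts G - X)). card (k e) = 0}"
    using k1 k2 unfolding restricts_def cY by (simp_all only: z image_empty card.empty add_0_right)
  then have "card (covered H1 k1 0) + card (covered H2 k2 0) = 3"
    using card_covered_split[OF G XV, of k 0] hex_coverD(4)[OF h] unfolding z by simp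
  moreover have "w1 \<in> verts H1 - X" "w2 \<in> verts H2 - (verts G - X)" using s(2-5) XV by auto
  then have "tait G" if "tait H1" "tait H2"
    using tait_merge_three_cut[OF G XV X(2) s12 _ _ that] by blast
  moreover have "card (verts H1) \<le> Suc (card X)" "card (verts H2) \<le> Suc (card (verts G - X))"
    unfolding s(2,3) by (simp_all add: card_insert_le_m1 card_insert_if)
  then have "card (verts H1) < card (verts G)" "card (verts H2) < card (verts G)"
    using card_verts_split[OF G XV] X(3,4) by linarith+
  ultimately show ?thesis using hex_split[OF h XV s(1) k1 k2] by blast
qed

section \<open>Three-edge cuts meeting the core\<close>

text \<open>A doubly covered edge has an uncovered neighbour at each end. Distinct cut edges have
  distinct ends in \<open>X\<close>, so the neighbour at the inner end is not in the cut.\<close>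

lemma inner_uncovered:
  assumes G: "bridgeless_cubic G" and k: "cover3 G k" and inj: "inj_on (inend G X) (crossing G X)"
    and f: "f \<in> crossing G X" "card (k f) = 2"
  obtains e where "e \<in> edges (induced G X)" "e \<in> star G (inend G X f)" "card (k e) = 0"
proof -
  define v where "v = inend G X f"
  have v: "v \<in> X" "f \<in> star G v" using inend_crossing(1,2)[OF G f(1)] unfolding v_def by auto
  obtain e where e: "e \<in> star G v" "card (k e) = 0"
    using cover3_partner[OF G k v(2)] f(2) by (metis order_refl)
  have "e \<notin> crossing G X"
  proof
    assume c: "e \<in> crossing G X"
    then have "inend G X e = inend G X f" using inend_crossing(2)[OF G c v(1)] e(1) unfolding v_def by simp
    then have "e = f" using inj_onD[OF inj] c f(1) by simp
    then show False using e f by simp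
  qed
  then have "e \<in> edges (induced G X)" using star_split[OF v(1) e(1)] by simp
  then show thesis using that e unfolding v_def by blast
qed

lemma finite_inner_edges: "bridgeless_cubic G \<Longrightarrow> finite {e\<in>edges (induced G X). P e}"
  by (rule finite_subset[OF _ bridgeless_cubicD(3)[of G]]) (use edges_induced_subset[of G X] in auto)

definition no_two_cut :: "graph \<Rightarrow> bool" where
  "no_two_cut G \<longleftrightarrow> (\<forall>X. proper_cut G X \<longrightarrow> card (crossing G X) \<noteq> 2)"

text \<open>The counts add up to three, so the triple restricts to both sides and \<open>f0\<close>
  becomes an uncovered edge of both completions. The doubly covered \<open>f2\<close> has an
  uncovered neighbour inside each side, which uses up the two others. With only two uncovered edges
  each completion is colourable, and the colourings glue.\<close>

lemma not_type_210:
  assumes h: "hex_cover G k" and X: "proper_cut G X" "card (crossing G X) = 3" "2 \<le> card X" "2 \<le> card (verts G - X)"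
    and no2: "no_two_cut G"
    and c: "crossing G X = {f0, f1, f2}" "card (k f0) = 0" "card (k f1) = 1" "card (k f2) = 2"
  shows False
proof -
  note G = hex_coverD(1)[OF h]
  note k = hex_coverD(3)[OF h]
  note f = bridgeless_cubicD[OF G]
  have n2: "\<And>X. proper_cut G X \<Longrightarrow> card (crossing G X) \<noteq> 2" using no2 unfolding no_two_cut_def by blast
  have XV: "X \<subseteq> verts G" using X(1) unfolding proper_cut_def by simp
  have cY: "crossing G (verts G - X) = crossing G X" using crossing_compl[OF f(1)] .
  have cY3: "card (crossing G (verts G - X)) = 3" using cY X(2) by simp
  have inj: "inj_on (inend G X) (crossing G X)" using three_cut_inj[OF G n2 X(1,2,3)] .
  have injY: "inj_on (inend G (verts G - X)) (crossing G X)"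
    using three_cut_inj[OF G n2 proper_cut_compl[OF X(1)] cY3 X(4)] cY by simp
  obtain H1 \<psi>1 H2 \<psi>2 w1 w2 where s: "split_pair G X H1 \<psi>1 H2 \<psi>2"
    "verts H1 = insert w1 X" "verts H2 = insert w2 (verts G - X)" "w1 \<notin> verts G" "w2 \<notin> verts G"
    "inj_on \<psi>1 (crossing G X)" "inj_on \<psi>2 (crossing G X)"
    by (rule split_three_cut[OF G X(1,2) inj injY])
  have s12: "side G X H1 \<psi>1" "side G (verts G - X) H2 \<psi>2" using s(1) unfolding split_pair_def by auto
  have d: "f0 \<noteq> f1" "f0 \<noteq> f2" "f1 \<noteq> f2" using c by auto
  have s3: "(\<Sum>f\<in>crossing G X. card (k f)) = 3" using c d by simp
  note p = three_cut_partition(3,4)[OF G k XV X(2) s3]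
  obtain k1 where k1: "restricts G X H1 \<psi>1 k k1"
    using restricts_three_cut[OF G k XV s12(1) s(6) p] by blast
  obtain k2 where k2: "restricts G (verts G - X) H2 \<psi>2 k k2"
    using restricts_three_cut[OF G k Diff_subset s12(2)] s(7) p unfolding cY by blast
  have z: "{f\<in>crossing G X. card (k f) = 0} = {f0}" using c by auto
  let ?a = "card {e\<in>edges (induced G X). card (k e) = 0}"
  let ?b = "card {e\<in>edges (induced G (verts G - X)). card (k e) = 0}"
  have sum: "?a + ?b = 2"
    using card_covered_split[OF G XV, of k 0] hex_coverD(4)[OF h] unfolding z by simp
  have u1: "card (covered H1 k1 0) = ?a + card (\<psi>1 ` {f\<in>crossing G X. card (k f) = 0})"
    using k1 unfolding restricts_def by blast
  have u2: "card (covered H2 k2 0) = ?b + card (\<psi>2 ` {f\<in>crossing G X. card (k f) = 0})"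
    using k2 unfolding restricts_def cY by blast
  have f2: "f2 \<in> crossing G X" "f2 \<in> crossing G (verts G - X)" using c cY by auto
  have nz: "card A \<noteq> 0" if "x \<in> A" "finite A" for x and A :: "nat set" using that by auto
  obtain e where "e \<in> {e\<in>edges (induced G X). card (k e) = 0}"
    using inner_uncovered[OF G k inj f2(1) c(4)] by blast
  then have "?a \<noteq> 0" by (rule nz) (rule finite_inner_edges[OF G])
  moreover obtain e' where "e' \<in> {e\<in>edges (induced G (verts G - X)). card (k e) = 0}"
    using inner_uncovered[OF G k _ f2(2) c(4)] injY cY by auto
  then have "?b \<noteq> 0" by (rule nz) (rule finite_inner_edges[OF G])
  ultimately have "card (covered H1 k1 0) = 2" "card (covered H2 k2 0) = 2"
    using sum u1 u2 unfolding z by simp_all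
  moreover have "cover3 H1 k1" "cover3 H2 k2" using k1 k2 unfolding restricts_def by simp_all
  ultimately have "tait H1" "tait H2"
    using not_tait_cover3(1)[OF sideD(1)[OF s12(1)]] not_tait_cover3(1)[OF sideD(1)[OF s12(2)]] by fastforce+
  moreover have "w1 \<in> verts H1 - X" "w2 \<in> verts H2 - (verts G - X)" using s(2-5) XV by auto
  ultimately have "tait G" using tait_merge_three_cut[OF G XV X(2) s12] by blast
  then show False using hex_coverD(2)[OF h] by simp
qed

text \<open>A bad triangle is the shape of the side with only one uncovered edge of a 3-cut that the three
  matchings cover 2, 2 and 1 times.\<close>

definition bad_triangle :: "graph \<Rightarrow> (nat \<Rightarrow> nat set) \<Rightarrow> nat \<Rightarrow> nat \<Rightarrow> nat \<Rightarrow>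
    nat \<Rightarrow> nat \<Rightarrow> nat \<Rightarrow> nat \<Rightarrow> nat \<Rightarrow> nat \<Rightarrow> bool" where
  "bad_triangle G k p q r g d1 d2 f1 f2 f3 \<longleftrightarrow> {p, q, r} \<subseteq> verts G \<and> distinct [p, q, r] \<and>
     distinct [g, d1, d2, f1, f2, f3] \<and>
     star G p = {f1, g, d1} \<and> star G q = {f2, g, d2} \<and> star G r = {f3, d1, d2} \<and>
     card (k g) = 0 \<and> card (k d1) = 1 \<and> card (k d2) = 1 \<and>
     card (k f1) = 2 \<and> card (k f2) = 2 \<and> card (k f3) = 1"

text \<open>Both doubly covered cut edges have an uncovered neighbour inside \<open>X\<close>, where
  only one uncovered edge exists, so this edge joins their ends \<open>p\<close> and
  \<open>q\<close>. Removing \<open>p\<close> and \<open>q\<close> from \<open>X\<close> leaves a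
  simply covered 3-cut, which would reduce the graph unless it is the star of a vertex.\<close>

lemma type_221_side:
  assumes h: "hex_cover G k" and X: "proper_cut G X" "card (crossing G X) = 3" "2 \<le> card X" "2 \<le> card (verts G - X)"
    and no2: "no_two_cut G"
    and c: "crossing G X = {f1, f2, f3}" "distinct [f1, f2, f3]" "card (k f1) = 2" "card (k f2) = 2" "card (k f3) = 1"
    and a: "card {e\<in>edges (induced G X). card (k e) = 0} \<le> 1"
    and nr: "\<not> hex_reduces G k"
  shows "\<exists>p q r g d1 d2. X = {p, q, r} \<and> bad_triangle G k p q r g d1 d2 f1 f2 f3"
proof -
  note G = hex_coverD(1)[OF h]
  note k = hex_coverD(3)[OF h]
  note f = bridgeless_cubicD[OF G]
  have n2: "\<And>X. proper_cut G X \<Longrightarrow> card (crossing G X) \<noteq> 2" using no2 unfolding no_two_cut_def by blast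
  have XV: "X \<subseteq> verts G" "X \<noteq> verts G" using X(1) unfolding proper_cut_def by auto
  have inj: "inj_on (inend G X) (crossing G X)" using three_cut_inj[OF G n2 X(1,2,3)] .
  have fX: "f1 \<in> crossing G X" "f2 \<in> crossing G X" "f3 \<in> crossing G X" using c by auto
  have fd: "f1 \<noteq> f2" "f1 \<noteq> f3" "f2 \<noteq> f3" using c(2) by auto
  define p where "p = inend G X f1"
  define q where "q = inend G X f2"
  have pX: "p \<in> X" "q \<in> X" using inend_crossing(1)[OF G] fX unfolding p_def q_def by auto
  have pq: "p \<noteq> q" using inj_onD[OF inj, of f1 f2] fX fd unfolding p_def q_def by auto
  have onlyp: "x = f1" if "x \<in> star G p" "x \<in> crossing G X" for x
    using inend_crossing(2)[OF G that(2) pX(1)] that inj_onD[OF inj, of x f1] fX unfolding p_def by auto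
  have onlyq: "x = f2" if "x \<in> star G q" "x \<in> crossing G X" for x
    using inend_crossing(2)[OF G that(2) pX(2)] that inj_onD[OF inj, of x f2] fX unfolding q_def by auto
  have f1p: "f1 \<in> star G p" using inend_crossing(2)[OF G fX(1) pX(1)] unfolding p_def by simp
  have f2q: "f2 \<in> star G q" using inend_crossing(2)[OF G fX(2) pX(2)] unfolding q_def by simp
  obtain g where g: "g \<in> edges (induced G X)" "g \<in> star G p" "card (k g) = 0"
    using inner_uncovered[OF G k inj fX(1) c(3)] unfolding p_def by blast
  obtain g' where g': "g' \<in> edges (induced G X)" "g' \<in> star G q" "card (k g') = 0"
    using inner_uncovered[OF G k inj fX(2) c(4)] unfolding q_def by blast
  have "g = g'"
  proof (rule ccontr)
    assume "g \<noteq> g'"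
    moreover have "card {g, g'} \<le> card {e\<in>edges (induced G X). card (k e) = 0}"
      using g g' finite_inner_edges[OF G] by (intro card_mono) auto
    ultimately show False using a by simp
  qed
  then have gq: "g \<in> star G q" using g' by simp
  have gX: "g \<notin> crossing G X" using g(1) edges_induced(3)[OF f(1) XV(1)] by blast
  have "card (star G p) = 3" "card (star G q) = 3" using f(5) pX XV(1) by auto
  then obtain d1 d2 where d: "star G p = {f1, g, d1}" "f1 \<noteq> d1" "g \<noteq> d1" "star G q = {f2, g, d2}" "f2 \<noteq> d2" "g \<noteq> d2"
    using card_three_cases2[of "star G p" f1 g] card_three_cases2[of "star G q" f2 g] f1p f2q g(2) gq gX fX by metis
  have gf: "g \<noteq> f1" "g \<noteq> f2" "g \<noteq> f3" using gX fX by auto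
  have dX: "d1 \<notin> crossing G X" "d2 \<notin> crossing G X" using onlyp[of d1] onlyq[of d2] d by auto
  have pqV: "p \<in> verts G" "q \<in> verts G" using pX XV(1) by auto
  have cd: "card (k d1) = 1" "card (k d2) = 1"
    using cover3_sum[OF G k pqV(1)] cover3_sum[OF G k pqV(2)] d gf c(3,4) g(3) by simp_all
  have "{p, q} = ({p} - {q}) \<union> ({q} - {p})" using pq by auto
  then have cpq0: "crossing G {p, q} = (star G p - star G q) \<union> (star G q - star G p)"
    using crossing_sym_diff by metis
  have f12: "f1 \<notin> star G q" "f2 \<notin> star G p" using onlyp[of f2] onlyq[of f1] fX fd by auto
  \<comment> \<open>A common third edge at \<open>p\<close> and \<open>q\<close> would leave only
    \<open>f1\<close> and \<open>f2\<close> around \<open>{p, q}\<close>, a 2-cut.\<close>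
  have dne: "d1 \<noteq> d2"
  proof
    assume e: "d1 = d2"
    have "crossing G {p, q} = {f1, f2}" unfolding cpq0 d(1,4) using e f12 d by auto
    then have "card (crossing G {p, q}) = 2" using fd by simp
    moreover have "proper_cut G {p, q}" using pX XV X(4) unfolding proper_cut_def by auto
    ultimately show False using n2 by blast
  qed
  have nd: "d1 \<noteq> f2" "d2 \<noteq> f1" "d1 \<noteq> f3" "d2 \<noteq> f3" using dX fX by auto
  have cpq: "crossing G {p, q} = {f1, f2, d1, d2}"
    unfolding cpq0 d(1,4) using dne nd fd gf d by auto
  define X' where "X' = X - {p, q}"
  have "X' = (X - {p, q}) \<union> ({p, q} - X)" using pX unfolding X'_def by auto
  then have "crossing G X' = (crossing G X - crossing G {p, q}) \<union> (crossing G {p, q} - crossing G X)"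
    using crossing_sym_diff by metis
  then have cX': "crossing G X' = {f3, d1, d2}" unfolding cpq c(1) using fd nd d dX c(1) by auto
  \<comment> \<open>By parity \<open>X\<close> has an odd number of vertices, so removing two of
    them cannot empty it.\<close>
  have "odd (card X)" using even_card_crossing_iff[OF G XV(1)] X(2) by simp
  moreover have finX: "finite X" using XV(1) f(2) finite_subset by blast
  moreover have "card X' = card X - 2" using finX pX pq unfolding X'_def by (simp add: card_Diff_subset)
  ultimately have "odd (card X')" using X(3) by simp
  then have X'0: "X' \<noteq> {}" by auto
  have X'p: "proper_cut G X'" using X'0 XV pX unfolding proper_cut_def X'_def by auto
  have c3: "card (crossing G X') = 3" unfolding cX' using nd dne by simp
  have simple: "card (k x) = 1" if "x \<in> crossing G X'" for x using that cd c(5) unfolding cX' by auto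
  have "\<not> 2 \<le> card X'"
  proof
    assume c2: "2 \<le> card X'"
    have "{p, q} \<subseteq> verts G - X'" using pqV unfolding X'_def by blast
    then have "card {p, q} \<le> card (verts G - X')" using f(2) by (intro card_mono) auto
    then have "2 \<le> card (verts G - X')" using pq by simp
    then show False using hex_simple_three_cut[OF h X'p c3 c2 _ n2 simple] nr by blast
  qed
  then have "card X' = 1" using \<open>odd (card X')\<close> by presburger
  then obtain r where r: "X' = {r}" by (meson card_1_singletonE)
  have rX: "r \<in> X" "r \<noteq> p" "r \<noteq> q" using r unfolding X'_def by auto
  have "X = {p, q, r}" using r pX unfolding X'_def by auto
  moreover have "bad_triangle G k p q r g d1 d2 f1 f2 f3"
  proof -
    have dist: "distinct [g, d1, d2, f1, f2, f3]" using d(2,3,5,6) nd dne gf fd by auto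
    have sub: "{p, q, r} \<subseteq> verts G" "distinct [p, q, r]" using pq rX pqV XV(1) by auto
    have rs: "star G r = {f3, d1, d2}" using cX' r by simp
    show ?thesis unfolding bad_triangle_def by (intro conjI dist sub rs d(1,4) cd c(3-5) g(3))
  qed
  ultimately show ?thesis by blast
qed

text \<open>The counts on the cut are at most two and, since every matching meets the cut an odd
  number of times, have an odd sum of at least three: up to order they are 1, 1, 1 or 2, 1, 0 or 2,
  2, 1. In the last case no cut edge is uncovered, so one side contains at most one of the three
  uncovered edges.\<close>

lemma three_cut_bad_triangle:
  assumes h: "hex_cover G k" and X: "proper_cut G X" "card (crossing G X) = 3" "2 \<le> card X" "2 \<le> card (verts G - X)"
    and no2: "no_two_cut G" and nr: "\<not> hex_reduces G k"
  shows "\<exists>p q r g d1 d2 f1 f2 f3. (X = {p, q, r} \<or> verts G - X = {p, q, r}) \<and>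
    bad_triangle G k p q r g d1 d2 f1 f2 f3"
proof -
  note G = hex_coverD(1)[OF h]
  note k = hex_coverD(3)[OF h]
  note f = bridgeless_cubicD[OF G]
  have n2: "\<And>X. proper_cut G X \<Longrightarrow> card (crossing G X) \<noteq> 2" using no2 unfolding no_two_cut_def by blast
  have XV: "X \<subseteq> verts G" using X(1) unfolding proper_cut_def by auto
  have cY: "crossing G (verts G - X) = crossing G X" using crossing_compl[OF f(1)] .
  obtain x y z where c: "crossing G X = {x, y, z}" "x \<noteq> y" "x \<noteq> z" "y \<noteq> z"
    using X(2) unfolding card_3_iff by blast
  have E: "x \<in> edges G" "y \<in> edges G" "z \<in> edges G" using crossing_subset[of G X] c by auto
  have le: "card (k x) \<le> 2" "card (k y) \<le> 2" "card (k z) \<le> 2" using hex_coverD(6)[OF h] E by auto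
  have s: "card (k x) + card (k y) + card (k z) = (\<Sum>i\<in>colours. card {f\<in>crossing G X. i \<in> k f})"
    using three_cut_partition(1)[OF G k XV X(2)] c by simp
  note odd = three_cut_partition(2)[OF G k XV X(2)]
  have "odd (\<Sum>i\<in>colours. card {f\<in>crossing G X. i \<in> k f})"
    using odd unfolding colours_def by simp
  moreover have "(\<Sum>i\<in>colours. 1) \<le> (\<Sum>i\<in>colours. card {f\<in>crossing G X. i \<in> k f})"
    using odd by (intro sum_mono) (metis One_nat_def Suc_leI neq0_conv even_zero)
  then have "3 \<le> (\<Sum>i\<in>colours. card {f\<in>crossing G X. i \<in> k f})" by simp
  ultimately have s': "odd (card (k x) + card (k y) + card (k z))" "3 \<le> card (k x) + card (k y) + card (k z)"
    using s by simp_all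
  have cases3: "(A = 1 \<and> B = 1 \<and> C = 1) \<or> (A = 0 \<and> B = 1 \<and> C = 2) \<or> (A = 0 \<and> C = 1 \<and> B = 2)
     \<or> (B = 0 \<and> A = 1 \<and> C = 2) \<or> (B = 0 \<and> C = 1 \<and> A = 2) \<or> (C = 0 \<and> A = 1 \<and> B = 2) \<or> (C = 0 \<and> B = 1 \<and> A = 2)
     \<or> (A = 2 \<and> B = 2 \<and> C = 1) \<or> (A = 2 \<and> C = 2 \<and> B = 1) \<or> (B = 2 \<and> C = 2 \<and> A = 1)"
    if "A \<le> 2" "B \<le> 2" "C \<le> 2" "odd (A + B + C)" "3 \<le> A + B + C" for A B C :: nat
    using that by presburger
  have perm: "crossing G X = {x, z, y}" "crossing G X = {y, x, z}" "crossing G X = {y, z, x}"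
    "crossing G X = {z, x, y}" "crossing G X = {z, y, x}" using c(1) by auto
  note no210 = not_type_210[OF h X no2]
  have "\<not> (card (k x) = 1 \<and> card (k y) = 1 \<and> card (k z) = 1)"
  proof
    assume "card (k x) = 1 \<and> card (k y) = 1 \<and> card (k z) = 1"
    then have "card (k f) = 1" if "f \<in> crossing G X" for f using that c(1) by auto
    then show False using hex_simple_three_cut[OF h X n2] nr by blast
  qed
  then have "(card (k x) = 2 \<and> card (k y) = 2 \<and> card (k z) = 1) \<or>
     (card (k x) = 2 \<and> card (k z) = 2 \<and> card (k y) = 1) \<or> (card (k y) = 2 \<and> card (k z) = 2 \<and> card (k x) = 1)"
    using cases3[OF le s'] no210[OF c(1)] no210[OF perm(1)] no210[OF perm(2)] no210[OF perm(3)]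
      no210[OF perm(4)] no210[OF perm(5)] by blast
  then obtain f1 f2 f3 where F: "crossing G X = {f1, f2, f3}" "distinct [f1, f2, f3]"
    "card (k f1) = 2" "card (k f2) = 2" "card (k f3) = 1"
  proof (elim disjE conjE)
    assume "card (k x) = 2" "card (k y) = 2" "card (k z) = 1"
    then show thesis using that[OF c(1)] c by simp
  next
    assume "card (k x) = 2" "card (k z) = 2" "card (k y) = 1"
    then show thesis using that[OF perm(1)] c by simp
  next
    assume "card (k y) = 2" "card (k z) = 2" "card (k x) = 1"
    then show thesis using that[OF perm(3)] c by simp
  qed
  have z: "{f\<in>crossing G X. card (k f) = 0} = {}" using F by auto
  let ?a = "card {e\<in>edges (induced G X). card (k e) = 0}"
  let ?b = "card {e\<in>edges (induced G (verts G - X)). card (k e) = 0}"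
  have "?a + ?b = 3" using card_covered_split[OF G XV, of k 0] hex_coverD(4)[OF h] unfolding z by simp
  then have "?a \<le> 1 \<or> ?b \<le> 1" by linarith
  then show ?thesis
  proof
    assume "?a \<le> 1"
    from type_221_side[OF h X no2 F this nr] show ?thesis by blast
  next
    assume b: "?b \<le> 1"
    have "card (crossing G (verts G - X)) = 3" "2 \<le> card (verts G - (verts G - X))"
      using cY X double_compl[OF XV] by simp_all
    from type_221_side[OF h proper_cut_compl[OF X(1)] this(1) X(4) this(2) no2 F(1)[folded cY] F(2-5) b nr]
    show ?thesis by blast
  qed
qed

section \<open>Kempe chains and pairs of triangles\<close>

text \<open>In a graph whose vertices have degree 1 (those in \<open>insert a Tm\<close>) or 2 (those in \<open>U\<close>), the
  component of \<open>a\<close> is a path ending at another vertex of degree 1.\<close>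

lemma kempe_chain:
  fixes st :: "nat \<Rightarrow> nat set"
  assumes "finite U" "a \<notin> U" "a \<notin> Tm" "U \<inter> Tm = {}" "st a = {e0}"
    "\<forall>t\<in>Tm. card (st t) = 1" "\<forall>u\<in>U. card (st u) = 2"
    "\<forall>z\<in>insert a (U \<union> Tm). \<forall>e\<in>st z. \<exists>x\<in>insert a (U \<union> Tm). x \<noteq> z \<and>
       (\<forall>y\<in>insert a (U \<union> Tm). e \<in> st y \<longleftrightarrow> y = z \<or> y = x)"
  shows "\<exists>t\<in>Tm. \<exists>K. e0 \<in> K \<and> st t \<subseteq> K \<and> (\<forall>t'\<in>Tm - {t}. st t' \<inter> K = {}) \<and>
    (\<forall>u\<in>U. st u \<subseteq> K \<or> st u \<inter> K = {})"
  using assms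
proof (induction "card U" arbitrary: U a st e0 rule: less_induct)
  case less
  note p = less.prems
  let ?W = "insert a (U \<union> Tm)"
  have "a \<in> ?W" "e0 \<in> st a" using p(5) by auto
  then obtain x where x: "x \<in> ?W" "x \<noteq> a" and xe: "\<And>y. y \<in> ?W \<Longrightarrow> e0 \<in> st y \<longleftrightarrow> y = a \<or> y = x"
    using p(8) by meson
  have ex: "e0 \<in> st x" using xe[OF x(1)] by simp
  show ?case
  proof (cases "x \<in> Tm")
    case True
    then have "card (st x) = 1" using p(6) by blast
    then obtain e where "st x = {e}" by (meson card_1_singletonE)
    then have "st x = {e0}" using ex by simp
    moreover have "st t' \<inter> {e0} = {}" if "t' \<in> Tm - {x}" for t'
      using xe[of t'] that p(3) by auto
    moreover have "st u \<subseteq> {e0} \<or> st u \<inter> {e0} = {}" if "u \<in> U" for u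
      using xe[of u] that p(2,4) True by auto
    ultimately show ?thesis using True by (intro bexI[of _ x] exI[of _ "{e0}"]) auto
  next
    case False
    then have xU: "x \<in> U" using x by blast
    then have "card (st x) = 2" using p(7) by blast
    then obtain u v where uv: "st x = {u, v}" "u \<noteq> v" by (meson card_2_iff)
    then have "e0 = u \<or> e0 = v" using ex by simp
    then obtain e1 where e1: "st x = {e0, e1}" "e0 \<noteq> e1" using uv by (metis insert_commute)
    \<comment> \<open>The walk advances from \<open>a\<close> to \<open>x\<close>: deleting
      \<open>e0\<close> makes \<open>x\<close> a vertex of degree 1, the start of the remaining
      chain.\<close>
    define st' where "st' = st(x := {e1})"
    define U' where "U' = U - {x}"
    have W': "insert x (U' \<union> Tm) \<subseteq> ?W" "a \<notin> insert x (U' \<union> Tm)"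
      using xU x(2) p(2,3) unfolding U'_def by auto
    have Wa: "y \<in> insert x (U' \<union> Tm)" if "y \<in> ?W" "y \<noteq> a" for y
      using that unfolding U'_def by blast
    have st'e: "e \<in> st' y \<longleftrightarrow> e \<in> st y" if "e \<noteq> e0" for e y
      unfolding st'_def using e1 that by simp
    have ne0: "e \<noteq> e0" if "z \<in> insert x (U' \<union> Tm)" "e \<in> st' z" for e z
    proof
      assume e: "e = e0"
      have "e0 \<notin> st' x" unfolding st'_def using e1(2) by simp
      then have "z \<noteq> x" using that(2) e by blast
      then have "e0 \<in> st z" using that(2) e unfolding st'_def by simp
      then have "z = a \<or> z = x" using xe W'(1) that(1) by blast
      then show False using W'(2) that(1) \<open>z \<noteq> x\<close> by blast
    qed
    have inc: "\<forall>z\<in>insert x (U' \<union> Tm). \<forall>e\<in>st' z. \<exists>x2\<in>insert x (U' \<union> Tm). x2 \<noteq> z \<and>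
       (\<forall>y\<in>insert x (U' \<union> Tm). e \<in> st' y \<longleftrightarrow> y = z \<or> y = x2)"
    proof (intro ballI)
      fix z e assume z: "z \<in> insert x (U' \<union> Tm)" "e \<in> st' z"
      have ne: "e \<noteq> e0" using ne0[OF z] .
      then have "e \<in> st z" using st'e z(2) by blast
      moreover have zW: "z \<in> ?W" using W' z(1) by blast
      ultimately obtain x2 where x2: "x2 \<in> ?W" "x2 \<noteq> z" and
        iff: "\<forall>y\<in>?W. e \<in> st y \<longleftrightarrow> y = z \<or> y = x2"
        using p(8) by meson
      have "e \<in> st x2" using iff x2(1) by blast
      then have "x2 \<noteq> a" using p(5) ne by auto
      then have "x2 \<in> insert x (U' \<union> Tm)" using Wa x2(1) by blast
      moreover have "\<forall>y\<in>insert x (U' \<union> Tm). e \<in> st' y \<longleftrightarrow> y = z \<or> y = x2"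
        using iff W'(1) st'e[OF ne] by blast
      ultimately show "\<exists>x2\<in>insert x (U' \<union> Tm). x2 \<noteq> z \<and>
         (\<forall>y\<in>insert x (U' \<union> Tm). e \<in> st' y \<longleftrightarrow> y = z \<or> y = x2)"
        using x2(2) by blast
    qed
    have same: "st' y = st y" if "y \<noteq> x" for y using that unfolding st'_def by simp
    have cU: "card U' < card U" using xU p(1) unfolding U'_def by (intro psubset_card_mono) auto
    have pr: "finite U'" "x \<notin> U'" "x \<notin> Tm" "U' \<inter> Tm = {}" "st' x = {e1}"
      using p(1,4) False unfolding U'_def st'_def by auto
    have cd: "\<forall>t\<in>Tm. card (st' t) = 1" "\<forall>u\<in>U'. card (st' u) = 2"
      using p(6,7) False same unfolding U'_def by (metis, metis Diff_iff singletonI)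
    obtain t K where t: "t \<in> Tm" and K: "e1 \<in> K" "st' t \<subseteq> K" "\<forall>t'\<in>Tm - {t}. st' t' \<inter> K = {}"
      "\<forall>u\<in>U'. st' u \<subseteq> K \<or> st' u \<inter> K = {}"
      using less.hyps[OF cU pr cd inc] by blast
    have Tx: "t' \<noteq> x" "e0 \<notin> st t'" if "t' \<in> Tm" for t'
      using that False xe[of t'] p(3) by auto
    have Ux: "e0 \<notin> st u" if "u \<in> U'" for u
      using that xe[of u] p(2) unfolding U'_def by auto
    have "e0 \<in> insert e0 K" by simp
    moreover have "st t \<subseteq> insert e0 K" using K(2) same[OF Tx(1)[OF t]] by blast
    moreover have "st t' \<inter> insert e0 K = {}" if "t' \<in> Tm - {t}" for t'
      using K(3) same[OF Tx(1)] Tx(2) that by auto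
    moreover have "st u \<subseteq> insert e0 K \<or> st u \<inter> insert e0 K = {}" if u: "u \<in> U" for u
    proof (cases "u = x")
      case True
      then show ?thesis using e1 K(1) by auto
    next
      case False
      then have "u \<in> U'" using u unfolding U'_def by simp
      then show ?thesis using K(4) same[OF False] Ux by fastforce
    qed
    ultimately show ?thesis by (intro bexI[OF _ t] exI[of _ "insert e0 K"] conjI ballI) simp_all
  qed
qed

section \<open>Colouring a graph whose core runs through two triangles\<close>

lemma star_two:
  assumes G: "bridgeless_cubic G" and e: "e \<in> star G x" "e \<in> star G y" "x \<noteq> y"
  shows "e \<in> star G z \<longleftrightarrow> z = x \<or> z = y"
proof -
  obtain u v where "\<forall>x. e \<in> star G x \<longleftrightarrow> x = u \<or> x = v"
    using edge_ends_ex[OF G star_verts(2)[OF G e(1)]] by blast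
  then show ?thesis using e by metis
qed

text \<open>Contracting both triangles leaves a 4-cycle \<open>f1\<close>, \<open>f\<close>,
  \<open>f2\<close>, \<open>h\<close>, and \<open>y1\<close> to \<open>y4\<close> are its colours in
  this order; the four equations are the conditions at its vertices. Back in a triangle, each edge
  takes the colour of the outgoing edge at the opposite vertex.\<close>

lemma hexagon_tait:
  assumes V: "verts G = U \<union> {a, b, p, q, r, p', q', r'}"
    and st: "star G a = {f1, h, da}" "star G b = {f2, h, db}" "star G p = {f1, g, d1}" "star G q = {f, g, d2}"
      "star G r = {f3, d1, d2}" "star G p' = {f, g', e1}" "star G q' = {f2, g', e2}" "star G r' = {f3', e1, e2}"
    and dist: "distinct [f1, f, f2, g, g', h, d1, d2, e1, e2]"
      "{da, db, f3, f3'} \<inter> set [f1, f, f2, g, g', h, d1, d2, e1, e2] = {}"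
    and U: "\<And>u. u \<in> U \<Longrightarrow> star G u \<inter> set [f1, f, f2, g, g', h, d1, d2, e1, e2] = {}"
      "\<And>u. u \<in> U \<Longrightarrow> s ` star G u = colours"
    and y: "{y1, y4, s da} = colours" "{y1, y2, s f3} = colours" "{y2, y3, s f3'} = colours" "{y3, y4, s db} = colours"
  shows "tait G"
proof (rule taitI)
  define c where "c e = (if e = f1 then y1 else if e = f then y2 else if e = f2 then y3 else if e = h then y4
    else if e = g then s f3 else if e = g' then s f3' else if e = d1 then y2 else if e = d2 then y1
    else if e = e1 then y3 else if e = e2 then y2 else s e)" for e
  have c: "c f1 = y1" "c f = y2" "c f2 = y3" "c h = y4" "c g = s f3" "c g' = s f3'" "c d1 = y2" "c d2 = y1"
    "c e1 = y3" "c e2 = y2"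
    using dist(1) unfolding c_def by auto
  have other: "c e = s e" if "e \<notin> set [f1, f, f2, g, g', h, d1, d2, e1, e2]" for e
    using that unfolding c_def by simp
  have c': "c da = s da" "c db = s db" "c f3 = s f3" "c f3' = s f3'"
    using dist(2) by (intro other; blast)+
  fix v assume v: "v \<in> verts G"
  show "c ` star G v = colours"
  proof (cases "v \<in> U")
    case True
    have "c e = s e" if "e \<in> star G v" for e using U(1)[OF True] that by (intro other) blast
    then show ?thesis using U(2)[OF True] by simp
  next
    case False
    then consider "v = a" | "v = b" | "v = p" | "v = q" | "v = r" | "v = p'" | "v = q'" | "v = r'"
      using v V by blast
    then show ?thesis
      by cases (use y in \<open>simp_all add: st c c' insert_commute\<close>)
  qed
qed

lemma bad_triangleD:
  assumes "bad_triangle G k p q r g d1 d2 f1 f2 f3"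
  shows "p \<in> verts G" "q \<in> verts G" "r \<in> verts G" "p \<noteq> q" "p \<noteq> r" "q \<noteq> r"
    "distinct [g, d1, d2, f1, f2, f3]"
    "star G p = {f1, g, d1}" "star G q = {f2, g, d2}" "star G r = {f3, d1, d2}"
    "card (k g) = 0" "card (k d1) = 1" "card (k d2) = 1" "card (k f1) = 2" "card (k f2) = 2" "card (k f3) = 1"
  using assms unfolding bad_triangle_def by simp_all

lemma bad_triangle_swap:
  "bad_triangle G k p q r g d1 d2 f1 f2 f3 \<Longrightarrow> bad_triangle G k q p r g d2 d1 f2 f1 f3"
  unfolding bad_triangle_def by (auto simp: insert_commute)

lemma bad_triangle_crossing:
  assumes "bad_triangle G k p q r g d1 d2 f1 f2 f3"
  shows "crossing G {p, q, r} = {f1, f2, f3}"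
proof -
  note d = bad_triangleD[OF assms]
  have "{p, q} = ({p} - {q}) \<union> ({q} - {p})" using d(4) by auto
  then have "crossing G {p, q} = (star G p - star G q) \<union> (star G q - star G p)"
    using crossing_sym_diff by metis
  then have pq: "crossing G {p, q} = {f1, d1, f2, d2}" unfolding d(8,9) using d(7) by auto
  have "{p, q, r} = ({p, q} - {r}) \<union> ({r} - {p, q})" using d(5,6) by auto
  then have "crossing G {p, q, r} = (crossing G {p, q} - star G r) \<union> (star G r - crossing G {p, q})"
    using crossing_sym_diff by metis
  then show ?thesis unfolding pq d(10) using d(7) by auto
qed

lemma cover3_star:
  assumes k: "cover3 G k" and v: "v \<in> verts G" "star G v = {x, y, z}" "x \<noteq> y" "x \<noteq> z" "y \<noteq> z"
  shows "k x \<union> k y \<union> k z = colours" "k x \<inter> k y = {}" "k x \<inter> k z = {}" "k y \<inter> k z = {}"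
proof -
  show "k x \<union> k y \<union> k z = colours" using cover3D(1)[OF k v(1)] unfolding v(2) by (simp add: Un_assoc)
  show "k x \<inter> k y = {}" "k x \<inter> k z = {}" "k y \<inter> k z = {}"
    using cover3D(2)[OF k v(1)] v(3-5) unfolding v(2) by simp_all
qed

lemma cover3_star_compl:
  assumes k: "cover3 G k" and v: "v \<in> verts G" "star G v = {x, y, z}" "x \<noteq> y" "x \<noteq> z" "y \<noteq> z" and y: "k y = {}"
  shows "k x = colours - k z" "k z = colours - k x"
  using cover3_star[OF k v] y by auto

text \<open>Two bad triangles sharing a doubly covered edge force the core to be a hexagon
  \<open>a p q p' q' b\<close> in which each triangle sits on one uncovered edge. Contracting both triangles leaves
  a 4-cycle whose outgoing edges have colours \<open>c1, c3, c1, c3\<close>; after a Kempe change along any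
  \<open>c1\<close>-\<open>c3\<close> chain leaving \<open>a\<close> the 4-cycle can be coloured.\<close>

lemma bad_triangles_sharing_edge:
  assumes hc: "hex_cover G k" and no2: "no_two_cut G"
    and T1: "bad_triangle G k p q r g d1 d2 f1 f f3" and T2: "bad_triangle G k p' q' r' g' e1 e2 f f2 f3'"
    and disj: "{p, q, r} \<inter> {p', q', r'} = {}"
  shows False
proof -
  note G = hex_coverD(1)[OF hc]
  note k = hex_coverD(3)[OF hc]
  note le2 = hex_coverD(6)[OF hc]
  note F = bridgeless_cubicD[OF G]
  note t1 = bad_triangleD[OF T1]
  note t2 = bad_triangleD[OF T2]
  have fin: "finite (covered G k j)" for j using F(3) unfolding covered_def by simp
  have vne: "p \<noteq> p'" "p \<noteq> q'" "p \<noteq> r'" "q \<noteq> p'" "q \<noteq> q'" "q \<noteq> r'" "r \<noteq> p'" "r \<noteq> q'" "r \<noteq> r'"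
    using disj by auto
  have dis1: "g \<noteq> d1" "g \<noteq> d2" "g \<noteq> f1" "g \<noteq> f" "g \<noteq> f3" "d1 \<noteq> d2" "d1 \<noteq> f1" "d1 \<noteq> f" "d1 \<noteq> f3"
    "d2 \<noteq> f1" "d2 \<noteq> f" "d2 \<noteq> f3" "f1 \<noteq> f" "f1 \<noteq> f3" "f \<noteq> f3" using t1(7) by auto
  have dis2: "g' \<noteq> e1" "g' \<noteq> e2" "g' \<noteq> f" "g' \<noteq> f2" "g' \<noteq> f3'" "e1 \<noteq> e2" "e1 \<noteq> f" "e1 \<noteq> f2" "e1 \<noteq> f3'"
    "e2 \<noteq> f" "e2 \<noteq> f2" "e2 \<noteq> f3'" "f \<noteq> f2" "f \<noteq> f3'" "f2 \<noteq> f3'" using t2(7) by auto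
  have inc: "\<And>z. g \<in> star G z \<longleftrightarrow> z = p \<or> z = q" "\<And>z. d1 \<in> star G z \<longleftrightarrow> z = p \<or> z = r"
    "\<And>z. d2 \<in> star G z \<longleftrightarrow> z = q \<or> z = r" "\<And>z. f \<in> star G z \<longleftrightarrow> z = q \<or> z = p'"
    "\<And>z. g' \<in> star G z \<longleftrightarrow> z = p' \<or> z = q'" "\<And>z. e1 \<in> star G z \<longleftrightarrow> z = p' \<or> z = r'"
    "\<And>z. e2 \<in> star G z \<longleftrightarrow> z = q' \<or> z = r'"
    by (rule star_two[OF G]; use t1(4-6,8-10) t2(4-6,8-10) vne in simp)+
  have cross: "g \<noteq> g'" "d1 \<noteq> e1" "d1 \<noteq> e2" "d2 \<noteq> e1" "d2 \<noteq> e2"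
    using inc vne by metis+
  \<comment> \<open>If \<open>f1\<close> and \<open>f2\<close> coincided, at most \<open>f3\<close>
    and \<open>f3'\<close> would leave the six triangle vertices. These would be all vertices, and
    only \<open>g\<close> and \<open>g'\<close> would be uncovered, one too few.\<close>
  have f12: "f1 \<noteq> f2"
  proof
    assume eq: "f1 = f2"
    let ?Z = "{p, q, r} \<union> {p', q', r'}"
    have "?Z = ({p, q, r} - {p', q', r'}) \<union> ({p', q', r'} - {p, q, r})" using disj by auto
    then have "crossing G ?Z = (crossing G {p, q, r} - crossing G {p', q', r'}) \<union>
        (crossing G {p', q', r'} - crossing G {p, q, r})"
      using crossing_sym_diff by metis
    then have cZ: "crossing G ?Z = ({f3} - {f3'}) \<union> ({f3'} - {f3})"
      unfolding bad_triangle_crossing[OF T1] bad_triangle_crossing[OF T2] using eq dis1 dis2 by auto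
    have ZV: "?Z \<subseteq> verts G" using t1(1-3) t2(1-3) by auto
    have "?Z = verts G"
    proof (rule ccontr)
      assume "?Z \<noteq> verts G"
      then have pc: "proper_cut G ?Z" using ZV unfolding proper_cut_def by blast
      then have "2 \<le> card (crossing G ?Z)" using F(6) unfolding proper_cut_def by blast
      moreover have "card (crossing G ?Z) \<noteq> 2" using no2 pc unfolding no_two_cut_def by blast
      moreover have "card (crossing G ?Z) \<le> card {f3, f3'}" unfolding cZ by (intro card_mono) auto
      moreover have "card {f3, f3'} \<le> 2" by (simp add: card_insert_if)
      ultimately show False by linarith
    qed
    then have "covered G k 0 \<subseteq> {g, g'}"
    proof -
      assume V: "?Z = verts G"
      show ?thesis
      proof
        fix e assume e: "e \<in> covered G k 0"
        then have eE: "e \<in> edges G" and e0: "card (k e) = 0" unfolding covered_def by auto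
        obtain v where v: "v \<in> verts G" "e \<in> star G v" using edge_ends_ex[OF G eE] by blast
        have "v = p \<or> v = q \<or> v = r \<or> v = p' \<or> v = q' \<or> v = r'" using v(1) V[symmetric] by auto
        then show "e \<in> {g, g'}"
          using v(2) e0 t1(8-10,12-16) t2(8-10,12-16) by auto
      qed
    qed
    then have "card (covered G k 0) \<le> card {g, g'}" by (intro card_mono) auto
    then show False using hex_coverD(4)[OF hc] cross(1) by simp
  qed
  have E: "f1 \<in> edges G" "f2 \<in> edges G" "f \<in> edges G"
    using star_verts(2)[OF G, of _ p] star_verts(2)[OF G, of _ q'] star_verts(2)[OF G, of _ q] t1(8,9) t2(9) by auto
  have E2: "covered G k 2 = {f1, f, f2}"
  proof (rule card_seteq[symmetric, OF fin])
    show "{f1, f, f2} \<subseteq> covered G k 2" using E t1(14,15) t2(15) unfolding covered_def by simp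
    show "card (covered G k 2) \<le> card {f1, f, f2}" using hex_coverD(5)[OF hc] dis1 dis2 f12 by simp
  qed
  have cne: "f1 \<noteq> g'" "f1 \<noteq> e1" "f1 \<noteq> e2" "f1 \<noteq> f3'" "f2 \<noteq> g" "f2 \<noteq> d1" "f2 \<noteq> d2" "f2 \<noteq> f3"
    using t1(11-16) t2(11-16) by auto
  obtain a where a: "a \<in> verts G" "a \<noteq> p" "f1 \<in> star G a"
    using edge_ends_ex[OF G E(1)] by metis
  obtain b where b: "b \<in> verts G" "b \<noteq> q'" "f2 \<in> star G b"
    using edge_ends_ex[OF G E(2)] by metis
  have an: "a \<noteq> q" "a \<noteq> r" "a \<noteq> p'" "a \<noteq> q'" "a \<noteq> r'"
    using a(3) t1(9,10) t2(8-10) dis1 f12 cne by auto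
  have bn: "b \<noteq> p" "b \<noteq> q" "b \<noteq> r" "b \<noteq> p'" "b \<noteq> r'"
    using b(3) t1(8-10) t2(8,10) dis2 f12 cne by auto
  obtain h where hz: "h \<in> star G a" "card (k h) = 0" using cover3_partner[OF G k a(3)] t1(14) by auto
  obtain h' where h': "h' \<in> star G b" "card (k h') = 0" using cover3_partner[OF G k b(3)] t2(15) by auto
  have gE: "g \<in> edges G" "g' \<in> edges G" "h \<in> edges G" "h' \<in> edges G"
    using star_verts(2)[OF G, of _ p] star_verts(2)[OF G, of _ p'] star_verts(2)[OF G] t1(8) t2(8) hz h' by auto
  have hg: "h \<noteq> g" "h \<noteq> g'" "h' \<noteq> g" "h' \<noteq> g'"
    using inc(1,5) hz(1) h'(1) a(2) an b(2) bn by metis+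
  have E0: "covered G k 0 = {g, g', h}"
  proof (rule card_seteq[symmetric, OF fin])
    show "{g, g', h} \<subseteq> covered G k 0" using gE t1(11) t2(11) hz(2) unfolding covered_def by simp
    show "card (covered G k 0) \<le> card {g, g', h}" using hex_coverD(4)[OF hc] hg cross(1) by simp
  qed
  have "h' \<in> covered G k 0" using gE h' unfolding covered_def by simp
  \<comment> \<open>Only three edges are uncovered, so the uncovered edges at \<open>a\<close> and
    at \<open>b\<close> are the same one, and \<open>h\<close> closes the hexagon.\<close>
  then have hh: "h' = h" using E0 hg by auto
  have emp: "k g = {}" "k g' = {}" "k h = {}"
    using cover3_subset(2)[OF G k] gE t1(11) t2(11) hz(2) by (metis card_0_eq)+
  have fsub: "k f1 \<subseteq> colours" "k f2 \<subseteq> colours" "k f \<subseteq> colours" using cover3_subset(1)[OF G k] E by auto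
  have ab: "a \<noteq> b"
  proof
    assume "a = b"
    then have "k f1 \<inter> k f2 = {}" using cover3D(2)[OF k a(1) a(3)] b(3) f12 by simp
    then show False using two_subsets_meet[OF fsub(1,2)] t1(14) t2(15) by simp
  qed
  have incf: "\<And>z. f1 \<in> star G z \<longleftrightarrow> z = p \<or> z = a" "\<And>z. f2 \<in> star G z \<longleftrightarrow> z = q' \<or> z = b"
    "\<And>z. h \<in> star G z \<longleftrightarrow> z = a \<or> z = b"
    by (rule star_two[OF G]; use t1(8) t2(9) a b ab hz h' hh in simp)+
  have hf: "h \<noteq> f1" "h \<noteq> f2" "h \<noteq> f" "h \<noteq> d1" "h \<noteq> d2" "h \<noteq> e1" "h \<noteq> e2"
    using hz(2) t1(12-16) t2(12-16) by auto
  obtain da where da: "star G a = {f1, h, da}" "f1 \<noteq> da" "h \<noteq> da"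
    using card_three_cases2[of "star G a" f1 h] F(5)[OF a(1)] a(3) hz(1) hf by metis
  obtain db where db: "star G b = {f2, h, db}" "f2 \<noteq> db" "h \<noteq> db"
    using card_three_cases2[of "star G b" f2 h] F(5)[OF b(1)] b(3) h'(1) hh hf by metis
  define L where "L = set [f1, f, f2, g, g', h, d1, d2, e1, e2]"
  obtain c1 where c1: "k d1 = {c1}" using t1(12) by (meson card_1_singletonE)
  obtain c2 where c2: "k d2 = {c2}" using t1(13) by (meson card_1_singletonE)
  obtain c3 where c3: "k f3 = {c3}" using t1(16) by (meson card_1_singletonE)
  obtain m where m: "k e2 = {m}" using t2(13) by (meson card_1_singletonE)
  obtain n where n: "k f3' = {n}" using t2(16) by (meson card_1_singletonE)
  have pr: "{c1, c2, c3} = colours" "c1 \<noteq> c2" "c1 \<noteq> c3" "c2 \<noteq> c3"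
    using cover3_star[OF k t1(3,10)] dis1 unfolding c1 c2 c3 by auto
  have kf1: "k f1 = colours - {c1}"
    using cover3_star_compl(1)[OF k t1(1,8)] dis1 emp c1 by auto
  have kf: "k f = colours - {c2}"
    using cover3_star_compl(1)[OF k t1(2,9)] dis1 emp c2 by auto
  have "k e1 = colours - k f" using cover3_star_compl(2)[OF k t2(1,8)] dis2 emp by auto
  then have ke1: "k e1 = {c2}" using kf pr by auto
  have kf2: "k f2 = colours - {m}"
    using cover3_star_compl(1)[OF k t2(2,9)] dis2 emp m by auto
  have "k da = colours - k f1" using cover3_star_compl(2)[OF k a(1) da(1)] da hf emp by auto
  then have kda: "k da = {c1}" using kf1 pr by auto
  have r': "{n} \<union> {c2} \<union> {m} = colours" "{n} \<inter> {c2} = {}" "{n} \<inter> {m} = {}" "{c2} \<inter> {m} = {}"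
    using cover3_star[OF k t2(3,10)] dis2 unfolding n m ke1 by auto
  \<comment> \<open>With \<open>m = c1\<close> the colour \<open>c3\<close> would be on all three
    doubly covered edges, which is impossible in a non-colourable graph. This settles the colours of
    all edges leaving the hexagon and the triangles.\<close>
  have mc: "m \<noteq> c1"
  proof
    assume "m = c1"
    then have "c3 \<in> k f1" "c3 \<in> k f" "c3 \<in> k f2" unfolding kf1 kf kf2 using pr by auto
    moreover have "c3 \<in> colours" using pr by auto
    from hex_coverD(7)[OF hc this] obtain e where "e \<in> covered G k 2" "c3 \<notin> k e"
      unfolding covered_def by blast
    ultimately show False unfolding E2 by auto
  qed
  have "m \<in> colours" "n \<in> colours" using r'(1) by auto
  then have mn: "m = c3" "n = c1" using pr mc r' by auto
  have "k db = colours - k f2" using cover3_star_compl(2)[OF k b(1) db(1)] db hf emp by auto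
  then have kdb: "k db = {c3}" using kf2 mn pr by auto
  have kn: "k e2 = {c3}" "k f3' = {c1}" using m n mn by auto
  have kL: "\<And>e. k e = {c1} \<or> k e = {c3} \<Longrightarrow> e \<noteq> f1 \<and> e \<noteq> f \<and> e \<noteq> f2 \<and> e \<noteq> g \<and> e \<noteq> g' \<and> e \<noteq> h \<and> e \<noteq> d2 \<and> e \<noteq> e1"
    using t1(14,15) t2(15) emp c2 ke1 pr by auto
  have Lv: "star G v \<inter> L = {}" if "v \<notin> {a, b, p, q, r, p', q', r'}" for v
    using that inc incf unfolding L_def by auto
  have ddL: "{da, db, f3, f3'} \<inter> L = {}"
  proof -
    have "d1 \<notin> star G a" "e2 \<notin> star G a" "d1 \<notin> star G b" "e2 \<notin> star G b"
      "e2 \<notin> star G r" "d1 \<notin> star G r'" using inc a(2) b(2) an bn vne by auto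
    then have "da \<noteq> d1" "da \<noteq> e2" "db \<noteq> d1" "db \<noteq> e2" "f3 \<noteq> e2" "f3' \<noteq> d1"
      using da db t1(10) t2(10) by auto
    then show ?thesis using kL[of da] kL[of db] kL[of f3] kL[of f3'] kda kdb c3 kn dis1 dis2
      unfolding L_def by auto
  qed
  define U where "U = verts G - {a, b, p, q, r, p', q', r'}"
  have one: "card (k e) = 1" if "u \<in> U" "e \<in> star G u" for u e
  proof -
    have eE: "e \<in> edges G" using star_verts(2)[OF G that(2)] .
    have "e \<notin> L" using Lv[of u] that unfolding U_def by blast
    then have "e \<notin> covered G k 0" "e \<notin> covered G k 2" unfolding E0 E2 L_def by auto
    then have "card (k e) \<noteq> 0" "card (k e) \<noteq> 2" using eE unfolding covered_def by auto
    then show ?thesis using le2[OF eE] by linarith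
  qed
  have Ustar: "\<exists>x y z. star G u = {x, y, z} \<and> k x = {c1} \<and> k y = {c3} \<and> k z = {c2}" if u: "u \<in> U" for u
  proof -
    have uV: "u \<in> verts G" using u unfolding U_def by blast
    have ex: "\<exists>x\<in>star G u. k x = {i}" if i: "i \<in> colours" for i
    proof -
      obtain x where x: "x \<in> star G u" "i \<in> k x" using cover3D(1)[OF k uV] i by blast
      obtain j where "k x = {j}" using one[OF u x(1)] by (meson card_1_singletonE)
      then show ?thesis using x by auto
    qed
    have cc: "c1 \<in> colours" "c2 \<in> colours" "c3 \<in> colours" using pr(1) by auto
    obtain x y z where xyz: "x \<in> star G u" "k x = {c1}" "y \<in> star G u" "k y = {c3}" "z \<in> star G u" "k z = {c2}"
      using ex[OF cc(1)] ex[OF cc(2)] ex[OF cc(3)] by blast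
    then have "x \<noteq> y" "x \<noteq> z" "y \<noteq> z" using pr by auto
    then have "star G u = {x, y, z}" using card_three_eq[OF F(5)[OF uV]] xyz by blast
    then show ?thesis using xyz by blast
  qed
  define st where "st v = {e\<in>star G v. (k e = {c1} \<or> k e = {c3}) \<and> e \<noteq> d1 \<and> e \<noteq> e2}" for v
  have sta: "st a = {da}" "st b = {db}" "st r = {f3}" "st r' = {f3'}"
    unfolding st_def da(1) db(1) t1(10) t2(10)
    using kL[of f1] kL[of f2] kL[of h] kL[of d2] kL[of e1] kda kdb c3 kn ddL[unfolded L_def] by auto
  have stU: "\<exists>x y z. star G u = {x, y, z} \<and> k x = {c1} \<and> k y = {c3} \<and> k z = {c2} \<and> st u = {x, y}" if u: "u \<in> U" for u
  proof -
    obtain x y z where s: "star G u = {x, y, z}" "k x = {c1}" "k y = {c3}" "k z = {c2}" using Ustar[OF u] by blast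
    have "star G u \<inter> L = {}" using Lv u unfolding U_def by blast
    then have "x \<noteq> d1" "x \<noteq> e2" "y \<noteq> d1" "y \<noteq> e2" unfolding s(1) L_def by auto
    then have "st u = {x, y}" unfolding st_def s(1) using s(2-4) pr by auto
    then show ?thesis using s by blast
  qed
  have stU2: "\<forall>u\<in>U. card (st u) = 2"
  proof
    fix u assume "u \<in> U"
    then obtain x y where "st u = {x, y}" "k x = {c1}" "k y = {c3}" using stU by blast
    moreover have "x \<noteq> y" using calculation(2,3) pr(3) by auto
    ultimately show "card (st u) = 2" by simp
  qed
  let ?Tm = "{r, r', b}"
  let ?W = "insert a (U \<union> ?Tm)"
  have Wi: "z \<in> ?W \<longleftrightarrow> z \<in> verts G \<and> z \<noteq> p \<and> z \<noteq> q \<and> z \<noteq> p' \<and> z \<noteq> q'" for z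
    unfolding U_def using t1(3,5,6) t2(3,5,6) a(1,2) b(1,2) an bn vne by auto
  have noW: "e \<notin> star G p" "e \<notin> star G q" "e \<notin> star G p'" "e \<notin> star G q'" if "e \<in> st z" for e z
    using that kL[of e] unfolding st_def t1(8,9) t2(8,9) by auto
  have incW: "\<forall>z\<in>?W. \<forall>e\<in>st z. \<exists>x\<in>?W. x \<noteq> z \<and> (\<forall>y\<in>?W. e \<in> st y \<longleftrightarrow> y = z \<or> y = x)"
  proof (intro ballI)
    fix z e assume z: "z \<in> ?W" "e \<in> st z"
    have ez: "e \<in> star G z" using z(2) unfolding st_def by blast
    obtain x where x: "x \<in> verts G" "x \<noteq> z" "\<forall>y. e \<in> star G y \<longleftrightarrow> y = z \<or> y = x"
      using edge_ends_ex[OF G star_verts(2)[OF G ez]] ez by metis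
    have "x \<noteq> p" "x \<noteq> q" "x \<noteq> p'" "x \<noteq> q'" using noW[OF z(2)] x(3) by auto
    then have "x \<in> ?W" using Wi x(1) by blast
    moreover have "e \<in> st y \<longleftrightarrow> y = z \<or> y = x" for y
      using z(2) x(3) unfolding st_def by simp
    ultimately show "\<exists>x\<in>?W. x \<noteq> z \<and> (\<forall>y\<in>?W. e \<in> st y \<longleftrightarrow> y = z \<or> y = x)" using x(2) by blast
  qed
  have finU: "finite U" "a \<notin> U" "a \<notin> ?Tm" "U \<inter> ?Tm = {}" using F(2) an ab unfolding U_def by auto
  have cTm: "\<forall>t\<in>?Tm. card (st t) = 1" using sta by simp
  obtain t K where t: "t \<in> ?Tm" and K: "da \<in> K" "st t \<subseteq> K" "\<forall>t'\<in>?Tm - {t}. st t' \<inter> K = {}"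
    "\<forall>u\<in>U. st u \<subseteq> K \<or> st u \<inter> K = {}"
    using kempe_chain[OF finU sta(1) cTm stU2 incW] by blast
  \<comment> \<open>The Kempe change: \<open>c1\<close> and \<open>c3\<close> are exchanged on the
    chain \<open>K\<close> that starts at \<open>a\<close>.\<close>
  define s where "s e = (if e \<in> K \<and> k e = {c1} then c3 else if e \<in> K \<and> k e = {c3} then c1 else the_elem (k e))" for e
  have sU: "s ` star G u = colours" if u: "u \<in> U" for u
  proof -
    obtain x y z where x: "star G u = {x, y, z}" "k x = {c1}" "k y = {c3}" "k z = {c2}" "st u = {x, y}"
      using stU[OF u] by blast
    have sz: "s z = c2" unfolding s_def x(4) using pr by simp
    have "st u \<subseteq> K \<or> st u \<inter> K = {}" using K(4) u by blast
    then show ?thesis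
    proof
      assume "st u \<subseteq> K"
      then have "s x = c3" "s y = c1" unfolding s_def x(2,3,5) using pr by auto
      then show ?thesis unfolding x(1) pr(1)[symmetric] using sz by auto
    next
      assume "st u \<inter> K = {}"
      then have "s x = c1" "s y = c3" unfolding s_def x(2,3,5) by auto
      then show ?thesis unfolding x(1) pr(1)[symmetric] using sz by auto
    qed
  qed
  have LU: "star G u \<inter> set [f1, f, f2, g, g', h, d1, d2, e1, e2] = {}" if "u \<in> U" for u
    using Lv[of u] that unfolding U_def L_def by blast
  have V: "verts G = U \<union> {a, b, p, q, r, p', q', r'}"
    unfolding U_def using t1(1-3) t2(1-3) a(1) b(1) by auto
  have dL: "distinct [f1, f, f2, g, g', h, d1, d2, e1, e2]"
  proof -
    have "g \<noteq> e1" "g \<noteq> e2" "g' \<noteq> d1" "g' \<noteq> d2" using t1(11-13) t2(11-13) by auto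
    then show ?thesis using dis1 dis2 f12 cross cne hg hf by auto
  qed
  have tait: "tait G" if y: "{y1, y4, s da} = colours" "{y1, y2, s f3} = colours"
    "{y2, y3, s f3'} = colours" "{y3, y4, s db} = colours" for y1 y2 y3 y4
    using hexagon_tait[OF V da(1) db(1) t1(8-10) t2(8-10) dL ddL[unfolded L_def] LU sU y] .
  have sda: "s da = c3" unfolding s_def using K(1) kda by simp
  have inK: "s f3 = c1" if "f3 \<in> K" using that unfolding s_def c3 using pr by auto
  have inK': "s f3' = c3" if "f3' \<in> K" using that unfolding s_def kn by auto
  have inKb: "s db = c1" if "db \<in> K" using that unfolding s_def kdb using pr by auto
  have nK: "s f3 = c3" if "f3 \<notin> K" using that unfolding s_def c3 by auto
  have nK': "s f3' = c1" if "f3' \<notin> K" using that unfolding s_def kn by auto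
  have nKb: "s db = c3" if "db \<notin> K" using that unfolding s_def kdb by auto
  have rn: "r \<noteq> r'" "r \<noteq> b" "r' \<noteq> b" using vne bn by auto
  have out: "t \<noteq> r \<Longrightarrow> f3 \<notin> K" "t \<noteq> r' \<Longrightarrow> f3' \<notin> K" "t \<noteq> b \<Longrightarrow> db \<notin> K"
    using bspec[OF K(3), of r] bspec[OF K(3), of r'] bspec[OF K(3), of b] sta by auto
  have "tait G"
  proof -
    \<comment> \<open>In cyclic order around the 4-cycle the outgoing colours were
      \<open>c1\<close>, \<open>c3\<close>, \<open>c1\<close>, \<open>c3\<close>, which would force
      \<open>c2\<close> on all four of its edges. With the chain ending at \<open>r\<close>,
      \<open>r'\<close> or \<open>b\<close> they become \<open>c3\<close>, \<open>c1\<close>,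
      \<open>c1\<close>, \<open>c3\<close>, or four times \<open>c3\<close>, or \<open>c3\<close>,
      \<open>c3\<close>, \<open>c1\<close>, \<open>c1\<close>, and then the cycle can be coloured.
      The arguments given to \<open>tait\<close> are the colours of \<open>f1\<close>,
      \<open>h\<close>, \<open>f\<close>, \<open>f2\<close>, in this order.\<close>
    consider "t = r" | "t = r'" | "t = b" using t by blast
    then show ?thesis
    proof cases
      case 1
      then have "f3 \<in> K" "f3' \<notin> K" "db \<notin> K" using K(2) out sta rn by auto
      then show ?thesis using tait[of c2 c1 c3 c2] sda inK nK' nKb pr(1) by (auto simp: insert_commute)
    next
      case 2
      then have "f3 \<notin> K" "f3' \<in> K" "db \<notin> K" using K(2) out sta rn by auto
      then show ?thesis using tait[of c1 c2 c2 c1] sda nK inK' nKb pr(1) by (auto simp: insert_commute)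
    next
      case 3
      then have "f3 \<notin> K" "f3' \<notin> K" "db \<in> K" using K(2) out sta rn by auto
      then show ?thesis using tait[of c1 c2 c2 c3] sda nK nK' inKb pr(1) by (auto simp: insert_commute)
    qed
  qed
  then show False using hex_coverD(2)[OF hc] by simp
qed

text \<open>Each triangle has two doubly covered edges leaving it and there are only three in all,
  so two triangles share one. Exchanging the roles of \<open>p\<close> and \<open>q\<close> brings
  the shared edge into the position expected by \<open>bad_triangles_sharing_edge\<close>.\<close>

lemma disjoint_bad_triangles:
  assumes h: "hex_cover G k" and no2: "no_two_cut G"
    and T1: "bad_triangle G k p q r g d1 d2 f1 f2 f3"
    and T2: "bad_triangle G k p' q' r' g' e1 e2 f1' f2' f3'"
    and disj: "{p, q, r} \<inter> {p', q', r'} = {}"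
  shows False
proof -
  note G = hex_coverD(1)[OF h]
  note t1 = bad_triangleD[OF T1]
  note t2 = bad_triangleD[OF T2]
  have E: "f1 \<in> edges G" "f2 \<in> edges G" "f1' \<in> edges G" "f2' \<in> edges G"
    using star_verts(2)[OF G, of _ p] star_verts(2)[OF G, of _ q] star_verts(2)[OF G, of _ p']
      star_verts(2)[OF G, of _ q'] t1(8,9) t2(8,9) by auto
  have fin: "finite (covered G k 2)" using bridgeless_cubicD(3)[OF G] unfolding covered_def by simp
  have ne: "f1 \<noteq> f2" "f1' \<noteq> f2'" using t1(7) t2(7) by auto
  have "{f1, f2} \<inter> {f1', f2'} \<noteq> {}"
  proof
    assume "{f1, f2} \<inter> {f1', f2'} = {}"
    then have "card ({f1, f2} \<union> {f1', f2'}) = 4" using ne by (subst card_Un_disjoint) auto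
    moreover have "{f1, f2} \<union> {f1', f2'} \<subseteq> covered G k 2" using E t1(14,15) t2(14,15) unfolding covered_def by auto
    then have "card ({f1, f2} \<union> {f1', f2'}) \<le> card (covered G k 2)" using card_mono[OF fin] by blast
    ultimately show False using hex_coverD(5)[OF h] by simp
  qed
  then consider "f2 = f1'" | "f2 = f2'" | "f1 = f1'" | "f1 = f2'" by auto
  then show False
  proof cases
    case 1
    show False by (rule bad_triangles_sharing_edge[OF h no2 T1 T2[folded 1] disj])
  next
    case 2
    have "{p, q, r} \<inter> {q', p', r'} = {}" using disj by auto
    then show False by (rule bad_triangles_sharing_edge[OF h no2 T1 bad_triangle_swap[OF T2, folded 2]])
  next
    case 3
    have "{q, p, r} \<inter> {p', q', r'} = {}" using disj by auto
    then show False by (rule bad_triangles_sharing_edge[OF h no2 bad_triangle_swap[OF T1] T2[folded 3]])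
  next
    case 4
    have "{q, p, r} \<inter> {q', p', r'} = {}" using disj by auto
    then show False
      by (rule bad_triangles_sharing_edge[OF h no2 bad_triangle_swap[OF T1] bad_triangle_swap[OF T2, folded 4]])
  qed
qed

section \<open>Contracting the triangle\<close>

lemma bad_triangle_edges:
  assumes G: "bridgeless_cubic G" and T: "bad_triangle G k p q r g d1 d2 f1 f2 f3"
  shows "{g, d1, d2} \<subseteq> edges G" "edge_verts G {g, d1, d2} = {p, q, r}"
    "\<And>z. g \<in> star G z \<longleftrightarrow> z = p \<or> z = q" "\<And>z. d1 \<in> star G z \<longleftrightarrow> z = p \<or> z = r"
    "\<And>z. d2 \<in> star G z \<longleftrightarrow> z = q \<or> z = r"
proof -
  note t = bad_triangleD[OF T]
  show inc: "\<And>z. g \<in> star G z \<longleftrightarrow> z = p \<or> z = q" "\<And>z. d1 \<in> star G z \<longleftrightarrow> z = p \<or> z = r"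
    "\<And>z. d2 \<in> star G z \<longleftrightarrow> z = q \<or> z = r"
    by (rule star_two[OF G]; use t(4-6,8-10) in simp)+
  show E: "{g, d1, d2} \<subseteq> edges G"
    using star_verts(2)[OF G, of g p] star_verts(2)[OF G, of d1 p] star_verts(2)[OF G, of d2 q] t(8,9) by auto
  have "incident G e v \<longleftrightarrow> e \<in> star G v" if "e \<in> {g, d1, d2}" for e v
    using in_star_iff[OF G] E that by blast
  then have "edge_verts G {g, d1, d2} = {v. \<exists>e\<in>{g, d1, d2}. e \<in> star G v}"
    unfolding edge_verts_def by blast
  then show "edge_verts G {g, d1, d2} = {p, q, r}" using inc by auto
qed

lemma ends_of_star:
  assumes G: "bridgeless_cubic G" and e: "e \<in> star G x" "e \<in> star G y" "x \<noteq> y"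
  shows "ends G e = (x, y) \<or> ends G e = (y, x)"
proof -
  obtain u v where "ends G e = (u, v)" "\<forall>x. e \<in> star G x \<longleftrightarrow> x = u \<or> x = v"
    using edge_ends_ex[OF G star_verts(2)[OF G e(1)]] by blast
  then show ?thesis using e by metis
qed

lemma bad_triangle_circuit:
  assumes G: "bridgeless_cubic G" and T: "bad_triangle G k p q r g d1 d2 f1 f2 f3"
  shows "circuit G {g, d1, d2}"
proof -
  note t = bad_triangleD[OF T]
  note b = bad_triangle_edges[OF G T]
  let ?T = "{g, d1, d2}"
  let ?H = "edge_subgraph G ?T"
  have eH: "edges ?H = ?T" "verts ?H = {p, q, r}" "ends ?H = ends G"
    unfolding edge_subgraph_def using b(2) by simp_all
  have adj: "adj ?H x y" "adj ?H y x" if "e \<in> ?T" "e \<in> star G x" "e \<in> star G y" "x \<noteq> y" for e x y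
    using ends_of_star[OF G that(2-4)] that(1) unfolding adj_def eH by blast+
  have "reach ?H x y" if "x \<in> {p, q, r}" "y \<in> {p, q, r}" for x y
  proof (cases "x = y")
    case False
    have "adj ?H p q" "adj ?H q p" using adj[of g p q] b(3) t(4) by auto
    moreover have "adj ?H p r" "adj ?H r p" using adj[of d1 p r] b(4) t(5) by auto
    moreover have "adj ?H q r" "adj ?H r q" using adj[of d2 q r] b(5) t(6) by auto
    ultimately have "adj ?H x y" using that False by auto
    then show ?thesis unfolding reach_def by blast
  qed (simp add: reach_def)
  then have con: "connected ?H" unfolding connected_def eH by blast
  have wf: "wf_graph ?H"
    using bridgeless_cubicD(1)[OF G] b(1,2) unfolding wf_graph_def eH
    by (auto simp: edge_verts_def incident_def)
  have "degree ?H v = 2" if v: "v \<in> {p, q, r}" for v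
  proof -
    have nl: "{e\<in>edges ?H. fst (ends ?H e) = v \<and> snd (ends ?H e) = v} = {}"
      using G b(1) unfolding bridgeless_cubic_def eH by force
    have "star ?H v = star G v \<inter> ?T" unfolding crossing_def eH using b(1) by blast
    moreover have "star G p \<inter> ?T = {g, d1}" "star G q \<inter> ?T = {g, d2}" "star G r \<inter> ?T = {d1, d2}"
      unfolding t(8-10) using t(7) by auto
    ultimately have "card (star ?H v) = 2" using v t(7) by auto
    moreover have "card {e\<in>edges ?H. fst (ends ?H e) = v \<and> snd (ends ?H e) = v} = 0"
      unfolding nl by simp
    ultimately show ?thesis using degree_eq_card_star[OF wf, of v] by linarith
  qed
  then show ?thesis using con b(1) unfolding circuit_def b(2) by auto
qed

text \<open>A cut of the contraction is a cut of \<open>G\<close> that does not separate the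
  triangle. A nontrivial 3-cut would cut off a bad triangle; this cannot be disjoint from the
  contracted one, so it has the same vertices, and their image is a single vertex.\<close>

lemma bad_triangle_contract:
  assumes h: "hex_cover G k" and no2: "no_two_cut G" and nr: "\<not> hex_reduces G k"
    and T: "bad_triangle G k p q r g d1 d2 f1 f2 f3"
  shows "cyc_edge_conn 4 (contract G {g, d1, d2})"
proof (rule ccontr)
  note G = hex_coverD(1)[OF h]
  note F = bridgeless_cubicD[OF G]
  note t = bad_triangleD[OF T]
  note b = bad_triangle_edges[OF G T]
  let ?T = "{g, d1, d2}"
  let ?VT = "{p, q, r}"
  define M where "M = contract G ?T"
  assume "\<not> cyc_edge_conn 4 (contract G ?T)"
  then have nc: "\<not> cyc_edge_conn 4 M" unfolding M_def .
  define w where "w = (SOME x. x \<in> ?VT)"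
  define m where "m x = (if x \<in> ?VT then w else x)" for x
  have w: "w \<in> ?VT" unfolding w_def by (rule someI[of _ p]) simp
  have M: "verts M = (verts G - ?VT) \<union> {w}" "edges M = edges G - ?T"
    "\<And>e. ends M e = (m (fst (ends G e)), m (snd (ends G e)))"
    unfolding M_def contract_def Let_def b(2) w_def[symmetric] m_def[abs_def] by simp_all
  have VTV: "?VT \<subseteq> verts G" using t(1-3) by simp
  have ends: "fst (ends G e) \<in> verts G" "snd (ends G e) \<in> verts G" if "e \<in> edges G" for e
    using F(1) that unfolding wf_graph_def by auto
  have mV: "m x \<in> verts M" if "x \<in> verts G" for x using that w unfolding m_def M(1) by auto
  have wfM: "wf_graph M"
    using F(2,3) ends mV unfolding wf_graph_def by (auto simp: M)
  have VTM: "x = w" if "x \<in> ?VT" "x \<in> verts M" for x using that unfolding M(1) by blast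
  have loop: "fst (ends M e) \<noteq> snd (ends M e)" if e: "e \<in> edges M" for e
  proof -
    have eE: "e \<in> edges G" "e \<notin> ?T" using e M(2) by auto
    obtain u v where uv: "u \<noteq> v" "ends G e = (u, v)" "\<forall>x. e \<in> star G x \<longleftrightarrow> x = u \<or> x = v"
      using edge_ends_ex[OF G eE(1)] by blast
    have "\<not> (u \<in> ?VT \<and> v \<in> ?VT)"
    proof
      assume "u \<in> ?VT \<and> v \<in> ?VT"
      then have c: "(u = p \<or> u = q \<or> u = r) \<and> (v = p \<or> v = q \<or> v = r)" by simp
      have s: "e \<in> star G u" "e \<in> star G v" using uv(3) by simp_all
      have n: "\<not> (e \<in> star G p \<and> e \<in> star G q)" "\<not> (e \<in> star G p \<and> e \<in> star G r)"
        "\<not> (e \<in> star G q \<and> e \<in> star G r)"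
        using eE(2) t(7) unfolding t(8-10) by auto
      show False using c s n uv(1) by metis
    qed
    then show ?thesis unfolding M(3) uv(2) m_def using w uv(1) by auto
  qed
  \<comment> \<open>The preimage of \<open>X\<close> under the contraction map \<open>m\<close>; it
    contains the whole triangle or misses it.\<close>
  define lift where "lift X = (if w \<in> X then X \<union> ?VT else X)" for X
  have mlift: "m x \<in> X \<longleftrightarrow> x \<in> lift X" if "X \<subseteq> verts M" for x X
  proof (cases "x \<in> ?VT")
    case True
    then have "x \<in> X \<Longrightarrow> w \<in> X" using VTM[of x] that by auto
    then show ?thesis using True unfolding m_def lift_def by auto
  next
    case False
    then show ?thesis unfolding m_def lift_def by auto
  qed
  have VTl: "?VT \<subseteq> lift X \<or> ?VT \<inter> lift X = {}" if X: "X \<subseteq> verts M" for X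
  proof (cases "w \<in> X")
    case True
    then show ?thesis unfolding lift_def by auto
  next
    case False
    then have "x \<notin> X" if "x \<in> ?VT" for x using VTM[OF that] X by blast
    then show ?thesis using False unfolding lift_def by auto
  qed
  have cr: "crossing M X = crossing G (lift X)" if X: "X \<subseteq> verts M" for X
  proof -
    have "crossing M X = crossing G (lift X) - ?T"
      unfolding crossing_def M(2,3) fst_conv snd_conv mlift[OF X] by blast
    moreover have "?T \<inter> crossing G (lift X) = {}"
    proof -
      have "fst (ends G e) \<in> ?VT \<and> snd (ends G e) \<in> ?VT" if "e \<in> ?T" for e
        using b(2) that unfolding edge_verts_def incident_def by blast
      then show ?thesis using VTl[OF X] unfolding crossing_def by blast
    qed
    ultimately show ?thesis by blast
  qed
  have sub: "X \<subseteq> lift X" "lift X \<subseteq> verts G" "verts M - X \<subseteq> verts G - lift X" if X: "X \<subseteq> verts M" for X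
  proof -
    show "X \<subseteq> lift X" unfolding lift_def by auto
    have MV: "verts M \<subseteq> verts G" using VTV w unfolding M(1) by blast
    then show "lift X \<subseteq> verts G" using X VTV unfolding lift_def by auto
    show "verts M - X \<subseteq> verts G - lift X"
    proof
      fix x assume x: "x \<in> verts M - X"
      have "x \<notin> lift X"
      proof
        assume "x \<in> lift X"
        then have "w \<in> X" "x \<in> ?VT" using x unfolding lift_def by (auto split: if_splits)
        then show False using VTM[of x] x by blast
      qed
      then show "x \<in> verts G - lift X" using x MV by blast
    qed
  qed
  have pcut: "proper_cut G (lift X)" if X: "X \<subseteq> verts M" "X \<noteq> {}" "X \<noteq> verts M" for X
  proof -
    obtain x where "x \<in> verts M - X" using X by blast
    then have "x \<in> verts G - lift X" using sub(3)[OF X(1)] by (rule subsetD[rotated])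
    moreover have "lift X \<noteq> {}" using sub(1)[OF X(1)] X(2) by auto
    ultimately show ?thesis using sub(2)[OF X(1)] unfolding proper_cut_def by blast
  qed
  have ge2: "2 \<le> card (crossing G Z)" if "proper_cut G Z" for Z
    using F(6)[of Z] that unfolding proper_cut_def by simp
  have con: "connected M" unfolding connected_iff_crossing[OF wfM]
  proof (intro conjI allI impI)
    show "verts M \<noteq> {}" unfolding M(1) by blast
    fix X assume X: "X \<subseteq> verts M \<and> X \<noteq> {} \<and> X \<noteq> verts M"
    then have "proper_cut G (lift X)" by (intro pcut) simp_all
    then have "2 \<le> card (crossing G (lift X))" by (rule ge2)
    then have "2 \<le> card (crossing M X)" using cr[of X] X by simp
    then show "crossing M X \<noteq> {}" by (metis card.empty not_numeral_le_zero)
  qed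
  obtain X where X: "X \<subseteq> verts M" "card (crossing M X) \<le> 3" "2 \<le> card X" "2 \<le> card (verts M - X)"
    using not_cyc_edge_conn_cut[OF wfM loop con nc] by blast
  have p: "proper_cut G (lift X)" using X by (intro pcut) auto
  have "2 \<le> card (crossing G (lift X))" by (rule ge2[OF p])
  moreover have "card (crossing G (lift X)) \<noteq> 2" using no2 p unfolding no_two_cut_def by blast
  ultimately have c3: "card (crossing G (lift X)) = 3" using X(2) cr[OF X(1)] by simp
  have finV: "finite (lift X)" "finite (verts G - lift X)" using F(2) sub(2)[OF X(1)] finite_subset by auto
  have c1: "2 \<le> card (lift X)" using card_mono[OF finV(1) sub(1)[OF X(1)]] X(3) by linarith
  have c2: "2 \<le> card (verts G - lift X)" using card_mono[OF finV(2) sub(3)[OF X(1)]] X(4) by linarith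
  obtain p2 q2 r2 g2 h1 h2 j1 j2 j3 where B: "lift X = {p2, q2, r2} \<or> verts G - lift X = {p2, q2, r2}"
    "bad_triangle G k p2 q2 r2 g2 h1 h2 j1 j2 j3"
    using three_cut_bad_triangle[OF h p c3 c1 c2 no2 nr] by blast
  note t2 = bad_triangleD[OF B(2)]
  have small: "card Y \<le> 1" if "Y \<subseteq> ?VT" "Y \<subseteq> verts M" for Y
  proof -
    have "Y \<subseteq> {w}" using VTM that by blast
    then show ?thesis using card_mono[of "{w}" Y] by simp
  qed
  have cards: "card ?VT = 3" "card {p2, q2, r2} = 3" using t(4-6) t2(4-6) by auto
  have nd: "?VT \<inter> {p2, q2, r2} \<noteq> {}" using disjoint_bad_triangles[OF h no2 T B(2)] by blast
  \<comment> \<open>The other triangle is one side of the cut of \<open>lift X\<close>, which does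
    not separate \<open>?VT\<close>; since it meets \<open>?VT\<close>, it contains it.\<close>
  have "?VT \<subseteq> {p2, q2, r2}" using B(1) VTl[OF X(1)] nd VTV by blast
  then have eq: "?VT = {p2, q2, r2}" using cards by (intro card_subset_eq) simp_all
  show False using B(1)
  proof
    assume "lift X = {p2, q2, r2}"
    then have "X \<subseteq> ?VT" using sub(1)[OF X(1)] eq by simp
    then show False using small[OF _ X(1)] X(3) by fastforce
  next
    assume "verts G - lift X = {p2, q2, r2}"
    then have "verts M - X \<subseteq> ?VT" using sub(3)[OF X(1)] eq by simp
    then show False using small[of "verts M - X"] X(4) by fastforce
  qed
qed

section \<open>Irreducible graphs and the final induction\<close>

definition terminal_factor :: "graph \<Rightarrow> nat set \<Rightarrow> bool" where
  "terminal_factor G C \<longleftrightarrow> (\<not> cyc_edge_conn 4 G \<longrightarrow> (\<exists>T. circuit G T \<and> card T = 3 \<and>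
     edge_verts G C \<inter> edge_verts G T \<noteq> {} \<and> cyc_edge_conn 4 (contract G T)))"

text \<open>A 2-cut always reduces, so an irreducible graph has none. If it is not cyclically
  4-edge-connected, it has a nontrivial 3-cut, and the bad triangle there meets the core in the
  uncovered edge \<open>g\<close>.\<close>

lemma hex_terminal:
  assumes h: "hex_cover G k" and nr: "\<not> hex_reduces G k"
  shows "terminal_factor G (core_edges G k)"
  unfolding terminal_factor_def
proof
  assume nc: "\<not> cyc_edge_conn 4 G"
  note G = hex_coverD(1)[OF h]
  have n2: "card (crossing G X) \<noteq> 2" if "proper_cut G X" for X using hex_two_cut[OF h that] nr by blast
  then have no2: "no_two_cut G" unfolding no_two_cut_def by blast
  obtain X where X: "proper_cut G X" "card (crossing G X) = 3" "2 \<le> card X" "2 \<le> card (verts G - X)"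
    by (rule three_cutE[OF G n2 nc])
  obtain p q r g d1 d2 f1 f2 f3 where T: "bad_triangle G k p q r g d1 d2 f1 f2 f3"
    using three_cut_bad_triangle[OF h X no2 nr] by blast
  note t = bad_triangleD[OF T]
  note b = bad_triangle_edges[OF G T]
  have "g \<in> core_edges G k" using b(1) t(11) unfolding core_edges_def by simp
  moreover have "incident G g p" using in_star_iff[OF G, of g p] t(8) by simp
  ultimately have "p \<in> edge_verts G (core_edges G k)" unfolding edge_verts_def by blast
  then have "edge_verts G (core_edges G k) \<inter> edge_verts G {g, d1, d2} \<noteq> {}" unfolding b(2) by blast
  moreover have "card {g, d1, d2} = 3" using t(7) by simp
  ultimately show "\<exists>T. circuit G T \<and> card T = 3 \<and>
     edge_verts G (core_edges G k) \<inter> edge_verts G T \<noteq> {} \<and> cyc_edge_conn 4 (contract G T)"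
    using bad_triangle_circuit[OF G T] bad_triangle_contract[OF h no2 nr T] by blast
qed

text \<open>Each reduction splits off a colourable part, which \<open>tait_factorizes\<close>
  decomposes completely; the recursion follows the part with the core. Since every round preserves
  the core as a set of labels, the last factor has the original core.\<close>

lemma hex_factorizes:
  assumes "hex_cover G k"
  shows "\<exists>H k1 D. factorizes G ({#H#} + D) \<and> hex_cover H k1 \<and> core_edges H k1 = core_edges G k \<and>
    colour_factors D \<and> terminal_factor H (core_edges H k1)"
  using assms
proof (induction "card (verts G)" arbitrary: G k rule: less_induct)
  case less
  show ?case
  proof (cases "hex_reduces G k")
    case True
    then obtain G' k' K where r: "hex_cover G' k'" "core_edges G' k' = core_edges G k" "bridgeless_cubic K"
      "tait K" "card (verts G') < card (verts G)"
      and fac: "\<forall>D1 D2. factorizes G' D1 \<longrightarrow> factorizes K D2 \<longrightarrow> factorizes G (D1 + D2)"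
      unfolding hex_reduces_def by blast
    obtain H k1 D1 where H: "factorizes G' ({#H#} + D1)" "hex_cover H k1" "core_edges H k1 = core_edges G' k'"
      "colour_factors D1" "terminal_factor H (core_edges H k1)"
      using less.hyps[OF r(5,1)] by blast
    obtain D2 where D2: "factorizes K D2" "colour_factors D2" using tait_factorizes[OF r(3,4)] by blast
    have "factorizes G ({#H#} + (D1 + D2))" using fac H(1) D2(1) by (metis add.assoc)
    then show ?thesis using H(2,5) H(3)[unfolded r(2)] colour_factors_add[OF H(4) D2(2)] by blast
  next
    case False
    have "factorizes G ({#G#} + {#})" using factorizes_refl by simp
    moreover have "colour_factors {#}" unfolding colour_factors_def by simp
    ultimately show ?thesis using less.prems hex_terminal[OF less.prems False] by blast
  qed
qed

theorem theorem4p3: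
  assumes "cubic G" and "two_connected G" and "df G = 3" and "hexagonal_core G C"
  shows "\<exists>Gs. Gs \<noteq> [] \<and> decomposition G (mset Gs) \<and>
     (\<forall>i. 1 \<le> i \<and> i < length Gs \<longrightarrow> cyc_edge_conn 4 (Gs ! i)) \<and>
     df (Gs ! 0) = 3 \<and> hexagonal_core (Gs ! 0) C \<and>
     (\<forall>i. 1 \<le> i \<and> i < length Gs \<longrightarrow> three_edge_colourable (Gs ! i)) \<and>
     (\<not> cyc_edge_conn 4 (Gs ! 0) \<longrightarrow>
        (\<exists>T. circuit (Gs ! 0) T \<and> card T = 3 \<and>
             edge_verts (Gs ! 0) C \<inter> edge_verts (Gs ! 0) T \<noteq> {} \<and>
             cyc_edge_conn 4 (contract (Gs ! 0) T))) \<and>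
     reconstructs (mset Gs) G"
proof -
  have G: "bridgeless_cubic G" using assms(1,2) bridgeless_cubic_iff by blast
  obtain k where k: "hex_cover G k" "C = {e\<in>edges G. card (k e) \<noteq> 1}"
    by (rule hexagonal_coreE[OF G assms(4)])
  have C: "C = core_edges G k" using k(2) unfolding core_edges_def .
  obtain H k1 D where H: "factorizes G ({#H#} + D)" "hex_cover H k1" "core_edges H k1 = core_edges G k"
    "colour_factors D" "terminal_factor H (core_edges H k1)"
    using hex_factorizes[OF k(1)] by blast
  obtain Ds where Ds: "mset Ds = D" using ex_mset by blast
  have m: "mset (H # Ds) = {#H#} + D" using Ds by simp
  have tail: "cyc_edge_conn 4 ((H # Ds) ! i) \<and> three_edge_colourable ((H # Ds) ! i)"
    if i: "1 \<le> i \<and> i < length (H # Ds)" for i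
  proof -
    obtain j where j: "i = Suc j" "j < length Ds" using i by (cases i) auto
    then have "Ds ! j \<in># D" using Ds by (metis nth_mem set_mset_mset)
    then have "cyc_edge_conn 4 (Ds ! j) \<and> three_edge_colourable (Ds ! j)"
      using H(4) unfolding colour_factors_def by blast
    then show ?thesis using j(1) by simp
  qed
  have core: "core_edges H k1 = C" using H(3) C by simp
  have hd: "df H = 3" "hexagonal_core H C"
    using hexagonal_coreI[OF H(2)] core unfolding core_edges_def by simp_all
  have trm: "\<not> cyc_edge_conn 4 H \<longrightarrow> (\<exists>T. circuit H T \<and> card T = 3 \<and>
     edge_verts H C \<inter> edge_verts H T \<noteq> {} \<and> cyc_edge_conn 4 (contract H T))"
    using H(5) unfolding terminal_factor_def core .
  have dec: "decomposition G (mset (H # Ds))" "reconstructs (mset (H # Ds)) G"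
    using H(1) unfolding factorizes_def m by simp_all
  show ?thesis
    by (rule exI[of _ "H # Ds"]) (use tail hd trm dec in simp)
qed

end
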